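(* Let $\alpha,\beta\in\mathbb{R}$ with $\beta<3$ and $2\alpha\ge\beta$. There exist constants $c_1>0$ and $c_2>0$, independent of $\varepsilon$, $x$ and the minimizer, such that the following holds. Let $\varepsilon>0$, let $u_*$ be a global minimizer of $\mathsf{E}_\varepsilon$ in $\mathcal{A}$, and for $x\in[0,1]$ let $$\varphi(x)=\int_0^x\left(\varepsilon\,t^\alpha\,|u_*''|+t^{-\beta}\,u_*^2\right)dt .$$ If $x\in[0,1]$ satisfies $x\ge c_1\,\varepsilon^{2/(9-3\beta)}$, then $$\varphi(x)\le c_2\,x\,\varepsilon^{2/3}.$$
   Context: For real constants $\alpha,\beta$ and $\varepsilon>0$, $\mathcal{A}$ is the set of $u\in H^1([0,1])$ with $|u'|=1$ a.e., $u'\in BV_{\rm loc}((0,1))$ and $u(0)=u(1)=0$. For $u\in\mathcal{A}$, $$\mathsf{E}_\varepsilon(u)=\int_0^1\left(\varepsilon\,t^\alpha\,|u''|+t^{-\beta}\,u^2\right)dt\in[0,+\infty],$$ where $u''$ is the distributional derivative of $u'$ (a signed Radon measure on $(0,1)$) and, for $0<x\le1$, $\int_0^x t^\alpha|u''|\,dt$ means $\int_{(0,x)}t^\alpha\,d|u''|(t)$, with $|u''|$ the total variation measure. Equivalently, it is $2\sum t^\alpha$ summed over the jump points $t\in(0,x)$ of $u'$. *)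

theory Defs
  imports "HOL-Analysis.Analysis"
begin

section \<open>Weak derivatives and measure derivatives on $(0,1)$\<close>

text \<open>
  Functions on the interval are total functions on the reals; the notions below depend only on
  the values on \<open>{0<..<1}\<close>.  Test functions are $C^1_c((0,1))$, as is customary for Sobolev and
  $BV$ functions.
\<close>

definition test_fun :: "(real \<Rightarrow> real) \<Rightarrow> bool" where
  "test_fun \<phi> \<longleftrightarrow> \<phi> C1_differentiable_on UNIV \<and>
     (\<exists>a b. 0 < a \<and> a < b \<and> b < 1 \<and> (\<forall>t. t \<notin> {a..b} \<longrightarrow> \<phi> t = 0))"

definition loc_integrable :: "(real \<Rightarrow> real) \<Rightarrow> bool" where
  "loc_integrable g \<longleftrightarrow> (\<forall>a b. 0 < a \<longrightarrow> b < 1 \<longrightarrow> set_integrable lebesgue {a..b} g)"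

definition weak_deriv :: "(real \<Rightarrow> real) \<Rightarrow> (real \<Rightarrow> real) \<Rightarrow> bool" where
  "weak_deriv u g \<longleftrightarrow> loc_integrable u \<and> loc_integrable g \<and>
     (\<forall>\<phi>. test_fun \<phi> \<longrightarrow>
        (LINT t:{0<..<1}|lebesgue. u t * deriv \<phi> t) = - (LINT t:{0<..<1}|lebesgue. g t * \<phi> t))"

text \<open>Positive Radon measures on the open interval $(0,1)$; mass may accumulate at $0$ and $1$.\<close>

definition radon01 :: "real measure \<Rightarrow> bool" where
  "radon01 M \<longleftrightarrow> sets M = sets (restrict_space borel {0<..<1}) \<and>
     (\<forall>a b. 0 < a \<longrightarrow> b < 1 \<longrightarrow> emeasure M {a..b} < \<infinity>)"

text \<open>
  A signed Radon measure on $(0,1)$ need not have a well-defined value on all Borel sets, so it is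
  represented as a formal difference $P - N$ of positive Radon measures.  The following says that
  it is the distributional derivative of \<open>g\<close>.
\<close>

definition measure_deriv :: "(real \<Rightarrow> real) \<Rightarrow> real measure \<Rightarrow> real measure \<Rightarrow> bool" where
  "measure_deriv g P N \<longleftrightarrow> radon01 P \<and> radon01 N \<and>
     (\<forall>\<phi>. test_fun \<phi> \<longrightarrow>
        (LINT t:{0<..<1}|lebesgue. g t * deriv \<phi> t) = - ((LINT t|P. \<phi> t) - (LINT t|N. \<phi> t)))"

definition BV_loc :: "(real \<Rightarrow> real) \<Rightarrow> bool" where
  "BV_loc g \<longleftrightarrow> loc_integrable g \<and> (\<exists>P N. measure_deriv g P N)"

definition mutually_singular01 :: "real measure \<Rightarrow> real measure \<Rightarrow> bool" where
  "mutually_singular01 P N \<longleftrightarrow>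
     (\<exists>S. S \<in> sets (restrict_space borel {0<..<1}) \<and>
        emeasure P S = 0 \<and> emeasure N ({0<..<1} - S) = 0)"

text \<open>
  \<open>is_tv_second_deriv u M\<close>: \<open>M\<close> is the total variation measure $|u''| = P + N$, where $(P, N)$ is
  the Jordan decomposition of the distributional derivative of $u'$.
\<close>

definition is_tv_second_deriv :: "(real \<Rightarrow> real) \<Rightarrow> real measure \<Rightarrow> bool" where
  "is_tv_second_deriv u M \<longleftrightarrow>
     (\<exists>g P N. weak_deriv u g \<and> measure_deriv g P N \<and> mutually_singular01 P N \<and>
        sets M = sets (restrict_space borel {0<..<1}) \<and>
        (\<forall>A \<in> sets M. emeasure M A = emeasure P A + emeasure N A))"

text \<open>
  Well-defined whenever $u'$ is in $BV_{loc}$: the weak derivative is unique almost everywhere and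
  the Jordan decomposition is unique.
\<close>

definition tv_second_deriv :: "(real \<Rightarrow> real) \<Rightarrow> real measure" where
  "tv_second_deriv u = (THE M. is_tv_second_deriv u M)"

section \<open>The admissible class and the energy\<close>

text \<open>$H^1([0,1])$; continuity selects the representative for which boundary values make sense.\<close>

definition H1_01 :: "(real \<Rightarrow> real) \<Rightarrow> bool" where
  "H1_01 u \<longleftrightarrow> continuous_on {0..1} u \<and> set_integrable lebesgue {0<..<1} (\<lambda>t. (u t)\<^sup>2) \<and>
     (\<exists>g. weak_deriv u g \<and> set_integrable lebesgue {0<..<1} (\<lambda>t. (g t)\<^sup>2))"

definition admissible :: "(real \<Rightarrow> real) set" where
  "admissible = {u. H1_01 u \<and>
     (\<exists>g. weak_deriv u g \<and> (AE t in lebesgue. t \<in> {0<..<1} \<longrightarrow> \<bar>g t\<bar> = 1) \<and> BV_loc g) \<and>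
     u 0 = 0 \<and> u 1 = 0}"

text \<open>The energy on $(0,x)$, in $[0,+\infty]$, for $0 \le x \le 1$.\<close>

definition energy_upto ::
  "real \<Rightarrow> real \<Rightarrow> real \<Rightarrow> (real \<Rightarrow> real) \<Rightarrow> real \<Rightarrow> ennreal" where
  "energy_upto \<alpha> \<beta> \<epsilon> u x =
     (\<integral>\<^sup>+ t \<in> {0<..<x}. ennreal (\<epsilon> * t powr \<alpha>) \<partial>tv_second_deriv u) +
     (\<integral>\<^sup>+ t \<in> {0<..<x}. ennreal (t powr (- \<beta>) * (u t)\<^sup>2) \<partial>lebesgue)"

definition energy :: "real \<Rightarrow> real \<Rightarrow> real \<Rightarrow> (real \<Rightarrow> real) \<Rightarrow> ennreal" where
  "energy \<alpha> \<beta> \<epsilon> u = energy_upto \<alpha> \<beta> \<epsilon> u 1"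

definition global_minimizer :: "real \<Rightarrow> real \<Rightarrow> real \<Rightarrow> (real \<Rightarrow> real) \<Rightarrow> bool" where
  "global_minimizer \<alpha> \<beta> \<epsilon> u \<longleftrightarrow>
     u \<in> admissible \<and> (\<forall>v \<in> admissible. energy \<alpha> \<beta> \<epsilon> u \<le> energy \<alpha> \<beta> \<epsilon> v)"

end

theory Submission
  imports Defs
begin

text \<open>
  Put \<open>e = \<epsilon> powr (1/3)\<close>.  Zigzags whose teeth near \<open>t\<close> have width about \<open>e t powr (\<beta> / 2)\<close> show that
  on \<open>{0..y}\<close> there are competitors of energy \<open>O(y e\<^sup>2)\<close> vanishing at \<open>y\<close>; reaching a prescribed value
  \<open>m\<close> at \<open>y\<close> costs an additional \<open>O(y powr (- \<beta>) \<bar>m\<bar> ^ 3)\<close>.  Gluing such a competitor to the minimizer at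
  \<open>y\<close> bounds \<open>\<phi> y\<close> by this amount with \<open>m = u y\<close>.  For \<open>y\<close> in \<open>{x<..<2 * x}\<close> with
  \<open>y powr (- \<beta>) (u y)\<^sup>2 = O(\<phi> (2 * x) / x)\<close>, the bound \<open>\<phi> 1 = O(e\<^sup>2)\<close> on the total energy and the
  lower bound on \<open>x\<close> make \<open>\<bar>u y\<bar> / x\<close> small, so \<open>\<phi> x \<le> O(x e\<^sup>2) + \<phi> (2 * x) / 4\<close>, and dyadic induction
  from \<open>x > 1 / 2\<close> downwards concludes.
\<close>

section \<open>Sums of measures, point masses and Radon measures on the unit interval\<close>

text \<open>A tent of width \<open>d\<close> near \<open>t\<close> costs about
  \<open>e ^ 3 * t powr \<alpha>\<close> in kinks and \<open>d ^ 3 * t powr (- \<beta>)\<close> in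
  elastic energy. For \<open>t \<le> 1\<close> the assumption
  \<open>2 * \<alpha> \<ge> \<beta>\<close> bounds the former by
  \<open>e ^ 3 * t powr (\<beta> / 2)\<close>, and the two balance at
  \<open>d = e * t powr (\<beta> / 2)\<close>, with energy of order \<open>e\<^sup>2\<close> per
  unit length. A single tent, of finite energy because \<open>\<beta> < 3\<close>, ends the
  construction at 0. The exponent in the lower bound on \<open>x\<close> comes from the total
  energy: it only gives \<open>(u y)\<^sup>2\<close> of order
  \<open>y powr (\<beta> - 1) * e\<^sup>2\<close>, which is small against \<open>y\<^sup>2\<close>
  when \<open>e\<^sup>2\<close> is small against \<open>x powr (3 - \<beta>)\<close>. Since the cost
  of the end value is cubic, one factor \<open>\<bar>u y\<bar>\<close> is left to supply the small
  factor of the contraction. The obstacle is that the minimizer is known only through weak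
  derivatives. Slopes are therefore handled as functionals on test functions: pieces are glued by
  adding functionals, with one point mass per kink. Any representation by two Radon measures bounds
  the energy from above, since the Jordan decomposition is the smallest one.\<close>

definition madd :: "'a measure \<Rightarrow> 'a measure \<Rightarrow> 'a measure" where
  "madd M N = measure_of (space M) (sets M) (\<lambda>A. emeasure M A + emeasure N A)"

lemma space_madd [simp]: "space (madd M N) = space M"
  and sets_madd [simp, measurable_cong]: "sets (madd M N) = sets M"
  by (simp_all add: madd_def)

lemma emeasure_madd:
  assumes "sets N = sets M" "A \<in> sets M"
  shows "emeasure (madd M N) A = emeasure M A + emeasure N A"
  unfolding madd_def
proof (rule emeasure_measure_of_sigma[OF _ _ _ assms(2)])
  show "sigma_algebra (space M) (sets M)" ..
  show "positive (sets M) (\<lambda>A. emeasure M A + emeasure N A)"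
    by (simp add: positive_def)
  show "countably_additive (sets M) (\<lambda>A. emeasure M A + emeasure N A)"
  proof (rule countably_additiveI)
    fix A :: "nat \<Rightarrow> 'a set"
    assume A: "range A \<subseteq> sets M" "disjoint_family A" "(\<Union>i. A i) \<in> sets M"
    then have "(\<Sum>i. emeasure M (A i)) = emeasure M (\<Union>i. A i)"
      "(\<Sum>i. emeasure N (A i)) = emeasure N (\<Union>i. A i)"
      by (auto intro!: suminf_emeasure simp: assms(1))
    then show "(\<Sum>i. emeasure M (A i) + emeasure N (A i)) = emeasure M (\<Union>i. A i) + emeasure N (\<Union>i. A i)"
      by (simp add: suminf_add[symmetric])
  qed
qed

lemma nn_integral_madd:
  assumes s: "sets N = sets M" and "f \<in> borel_measurable M"
  shows "(\<integral>\<^sup>+ x. f x \<partial>madd M N) = (\<integral>\<^sup>+ x. f x \<partial>M) + (\<integral>\<^sup>+ x. f x \<partial>N)"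
  using assms(2)
proof (induction rule: borel_measurable_induct)
  case (cong f g)
  have "space N = space M" using s by (rule sets_eq_imp_space_eq)
  with cong show ?case
    by (metis (no_types, lifting) nn_integral_cong space_madd)
next
  case (set A)
  then show ?case using s by (simp add: emeasure_madd)
next
  case (mult u c)
  have [measurable]: "u \<in> borel_measurable M" "u \<in> borel_measurable N"
    using mult s by (auto cong: measurable_cong_sets)
  have [measurable]: "u \<in> borel_measurable (madd M N)" by measurable
  show ?case using mult by (simp add: nn_integral_cmult distrib_left)
next
  case (add u v)
  have [measurable]: "u \<in> borel_measurable M" "u \<in> borel_measurable N" "v \<in> borel_measurable M" "v \<in> borel_measurable N"
    using add s by (auto cong: measurable_cong_sets)
  have [measurable]: "u \<in> borel_measurable (madd M N)" "v \<in> borel_measurable (madd M N)" by measurable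
  show ?case using add by (simp add: nn_integral_add algebra_simps)
next
  case (seq U)
  have [measurable]: "\<And>i. U i \<in> borel_measurable M" "\<And>i. U i \<in> borel_measurable N"
    using seq s by (auto cong: measurable_cong_sets)
  have [measurable]: "\<And>i. U i \<in> borel_measurable (madd M N)" by measurable
  have m: "incseq (\<lambda>i. integral\<^sup>N M (U i))" "incseq (\<lambda>i. integral\<^sup>N N (U i))"
    using seq(3) by (auto simp: incseq_def le_fun_def intro!: nn_integral_mono)
  have e: "(\<integral>\<^sup>+ x. (SUP i. U i) x \<partial>K) = (SUP i. integral\<^sup>N K (U i))" if "\<And>i. U i \<in> borel_measurable K" for K
    using that seq(3) by (simp add: image_comp nn_integral_monotone_convergence_SUP)
  show ?case
    using seq.IH by (simp add: e ennreal_SUP_add[OF m] del: Sup_apply SUP_apply)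
qed

lemma integral_madd:
  fixes f :: "'a \<Rightarrow> real"
  assumes s: "sets N = sets M" and M: "integrable M f" and N: "integrable N f"
  shows "integral\<^sup>L (madd M N) f = integral\<^sup>L M f + integral\<^sup>L N f" "integrable (madd M N) f"
proof -
  have [measurable]: "f \<in> borel_measurable M" using M by auto
  have a: "f \<in> borel_measurable (madd M N)" by measurable
  have nn: "(\<integral>\<^sup>+ x. ennreal (norm (f x)) \<partial>madd M N) < \<infinity>"
    using M N by (simp add: nn_integral_madd s integrable_iff_bounded)
  show i: "integrable (madd M N) f" using a nn by (rule integrableI_bounded)
  \<comment> \<open>\<open>enn2real\<close> splits a sum only when both terms are finite;
    integrability supplies this for the positive and the negative part.\<close>
  have *: "(\<integral>\<^sup>+ x. ennreal (f x) \<partial>K) < top" "(\<integral>\<^sup>+ x. ennreal (- f x) \<partial>K) < top" if "integrable K f" for K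
    using that by (auto simp: real_integrable_def top.not_eq_extremum)
  show "integral\<^sup>L (madd M N) f = integral\<^sup>L M f + integral\<^sup>L N f"
    using *[OF M] *[OF N]
    by (simp add: real_lebesgue_integral_def i M N nn_integral_madd s enn2real_plus)
qed

text \<open>The Dirac mass is transported to the Borel sets of the open interval so that it carries
  the sigma-algebra demanded by \<open>radon01\<close>.\<close>

definition point_mass :: "real \<Rightarrow> real \<Rightarrow> real measure" where
  "point_mass a s = distr (point_measure {a} (\<lambda>_. ennreal s)) (restrict_space borel {0<..<1}) (\<lambda>x. x)"

lemma sets_point_mass [simp, measurable_cong]: "sets (point_mass a s) = sets (restrict_space borel {0<..<1})"
  by (simp add: point_mass_def)

lemma point_mass_measurable: "a \<in> {0<..<1} \<Longrightarrow>
  (\<lambda>x. x) \<in> measurable (point_measure {a} (\<lambda>_. ennreal s)) (restrict_space borel {0<..<1})"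
  by (simp add: space_restrict_space)

lemma nn_integral_point_mass:
  assumes "a \<in> {0<..<1}" "f \<in> borel_measurable (restrict_space borel {0<..<1::real})"
  shows "(\<integral>\<^sup>+ x. f x \<partial>point_mass a s) = ennreal s * f a"
  using assms unfolding point_mass_def
  by (subst nn_integral_distr[OF point_mass_measurable]) (auto simp: nn_integral_point_measure_finite mult.commute)

lemma integral_point_mass:
  fixes f :: "real \<Rightarrow> real"
  assumes "a \<in> {0<..<1}" "f \<in> borel_measurable (restrict_space borel {0<..<1::real})" "s \<ge> 0"
  shows "(\<integral>x. f x \<partial>point_mass a s) = s * f a"
  using assms unfolding point_mass_def
  by (subst integral_distr[OF point_mass_measurable]) (auto simp: lebesgue_integral_point_measure_finite)

lemma radon01_point_mass:
  assumes "a \<in> {0<..<1}"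
  shows "radon01 (point_mass a s)"
  unfolding radon01_def
proof (intro conjI allI impI)
  fix c d :: real assume "0 < c" "d < 1"
  then have "{c..d} \<in> sets (restrict_space borel {0<..<1})"
    by (auto simp: sets_restrict_space image_iff intro!: bexI[of _ "{c..d}"])
  then have "emeasure (point_mass a s) {c..d} = (\<integral>\<^sup>+ x. indicator {c..d} x \<partial>point_mass a s)"
    by simp
  also have "\<dots> = ennreal s * indicator {c..d} a"
    using assms by (intro nn_integral_point_mass) (auto intro!: measurable_restrict_space1)
  also have "\<dots> < \<infinity>" by (simp add: indicator_def)
  finally show "emeasure (point_mass a s) {c..d} < \<infinity>" .
qed simp

section \<open>Radon measures on the open unit interval\<close>

lemma Icc_in_sets_restrict: "0 < a \<Longrightarrow> b < 1 \<Longrightarrow> {a..b} \<in> sets (restrict_space borel {0<..<1::real})"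
  by (auto simp: sets_restrict_space image_iff intro!: bexI[of _ "{a..b}"])

lemma radon01_sets: "radon01 M \<Longrightarrow> sets M = sets (restrict_space borel {0<..<1})"
  and radon01_finite: "radon01 M \<Longrightarrow> 0 < a \<Longrightarrow> b < 1 \<Longrightarrow> emeasure M {a..b} < \<infinity>"
  by (auto simp: radon01_def)

lemma radon01_space: "radon01 M \<Longrightarrow> space M = {0<..<1}"
  using radon01_sets[of M, THEN sets_eq_imp_space_eq] by (simp add: space_restrict_space)

lemma radon01_measurable: "radon01 M \<Longrightarrow> f \<in> borel_measurable borel \<Longrightarrow> f \<in> borel_measurable M"
  by (metis measurable_cong_sets measurable_restrict_space1 radon01_sets)

lemma radon01_madd: "radon01 M \<Longrightarrow> radon01 N \<Longrightarrow> radon01 (madd M N)"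
  unfolding radon01_def by (auto simp: emeasure_madd Icc_in_sets_restrict)

lemma radon01_le:
  assumes "radon01 M" "sets N = sets M" "\<And>A. A \<in> sets M \<Longrightarrow> emeasure N A \<le> emeasure M A"
  shows "radon01 N"
  unfolding radon01_def
proof (intro conjI allI impI)
  fix a b :: real assume "0 < a" "b < 1"
  then show "emeasure N {a..b} < \<infinity>"
    using assms(3)[of "{a..b}"] radon01_finite[OF assms(1), of a b] radon01_sets[OF assms(1)]
    by (metis Icc_in_sets_restrict order_le_less_trans)
qed (use assms radon01_sets in auto)

text \<open>Mass may accumulate at 0 and 1, so finiteness is available only on an exhaustion by
  compact subintervals. This is what Radon-Nikodym will be applied with.\<close>

lemma radon01_sigma_finite: "radon01 M \<Longrightarrow> sigma_finite_measure M"
proof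
  assume M: "radon01 M"
  let ?A = "\<lambda>n. {1 / (real n + 1) .. 1 - 1 / (real n + 1)}"
  have "(\<Union>n. ?A n) = {0<..<1}"
  proof (intro equalityI subsetI)
    fix x :: real assume "x \<in> {0<..<1}"
    then have "min x (1 - x) > 0" by auto
    then obtain n where "inverse (real (Suc n)) < min x (1 - x)" using reals_Archimedean by blast
    then have "x \<in> ?A n" by (auto simp: field_simps)
    then show "x \<in> (\<Union>n. ?A n)" by blast
  next
    fix x assume "x \<in> (\<Union>n. ?A n)"
    then obtain n where n: "x \<in> ?A n" by blast
    have "0 < 1 / (real n + 1)" by simp
    with n show "x \<in> {0<..<1}"
      unfolding atLeastAtMost_iff greaterThanLessThan_iff by linarith
  qed
  moreover have "?A n \<in> sets M" "emeasure M (?A n) \<noteq> \<infinity>" for n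
    using Icc_in_sets_restrict[of "1 / (real n + 1)" "1 - 1 / (real n + 1)"]
     radon01_finite[OF M, of "1 / (real n + 1)" "1 - 1 / (real n + 1)"] radon01_sets[OF M] by auto
  ultimately show "\<exists>A. countable A \<and> A \<subseteq> sets M \<and> \<Union> A = space M \<and> (\<forall>a\<in>A. emeasure M a \<noteq> \<infinity>)"
    by (intro exI[of _ "range ?A"]) (auto simp: radon01_space[OF M])
qed

lemma radon01_integrable:
  fixes f :: "real \<Rightarrow> real"
  assumes M: "radon01 M" and f: "f \<in> borel_measurable borel" and ab: "0 < a" "b < 1"
    and supp: "\<And>t. t \<notin> {a..b} \<Longrightarrow> f t = 0" and B: "\<And>t. \<bar>f t\<bar> \<le> B"
  shows "integrable M f"
proof -
  have s: "{a..b} \<in> sets M" using ab Icc_in_sets_restrict radon01_sets[OF M] by auto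
  have "integrable M (\<lambda>t. B * indicator {a..b} t)"
    using s radon01_finite[OF M ab] by (intro integrable_mult_right integrable_real_indicator) auto
  then show ?thesis
  proof (rule Bochner_Integration.integrable_bound)
    show "f \<in> borel_measurable M" using M f by (rule radon01_measurable)
    show "AE x in M. norm (f x) \<le> norm (B * indicator {a..b} x)"
    proof (rule AE_I2)
      fix t show "norm (f t) \<le> norm (B * indicator {a..b} t)"
        using B[of t] supp[of t] by (auto simp: indicator_def)
    qed
  qed
qed

section \<open>Test functions and cutoffs\<close>

lemma test_funD:
  assumes "test_fun \<phi>"
  shows test_fun_deriv: "(\<phi> has_real_derivative deriv \<phi> t) (at t)"
    and test_fun_cont_deriv: "continuous_on UNIV (deriv \<phi>)"
    and test_fun_cont: "continuous_on UNIV \<phi>"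
proof -
  from assms obtain D where D: "\<And>x. (\<phi> has_vector_derivative D x) (at x)" "continuous_on UNIV D"
    unfolding test_fun_def C1_differentiable_on_def by auto
  then have *: "(\<phi> has_real_derivative D x) (at x)" for x
    by (simp add: has_real_derivative_iff_has_vector_derivative)
  then have d: "deriv \<phi> = D" by (auto intro!: ext DERIV_imp_deriv)
  show "(\<phi> has_real_derivative deriv \<phi> t) (at t)" "continuous_on UNIV (deriv \<phi>)"
    using * D d by auto
  show "continuous_on UNIV \<phi>"
    using * by (meson DERIV_continuous_on DERIV_subset subset_UNIV)
qed

lemma test_fun_measurable [measurable (raw)]:
  assumes "test_fun \<phi>"
  shows "\<phi> \<in> borel_measurable borel" "deriv \<phi> \<in> borel_measurable borel"
  using test_funD[OF assms] by (auto intro: borel_measurable_continuous_onI)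

lemma deriv_zero_outside:
  fixes \<phi> :: "real \<Rightarrow> real"
  assumes "\<And>t. t \<notin> {a..b} \<Longrightarrow> \<phi> t = 0" "t \<notin> {a..b}"
  shows "deriv \<phi> t = 0"
proof -
  have "(\<phi> has_real_derivative 0) (at t)"
  proof (rule has_field_derivative_transform_within_open)
    show "((\<lambda>_. 0) has_real_derivative 0) (at t)" by simp
    show "open (- {a..b})" by auto
    show "t \<in> - {a..b}" using assms(2) by simp
    show "0 = \<phi> x" if "x \<in> - {a..b}" for x using assms(1)[of x] that by simp
  qed
  then show ?thesis by (rule DERIV_imp_deriv)
qed

lemma continuous_bounded_support:
  fixes f :: "real \<Rightarrow> real"
  assumes "continuous_on UNIV f" "\<And>t. t \<notin> {a..b} \<Longrightarrow> f t = 0"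
  obtains B where "B > 0" "\<And>t. \<bar>f t\<bar> \<le> B"
proof -
  have "compact (f ` {a..b})"
    using assms(1) by (intro compact_continuous_image) (auto intro: continuous_on_subset)
  then have "bounded (f ` {a..b})" by (rule compact_imp_bounded)
  then obtain B where B: "B > 0" "\<forall>y \<in> f ` {a..b}. norm y \<le> B"
    unfolding bounded_pos by blast
  have "\<bar>f t\<bar> \<le> B" for t
    using B assms(2)[of t] by (cases "t \<in> {a..b}") auto
  with B(1) show ?thesis by (rule that)
qed

lemma test_fun_support:
  assumes "test_fun \<phi>"
  obtains a b B where "0 < a" "a < b" "b < 1" "B > 0" "\<And>t. t \<notin> {a..b} \<Longrightarrow> \<phi> t = 0"
    "\<And>t. t \<notin> {a..b} \<Longrightarrow> deriv \<phi> t = 0" "\<And>t. \<bar>\<phi> t\<bar> \<le> B" "\<And>t. \<bar>deriv \<phi> t\<bar> \<le> B"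
proof -
  obtain a b where ab: "0 < a" "a < b" "b < 1" and z: "\<And>t. t \<notin> {a..b} \<Longrightarrow> \<phi> t = 0"
    using assms unfolding test_fun_def by blast
  have z': "\<And>t. t \<notin> {a..b} \<Longrightarrow> deriv \<phi> t = 0" using deriv_zero_outside z by blast
  obtain B1 where B1: "B1 > 0" "\<And>t. \<bar>\<phi> t\<bar> \<le> B1"
    using continuous_bounded_support[OF test_fun_cont[OF assms] z] by blast
  obtain B2 where B2: "B2 > 0" "\<And>t. \<bar>deriv \<phi> t\<bar> \<le> B2"
    using continuous_bounded_support[OF test_fun_cont_deriv[OF assms] z'] by blast
  show ?thesis
  proof (rule that[of a b "max B1 B2"])
    show "\<bar>\<phi> t\<bar> \<le> max B1 B2" "\<bar>deriv \<phi> t\<bar> \<le> max B1 B2" for t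
      using B1(2)[of t] B2(2)[of t] by (auto simp: le_max_iff_disj)
  qed (use ab z z' B1 in auto)
qed

lemma radon01_integrable_test: "radon01 M \<Longrightarrow> test_fun \<phi> \<Longrightarrow> integrable M \<phi>"
  using test_fun_measurable(1)[of \<phi>] test_fun_support[of \<phi>] radon01_integrable[of M \<phi>]
  by (smt (verit, best))

lemma test_fun_zero: "test_fun \<phi> \<Longrightarrow> t \<notin> {0<..<1} \<Longrightarrow> \<phi> t = 0"
  by (auto simp: test_fun_def)

lemma test_funI:
  fixes \<phi> D :: "real \<Rightarrow> real"
  assumes "\<And>t. (\<phi> has_real_derivative D t) (at t)" "continuous_on UNIV D"
    "0 < a" "a < b" "b < 1" "\<And>t. t \<notin> {a..b} \<Longrightarrow> \<phi> t = 0"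
  shows "test_fun \<phi>"
  unfolding test_fun_def C1_differentiable_on_def
  using assms by (auto simp: has_real_derivative_iff_has_vector_derivative)

section \<open>Piecewise quadratic cutoff functions\<close>

definition ramp2 :: "real \<Rightarrow> real" where "ramp2 t = (max 0 t)\<^sup>2"

lemma ramp2_deriv: "(ramp2 has_real_derivative 2 * max 0 t) (at t)"
proof (cases t "0::real" rule: linorder_cases)
  case less
  have "((\<lambda>_. 0) has_real_derivative 0) (at t)" by simp
  then have "(ramp2 has_real_derivative 0) (at t)"
    by (rule has_field_derivative_transform_within_open[of _ _ _ "{..<0}"]) (use less in \<open>auto simp: ramp2_def\<close>)
  then show ?thesis using less by simp
next
  case greater
  have "((\<lambda>t. t\<^sup>2) has_real_derivative 2 * t) (at t)" by (auto intro!: derivative_eq_intros)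
  then have "(ramp2 has_real_derivative 2 * t) (at t)"
    by (rule has_field_derivative_transform_within_open[of _ _ _ "{0<..}"]) (use greater in \<open>auto simp: ramp2_def\<close>)
  then show ?thesis using greater by simp
next
  case equal
  have "((\<lambda>h. max 0 h) \<longlongrightarrow> max 0 (0::real)) (at 0)"
    by (intro tendsto_intros)
  then have l: "((\<lambda>h. max 0 h) \<longlongrightarrow> (0::real)) (at 0)" by simp
  have "((\<lambda>h. (ramp2 (0 + h) - ramp2 0) / h) \<longlongrightarrow> 0) (at 0)"
    by (rule Lim_transform_eventually[OF l])
       (auto simp: eventually_at ramp2_def max_def power2_eq_square intro!: exI[of _ 1])
  then show ?thesis using equal by (simp add: DERIV_def)
qed

lemma ramp2_deriv':
  "(f has_real_derivative D) (at x) \<Longrightarrow> ((\<lambda>x. ramp2 (f x)) has_real_derivative 2 * max 0 (f x) * D) (at x)"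
  using DERIV_chain2[OF ramp2_deriv] by blast

text \<open>The coefficients make \<open>step\<close> a $C^1$ quadratic spline equal to 0 on \<open>{..0}\<close> and to 1 on
  \<open>{1..}\<close>, and \<open>hat\<close> its derivative.\<close>

definition step :: "real \<Rightarrow> real" where
  "step t = 2 * (ramp2 t - 2 * ramp2 (t - 1/2) + ramp2 (t - 1))"

definition hat :: "real \<Rightarrow> real" where
  "hat t = 4 * (max 0 t - 2 * max 0 (t - 1/2) + max 0 (t - 1))"

lemma step_deriv: "(step has_real_derivative hat t) (at t)"
  unfolding step_def[abs_def] hat_def
  by (rule DERIV_cong, (rule derivative_intros ramp2_deriv')+) simp

lemma step_deriv' [derivative_intros]:
  "(f has_real_derivative D) (at x) \<Longrightarrow> ((\<lambda>x. step (f x)) has_real_derivative hat (f x) * D) (at x)"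
  using DERIV_chain2[OF step_deriv] by blast

lemma continuous_on_hat [continuous_intros]: "continuous_on S f \<Longrightarrow> continuous_on S (\<lambda>t. hat (f t))"
  unfolding hat_def by (intro continuous_intros)

lemma hat_nonneg: "0 \<le> hat t" and hat_zero: "t \<le> 0 \<or> 1 \<le> t \<Longrightarrow> hat t = 0"
  unfolding hat_def by (auto simp: max_def)

lemma step_zero: "t \<le> 0 \<Longrightarrow> step t = 0" and step_one: "1 \<le> t \<Longrightarrow> step t = 1"
  unfolding step_def ramp2_def by (auto simp: max_def power2_eq_square algebra_simps)

lemma step_mono: "s \<le> t \<Longrightarrow> step s \<le> step t"
  by (rule DERIV_nonneg_imp_nondecreasing[of s t step]) (auto intro!: exI step_deriv hat_nonneg)

lemma step_bounds: "0 \<le> step t" "step t \<le> 1"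
  using step_mono[of "min t 0" t] step_mono[of t "max t 1"] by (auto simp: step_zero step_one)

lemma continuous_on_step [continuous_intros]: "continuous_on S f \<Longrightarrow> continuous_on S (\<lambda>t. step (f t))"
proof -
  have "continuous_on UNIV step" using step_deriv by (meson DERIV_continuous_on DERIV_subset subset_UNIV)
  then show "continuous_on S f \<Longrightarrow> continuous_on S (\<lambda>t. step (f t))"
    by (rule continuous_on_compose2) auto
qed

text \<open>The value 0 at \<open>s = 0\<close> matters: the cutoffs converge to indicators of open
  intervals and open half-lines, so atoms at an endpoint are excluded.\<close>

lemma step_LIMSEQ: "(\<lambda>n. step (real n * s)) \<longlonglongrightarrow> (if 0 < s then 1 else 0)"
proof (cases "0 < s")
  case True
  have "\<forall>\<^sub>F n in sequentially. 1 / s \<le> real n"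
    using filterlim_real_sequentially by (simp add: filterlim_at_top)
  then have "\<forall>\<^sub>F n in sequentially. step (real n * s) = 1"
    by eventually_elim (use True in \<open>simp add: step_one field_simps\<close>)
  then show ?thesis using True by (simp add: tendsto_eventually)
next
  case False
  then have "step (real n * s) = 0" for n by (intro step_zero) (auto simp: mult_nonneg_nonpos)
  then show ?thesis using False by simp
qed

lemma test_fun_mult:
  assumes "test_fun \<phi>" "\<And>t. (\<psi> has_real_derivative D t) (at t)" "continuous_on UNIV D"
  shows "test_fun (\<lambda>t. \<phi> t * \<psi> t)"
    "deriv (\<lambda>t. \<phi> t * \<psi> t) = (\<lambda>t. deriv \<phi> t * \<psi> t + \<phi> t * D t)"
proof -
  have d: "((\<lambda>t. \<phi> t * \<psi> t) has_real_derivative (deriv \<phi> t * \<psi> t + \<phi> t * D t)) (at t)" for t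
    using assms by (auto intro!: derivative_eq_intros test_fun_deriv)
  obtain a b where ab: "0 < a" "a < b" "b < 1" and z: "\<And>t. t \<notin> {a..b} \<Longrightarrow> \<phi> t = 0"
    using assms unfolding test_fun_def by blast
  have "continuous_on UNIV \<psi>"
    using assms(2) by (meson DERIV_continuous_on DERIV_subset subset_UNIV)
  then have "continuous_on UNIV (\<lambda>t. deriv \<phi> t * \<psi> t + \<phi> t * D t)"
    using assms test_funD by (auto intro!: continuous_intros)
  then show "test_fun (\<lambda>t. \<phi> t * \<psi> t)"
    using test_funI[OF d _ ab] z by auto
  show "deriv (\<lambda>t. \<phi> t * \<psi> t) = (\<lambda>t. deriv \<phi> t * \<psi> t + \<phi> t * D t)"
    using d by (auto intro!: ext DERIV_imp_deriv)
qed

text \<open>Products of two cutoffs are test functions tending to the indicator of an open interval,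
  so the measures agree on all intervals compactly contained in the unit interval. Such intervals
  generate the Borel sets, and an exhaustion extends the equality to sets of infinite
  measure.\<close>

lemma radon01_eqI:
  assumes P: "radon01 P" and N: "radon01 N"
    and eq: "\<And>\<phi>. test_fun \<phi> \<Longrightarrow> (\<integral>t. \<phi> t \<partial>P) = (\<integral>t. \<phi> t \<partial>N)"
  shows "P = N"
proof -
  have Ioo: "{a<..<b} \<in> sets M" if "radon01 M" "0 < a" "b < 1" for a b M
    using that radon01_sets[of M] by (auto simp: sets_restrict_space image_iff intro!: bexI[of _ "{a<..<b}"])
  have Ioo_fin: "emeasure M {a<..<b} < \<infinity>" if M: "radon01 M" "0 < a" "b < 1" for a b M
  proof -
    have "emeasure M {a<..<b} \<le> emeasure M {a..b}"
      by (rule emeasure_mono) (use M radon01_sets Icc_in_sets_restrict in auto)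
    also have "\<dots> < \<infinity>" using M by (rule radon01_finite)
    finally show ?thesis .
  qed
  have lim: "(\<lambda>n. \<integral>t. step (n * (t - a)) * step (n * (b - t)) \<partial>M) \<longlonglongrightarrow> measure M {a<..<b}"
    if M: "radon01 M" and ab: "0 < a" "a < b" "b < 1" for M a b
  proof -
    have "(\<lambda>n. \<integral>t. step (n * (t - a)) * step (n * (b - t)) \<partial>M) \<longlonglongrightarrow> (\<integral>t. indicator {a<..<b} t \<partial>M)"
    proof (rule integral_dominated_convergence[where w = "indicator {a..b}"])
      show "integrable M (indicat_real {a..b})"
        using M ab radon01_sets[OF M] Icc_in_sets_restrict radon01_finite[OF M, of a b]
        by (intro integrable_real_indicator) auto
      show "AE t in M. (\<lambda>n. step (real n * (t - a)) * step (real n * (b - t))) \<longlonglongrightarrow> indicat_real {a<..<b} t"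
      proof (rule AE_I2)
        fix t show "(\<lambda>n. step (real n * (t - a)) * step (real n * (b - t))) \<longlonglongrightarrow> indicat_real {a<..<b} t"
          using tendsto_mult[OF step_LIMSEQ[of "t - a"] step_LIMSEQ[of "b - t"]]
          by (auto simp: indicator_def split: if_splits)
      qed
      show "AE t in M. norm (step (real n * (t - a)) * step (real n * (b - t))) \<le> indicat_real {a..b} t" for n
      proof (rule AE_I2)
        fix t
        have "t \<notin> {a..b} \<Longrightarrow> step (real n * (t - a)) * step (real n * (b - t)) = 0"
          by (auto simp: not_le intro!: step_zero mult_nonneg_nonpos)
        then show "norm (step (real n * (t - a)) * step (real n * (b - t))) \<le> indicat_real {a..b} t"
          using step_bounds by (auto simp: indicator_def abs_mult mult_le_one)
      qed
      show "(\<lambda>t. step (real n * (t - a)) * step (real n * (b - t))) \<in> borel_measurable M" for n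
        using M by (rule radon01_measurable) (auto intro!: borel_measurable_continuous_onI continuous_intros)
      show "indicat_real {a<..<b} \<in> borel_measurable M" using M by (rule radon01_measurable) simp
    qed
    also have "(\<integral>t. indicator {a<..<b} t \<partial>M) = measure M {a<..<b}"
      using Ioo[OF M ab(1,3)] M ab by (simp add: radon01_space)
    finally show ?thesis .
  qed
  have test: "test_fun (\<lambda>t. step (real n * (t - a)) * step (real n * (b - t)))"
    if ab: "0 < a" "a < b" "b < 1" for n a b
  proof (rule test_funI[OF _ _ ab])
    show "((\<lambda>t. step (real n * (t - a)) * step (real n * (b - t))) has_real_derivative
       (hat (real n * (t - a)) * real n * step (real n * (b - t)) -
        step (real n * (t - a)) * hat (real n * (b - t)) * real n)) (at t)" for t
      by (auto intro!: derivative_eq_intros simp: algebra_simps)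
    show "t \<notin> {a..b} \<Longrightarrow> step (real n * (t - a)) * step (real n * (b - t)) = 0" for t
      by (auto simp: not_le intro!: step_zero mult_nonneg_nonpos)
  qed (auto intro!: continuous_intros)
  have Ioo_eq: "emeasure P {a<..<b} = emeasure N {a<..<b}" if "0 < a" "b < 1" for a b
  proof (cases "a < b")
    case True
    have "measure P {a<..<b} = measure N {a<..<b}"
      using LIMSEQ_unique[OF lim[OF P, of a b]] lim[OF N, of a b] eq[OF test[of a b]] that True by simp
    then show ?thesis
      using Ioo_fin P N that by (metis emeasure_eq_ennreal_measure infinity_ennreal_def less_irrefl)
  qed auto
  let ?J = "\<lambda>n. {1 / (real n + 1) <..< 1 - 1 / (real n + 1)}"
  \<comment> \<open>Restricting to \<open>?J n\<close> makes the measures finite on rays; pushing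
    them to the whole line makes the criterion for Borel measures that agree on all rays
    \<open>{x<..}\<close> applicable.\<close>
  let ?R = "\<lambda>M n. distr (density M (indicator (?J n))) borel (\<lambda>x. x)"
  have JS: "?J n \<in> sets M" if "radon01 M" for M n using Ioo[OF that] by simp
  have meas: "(\<lambda>x. x) \<in> measurable (density M f) borel" if "radon01 M" for M and f :: "real \<Rightarrow> ennreal"
    using radon01_measurable[OF that, of "\<lambda>x. x"] by simp
  have emR: "emeasure (?R M n) A = emeasure M (?J n \<inter> A)" if M: "radon01 M" and A: "A \<in> sets borel" for M n A
  proof -
    have AS: "A \<inter> {0<..<1} \<in> sets M"
      using A radon01_sets[OF M] by (auto simp: sets_restrict_space image_iff)
    have "emeasure (?R M n) A = emeasure (density M (indicator (?J n))) (A \<inter> {0<..<1})"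
      by (subst emeasure_distr[OF meas[OF M] A]) (simp add: radon01_space[OF M])
    also have "\<dots> = (\<integral>\<^sup>+x. indicator (?J n) x * indicator (A \<inter> {0<..<1}) x \<partial>M)"
      by (rule emeasure_density) (use AS JS[OF M] in auto)
    also have "\<dots> = (\<integral>\<^sup>+x. indicator (?J n \<inter> (A \<inter> {0<..<1})) x \<partial>M)"
      by (intro nn_integral_cong) (auto simp: indicator_def)
    also have "\<dots> = emeasure M (?J n \<inter> (A \<inter> {0<..<1}))"
      using AS JS[OF M] by (intro nn_integral_indicator) auto
    also have "?J n \<inter> (A \<inter> {0<..<1}) = ?J n \<inter> A"
      using sets.sets_into_space[OF JS[OF M, of n]]
      by (auto simp: radon01_space[OF M])
    finally show ?thesis .
  qed
  have JI: "?J n \<inter> {x<..} = {max x (1 / (real n + 1)) <..< 1 - 1 / (real n + 1)}" for x n by auto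
  have p: "0 < max x (1 / (real n + 1))" "1 - 1 / (real n + 1) < 1" for n x
    by (auto simp: less_max_iff_disj)
  have gt: "{x<..} \<in> sets borel" for x :: real by simp
  have RR: "?R P n = ?R N n" for n
  proof (rule measure_eqI_lessThan)
    fix x
    show "emeasure (?R P n) {x<..} < \<infinity>"
      using Ioo_fin[OF P p(1)[of x n] p(2)[of n]] by (simp only: emR[OF P gt] JI)
    show "emeasure (?R P n) {x<..} = emeasure (?R N n) {x<..}"
      using Ioo_eq[OF p(1)[of x n] p(2)[of n]] by (simp only: emR[OF P gt] emR[OF N gt] JI)
  qed auto
  have inc: "incseq ?J"
  proof (rule incseq_SucI)
    fix n have "1 / (real (Suc n) + 1) \<le> 1 / (real n + 1)" by (simp add: field_simps)
    then show "?J n \<le> ?J (Suc n)" by auto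
  qed
  have UJ: "(\<Union>n. ?J n) = {0<..<1}"
  proof (intro equalityI subsetI)
    fix x :: real assume "x \<in> {0<..<1}"
    then have "min x (1 - x) > 0" by auto
    then obtain n where "inverse (real (Suc n)) < min x (1 - x)" using reals_Archimedean by blast
    then have "x \<in> ?J n" by (auto simp: field_simps)
    then show "x \<in> (\<Union>n. ?J n)" by blast
  next
    fix x assume "x \<in> (\<Union>n. ?J n)"
    then obtain n where n: "x \<in> ?J n" by blast
    have "0 < 1 / (real n + 1)" by simp
    with n show "x \<in> {0<..<1}"
      unfolding greaterThanLessThan_iff by linarith
  qed
  show ?thesis
  proof (rule measure_eqI)
    show "sets P = sets N" using radon01_sets P N by simp
    fix A assume A: "A \<in> sets P"
    then obtain B where B: "B \<in> sets borel" "A = {0<..<1} \<inter> B"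
      using radon01_sets[OF P] by (auto simp: sets_restrict_space)
    have e: "emeasure M A = (SUP n. emeasure M (?J n \<inter> B))" if M: "radon01 M" for M
    proof -
      have JA: "?J n \<inter> B = ?J n \<inter> A" for n
        using B UJ by blast
      have "range (\<lambda>n. ?J n \<inter> A) \<subseteq> sets M"
        using A JS[OF M] radon01_sets[OF M] radon01_sets[OF P] by (auto intro!: sets.Int)
      moreover have "incseq (\<lambda>n. ?J n \<inter> A)"
        using inc unfolding incseq_def by blast
      ultimately have "(SUP n. emeasure M (?J n \<inter> A)) = emeasure M (\<Union>n. ?J n \<inter> A)"
        by (rule SUP_emeasure_incseq)
      also have "(\<Union>n. ?J n \<inter> A) = A" using UJ B by blast
      finally show ?thesis by (simp only: JA)
    qed
    show "emeasure P A = emeasure N A"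
      using RR by (simp add: e[OF P] e[OF N] emR[OF P B(1), symmetric] emR[OF N B(1), symmetric])
  qed
qed

section \<open>Jordan decomposition and the total variation of the second derivative\<close>

text \<open>Each measure is absolutely continuous with respect to the sum, which is again Radon and
  hence sigma-finite.\<close>

lemma has_density_radon01:
  assumes P: "radon01 P" and N: "radon01 N"
  shows "\<exists>f \<in> borel_measurable (madd P N). density (madd P N) f = P"
proof -
  interpret sigma_finite_measure "madd P N"
    using P N by (intro radon01_sigma_finite radon01_madd)
  have "absolutely_continuous (madd P N) P"
    unfolding absolutely_continuous_def null_sets_def
    using radon01_sets[OF P] radon01_sets[OF N] by (auto simp: emeasure_madd)
  moreover have "sets P = sets (madd P N)" by simp
  ultimately show ?thesis by (rule Radon_Nikodym)
qed

lemma madd_commute: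
  assumes "sets N = sets M"
  shows "madd M N = madd N M"
  by (rule measure_eqI) (simp_all add: assms emeasure_madd add.commute)

lemma density_madd:
  assumes "f \<in> borel_measurable Q" "g \<in> borel_measurable Q"
  shows "density Q (\<lambda>x. f x + g x) = madd (density Q f) (density Q g)"
proof (rule measure_eqI)
  fix A assume "A \<in> sets (density Q (\<lambda>x. f x + g x))"
  then have "A \<in> sets Q" by simp
  then show "emeasure (density Q (\<lambda>x. f x + g x)) A = emeasure (madd (density Q f) (density Q g)) A"
    using assms by (simp add: emeasure_density emeasure_madd nn_integral_add distrib_right)
qed simp

text \<open>With densities \<open>f\<close>, \<open>h\<close> of \<open>P\<close>, \<open>N\<close> relative to \<open>P + N\<close>, the parts are the positive parts of
  \<open>f - h\<close> and \<open>h - f\<close>.  The case distinctions avoid the value \<open>\<infinity> - \<infinity> = \<infinity>\<close> of \<open>ennreal\<close>.\<close>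

lemma jordan01:
  assumes P: "radon01 P" and N: "radon01 N"
  obtains P' N' where "radon01 P'" "radon01 N'" "mutually_singular01 P' N'"
    "\<And>\<phi>. test_fun \<phi> \<Longrightarrow> (\<integral>t. \<phi> t \<partial>P') - (\<integral>t. \<phi> t \<partial>N') = (\<integral>t. \<phi> t \<partial>P) - (\<integral>t. \<phi> t \<partial>N)"
    "\<And>\<rho>. \<rho> \<in> borel_measurable borel \<Longrightarrow> (\<integral>\<^sup>+t. \<rho> t \<partial>P') \<le> (\<integral>\<^sup>+t. \<rho> t \<partial>P)"
    "\<And>\<rho>. \<rho> \<in> borel_measurable borel \<Longrightarrow> (\<integral>\<^sup>+t. \<rho> t \<partial>N') \<le> (\<integral>\<^sup>+t. \<rho> t \<partial>N)"
proof -
  define Q where "Q = madd P N"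
  have Q: "radon01 Q" unfolding Q_def using P N by (rule radon01_madd)
  have QNP: "Q = madd N P" unfolding Q_def using radon01_sets P N by (intro madd_commute) auto
  obtain f where f [measurable]: "f \<in> borel_measurable Q" and Pf: "density Q f = P"
    using has_density_radon01[OF P N] Q_def by auto
  obtain h where h [measurable]: "h \<in> borel_measurable Q" and Nh: "density Q h = N"
    using has_density_radon01[OF N P] QNP by auto
  define fp where "fp x = (if h x < f x then f x - h x else 0)" for x
  define hp where "hp x = (if f x < h x then h x - f x else 0)" for x
  define k where "k x = min (f x) (h x)" for x
  have [measurable]: "fp \<in> borel_measurable Q" "hp \<in> borel_measurable Q" "k \<in> borel_measurable Q"
    unfolding fp_def hp_def k_def by measurable
  \<comment> \<open>\<open>R\<close> is the common part of the two measures. Removing it from both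
    keeps the difference of the integrals of test functions and can only lower integrals of
    nonnegative functions.\<close>
  define P' N' R where "P' = density Q fp" and "N' = density Q hp" and "R = density Q k"
  have fk: "f = (\<lambda>x. fp x + k x)" and hk: "h = (\<lambda>x. hp x + k x)"
    by (auto simp: fun_eq_iff fp_def hp_def k_def min_def diff_add_cancel_ennreal)
  have PR: "P = madd P' R"
    unfolding P'_def R_def by (subst density_madd[symmetric]) (simp_all add: fk[symmetric] Pf)
  have NR: "N = madd N' R"
    unfolding N'_def R_def by (subst density_madd[symmetric]) (simp_all add: hk[symmetric] Nh)
  have s: "sets P' = sets Q" "sets N' = sets Q" "sets R = sets Q"
    by (simp_all add: P'_def N'_def R_def)
  have s': "sets P = sets Q" "sets N = sets Q" using Pf Nh sets_density by metis+
  have P': "radon01 P'"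
    by (rule radon01_le[OF P]) (auto simp: s s' PR emeasure_madd)
  have R: "radon01 R"
    by (rule radon01_le[OF P]) (auto simp: s s' PR emeasure_madd)
  have N': "radon01 N'"
    by (rule radon01_le[OF N]) (auto simp: s s' NR emeasure_madd)
  show ?thesis
  proof
    show "mutually_singular01 P' N'"
      unfolding mutually_singular01_def
    proof (intro exI conjI)
      let ?S = "{x \<in> space Q. f x \<le> h x}"
      have S: "?S \<in> sets Q" by measurable
      then show "?S \<in> sets (restrict_space borel {0<..<1})" using radon01_sets[OF Q] by simp
      have "emeasure P' ?S = (\<integral>\<^sup>+x. fp x * indicator ?S x \<partial>Q)"
        unfolding P'_def using S by (intro emeasure_density) auto
      also have "\<dots> = (\<integral>\<^sup>+x. 0 \<partial>Q)"
        by (intro nn_integral_cong) (auto simp: fp_def indicator_def)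
      finally show "emeasure P' ?S = 0" by simp
      have "{0<..<1} - ?S \<in> sets Q"
        using S radon01_space[OF Q] by (metis sets.compl_sets)
      then have "emeasure N' ({0<..<1} - ?S) = (\<integral>\<^sup>+x. hp x * indicator ({0<..<1} - ?S) x \<partial>Q)"
        unfolding N'_def by (intro emeasure_density) auto
      also have "\<dots> = (\<integral>\<^sup>+x. 0 \<partial>Q)"
        by (intro nn_integral_cong) (auto simp: hp_def indicator_def)
      finally show "emeasure N' ({0<..<1} - ?S) = 0" by simp
    qed
    show "(\<integral>t. \<phi> t \<partial>P') - (\<integral>t. \<phi> t \<partial>N') = (\<integral>t. \<phi> t \<partial>P) - (\<integral>t. \<phi> t \<partial>N)" if "test_fun \<phi>" for \<phi>
      unfolding PR NR using that P' N' R
      by (simp add: integral_madd s radon01_integrable_test)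
    show "(\<integral>\<^sup>+t. \<rho> t \<partial>P') \<le> (\<integral>\<^sup>+t. \<rho> t \<partial>P)" if "\<rho> \<in> borel_measurable borel" for \<rho>
      using radon01_measurable[OF P' that] unfolding PR by (simp add: nn_integral_madd s)
    show "(\<integral>\<^sup>+t. \<rho> t \<partial>N') \<le> (\<integral>\<^sup>+t. \<rho> t \<partial>N)" if "\<rho> \<in> borel_measurable borel" for \<rho>
      using radon01_measurable[OF N' that] unfolding NR by (simp add: nn_integral_madd s)
  qed (fact P' N')+
qed

section \<open>Limits of integrals and uniqueness of weak derivatives\<close>

lemma set_lebesgue_integral_bounded_conv:
  fixes h :: "real \<Rightarrow> real" and \<psi> :: "nat \<Rightarrow> real \<Rightarrow> real"
  assumes h: "set_integrable lebesgue A h" and A: "A \<in> sets lebesgue"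
    and m: "\<And>n. \<psi> n \<in> borel_measurable borel" "\<psi>' \<in> borel_measurable borel"
    and B: "\<And>n t. \<bar>\<psi> n t\<bar> \<le> B" and lim: "\<And>t. t \<in> A \<Longrightarrow> (\<lambda>n. \<psi> n t) \<longlonglongrightarrow> \<psi>' t"
  shows "(\<lambda>n. LINT t:A|lebesgue. h t * \<psi> n t) \<longlonglongrightarrow> (LINT t:A|lebesgue. h t * \<psi>' t)"
  unfolding set_lebesgue_integral_def
proof (rule integral_dominated_convergence[where w = "\<lambda>t. B * \<bar>indicat_real A t *\<^sub>R h t\<bar>"])
  have hm: "(\<lambda>t. indicat_real A t *\<^sub>R h t) \<in> borel_measurable lebesgue"
    using h unfolding set_integrable_def by auto
  have e: "(\<lambda>t. indicat_real A t *\<^sub>R (h t * \<psi> t)) = (\<lambda>t. (indicat_real A t *\<^sub>R h t) * \<psi> t)" for \<psi> :: "real \<Rightarrow> real"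
    by auto
  have mm: "\<psi>' \<in> borel_measurable lebesgue" "\<And>n. \<psi> n \<in> borel_measurable lebesgue"
    using m by (auto intro: measurable_completion)
  show "(\<lambda>t. indicat_real A t *\<^sub>R (h t * \<psi>' t)) \<in> borel_measurable lebesgue"
    unfolding e using hm mm by measurable
  show "(\<lambda>t. indicat_real A t *\<^sub>R (h t * \<psi> n t)) \<in> borel_measurable lebesgue" for n
    unfolding e using hm mm by measurable
  show "integrable lebesgue (\<lambda>t. B * \<bar>indicat_real A t *\<^sub>R h t\<bar>)"
    using h unfolding set_integrable_def by (intro integrable_mult_right integrable_abs)
  show "AE t in lebesgue. (\<lambda>n. indicat_real A t *\<^sub>R (h t * \<psi> n t)) \<longlonglongrightarrow> indicat_real A t *\<^sub>R (h t * \<psi>' t)"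
    using lim by (intro AE_I2) (auto simp: indicator_def intro!: tendsto_mult)
  show "AE t in lebesgue. norm (indicat_real A t *\<^sub>R (h t * \<psi> n t)) \<le> B * \<bar>indicat_real A t *\<^sub>R h t\<bar>" for n
  proof (rule AE_I2)
    fix t
    show "norm (indicat_real A t *\<^sub>R (h t * \<psi> n t)) \<le> B * \<bar>indicat_real A t *\<^sub>R h t\<bar>"
      using mult_right_mono[OF B[of n t], of "\<bar>h t\<bar>"] by (auto simp: indicator_def abs_mult mult.commute)
  qed
qed

lemma set_integral_support:
  fixes f :: "real \<Rightarrow> real"
  assumes "\<And>t. t \<in> A - B \<Longrightarrow> f t = 0" "B \<subseteq> A"
  shows "(LINT t:A|M. f t) = (LINT t:B|M. f t)"
  unfolding set_lebesgue_integral_def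
  by (intro Bochner_Integration.integral_cong) (use assms in \<open>auto simp: indicator_def\<close>)

lemma set_integrable_mult_bounded:
  fixes h \<psi> :: "real \<Rightarrow> real"
  assumes h: "set_integrable lebesgue A h" and m: "\<psi> \<in> borel_measurable borel" and B: "\<And>t. \<bar>\<psi> t\<bar> \<le> B"
  shows "set_integrable lebesgue A (\<lambda>t. h t * \<psi> t)"
  unfolding set_integrable_def
proof (rule Bochner_Integration.integrable_bound[where f = "\<lambda>t. B * (indicat_real A t *\<^sub>R h t)"])
  show "integrable lebesgue (\<lambda>t. B * (indicat_real A t *\<^sub>R h t))"
    using h unfolding set_integrable_def by (rule integrable_mult_right)
  have hm: "(\<lambda>t. indicat_real A t *\<^sub>R h t) \<in> borel_measurable lebesgue"
    using h unfolding set_integrable_def by auto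
  have e: "(\<lambda>t. indicat_real A t *\<^sub>R (h t * \<psi> t)) = (\<lambda>t. (indicat_real A t *\<^sub>R h t) * \<psi> t)"
    by auto
  have mm: "\<psi> \<in> borel_measurable lebesgue"
    using m by (auto intro: measurable_completion)
  show "(\<lambda>t. indicat_real A t *\<^sub>R (h t * \<psi> t)) \<in> borel_measurable lebesgue"
    unfolding e using hm mm by measurable
  show "AE t in lebesgue. norm (indicat_real A t *\<^sub>R (h t * \<psi> t)) \<le> norm (B * (indicat_real A t *\<^sub>R h t))"
  proof (rule AE_I2)
    fix t
    have "\<bar>\<psi> t\<bar> \<le> \<bar>B\<bar>" using B[of t] by linarith
    from mult_right_mono[OF this, of "\<bar>h t\<bar>"]
    show "norm (indicat_real A t *\<^sub>R (h t * \<psi> t)) \<le> norm (B * (indicat_real A t *\<^sub>R h t))"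
      by (auto simp: indicator_def abs_mult mult.commute)
  qed
qed

lemma loc_integrable_mult_test:
  assumes h: "loc_integrable h" and m: "\<psi> \<in> borel_measurable borel" and B: "\<And>t. \<bar>\<psi> t\<bar> \<le> B"
    and ab: "0 < a" "b < 1" and z: "\<And>t. t \<notin> {a..b} \<Longrightarrow> \<psi> t = 0"
  shows "set_integrable lebesgue {0<..<1} (\<lambda>t. h t * \<psi> t)"
    "(LINT t:{0<..<1}|lebesgue. h t * \<psi> t) = (LINT t:{a..b}|lebesgue. h t * \<psi> t)"
proof -
  have "set_integrable lebesgue {a..b} h" using h ab by (auto simp: loc_integrable_def)
  then have i: "set_integrable lebesgue {a..b} (\<lambda>t. h t * \<psi> t)"
    using m B by (rule set_integrable_mult_bounded)
  have "(\<lambda>t. indicat_real {0<..<1} t *\<^sub>R (h t * \<psi> t)) = (\<lambda>t. indicat_real {a..b} t *\<^sub>R (h t * \<psi> t))"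
    using z ab by (auto simp: indicator_def fun_eq_iff)
  then show "set_integrable lebesgue {0<..<1} (\<lambda>t. h t * \<psi> t)" using i by (simp add: set_integrable_def)
  show "(LINT t:{0<..<1}|lebesgue. h t * \<psi> t) = (LINT t:{a..b}|lebesgue. h t * \<psi> t)"
    by (rule set_integral_support) (use z ab in auto)
qed

text \<open>The shift moves the support to the left by \<open>1 / real (Suc n)\<close>; keeping this
  below \<open>a / 2\<close> leaves the support at a positive distance from 0.\<close>

lemma test_fun_diff_quotient:
  assumes \<phi>: "test_fun \<phi>" and ab: "0 < a" "a < b" "b < 1" and z: "\<And>t. t \<notin> {a..b} \<Longrightarrow> \<phi> t = 0"
    and n: "1 / real (Suc n) \<le> a / 2"
  shows "test_fun (\<lambda>t. real (Suc n) * (\<phi> (t + 1 / real (Suc n)) - \<phi> t))"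
proof (rule test_funI[where a = "a / 2" and b = b])
  let ?c = "1 / real (Suc n)"
  show "((\<lambda>t. real (Suc n) * (\<phi> (t + ?c) - \<phi> t)) has_real_derivative
     real (Suc n) * (deriv \<phi> (t + ?c) - deriv \<phi> t)) (at t)" for t
    by (intro DERIV_cmult DERIV_diff test_fun_deriv \<phi> DERIV_shift[THEN iffD1])
  show "continuous_on UNIV (\<lambda>t. real (Suc n) * (deriv \<phi> (t + ?c) - deriv \<phi> t))"
    by (intro continuous_intros continuous_on_compose2[OF test_fun_cont_deriv[OF \<phi>]]) auto
  show "real (Suc n) * (\<phi> (t + ?c) - \<phi> t) = 0" if t: "t \<notin> {a / 2..b}" for t
  proof -
    have "?c > 0" by simp
    with t n ab have "t \<notin> {a..b}" "t + ?c \<notin> {a..b}" unfolding atLeastAtMost_iff by linarith+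
    then show ?thesis by (simp add: z)
  qed
qed (use ab in auto)

text \<open>Difference quotients of \<open>\<phi>\<close> are test functions converging to \<open>deriv \<phi>\<close>, which is merely
  continuous and hence not itself admissible as a test function.\<close>

lemma weak_deriv_unique:
  assumes "weak_deriv u g" "weak_deriv u g'" and \<phi>: "test_fun \<phi>"
  shows "(LINT t:{0<..<1}|lebesgue. g t * deriv \<phi> t) = (LINT t:{0<..<1}|lebesgue. g' t * deriv \<phi> t)"
proof -
  have g: "loc_integrable g" "loc_integrable g'" using assms unfolding weak_deriv_def by auto
  obtain a b B where ab: "0 < a" "a < b" "b < 1" and B: "B > 0" and z: "\<And>t. t \<notin> {a..b} \<Longrightarrow> \<phi> t = 0"
    "\<And>t. t \<notin> {a..b} \<Longrightarrow> deriv \<phi> t = 0" "\<And>t. \<bar>\<phi> t\<bar> \<le> B" "\<And>t. \<bar>deriv \<phi> t\<bar> \<le> B"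
    using test_fun_support[OF \<phi>] by metis
  obtain N where N: "1 / real (Suc N) \<le> a / 2"
    using reals_Archimedean[of "a/2"] ab by (auto simp: inverse_eq_divide intro: less_imp_le)
  define \<psi> where "\<psi> n t = real (Suc (n + N)) * (\<phi> (t + 1 / real (Suc (n + N))) - \<phi> t)" for n t
  have N': "1 / real (Suc (n + N)) \<le> a / 2" for n
    by (rule order_trans[OF _ N]) (simp add: frac_le)
  have test: "test_fun (\<psi> n)" for n
    unfolding \<psi>_def using N' by (intro test_fun_diff_quotient[OF \<phi> ab z(1)])
  have zero: "\<psi> n t = 0" if t: "t \<notin> {a / 2..b}" for n t
  proof -
    have "1 / real (Suc (n + N)) > 0" by simp
    with t N'[of n] ab have "t \<notin> {a..b}" "t + 1 / real (Suc (n + N)) \<notin> {a..b}"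
      unfolding atLeastAtMost_iff by linarith+
    then show ?thesis by (simp add: z \<psi>_def)
  qed
  \<comment> \<open>By the mean value theorem the bound on \<open>deriv \<phi>\<close> holds for all
    quotients, uniformly in \<open>n\<close>, as dominated convergence requires.\<close>
  have bound: "\<bar>\<psi> n t\<bar> \<le> B" for n t
  proof -
    have "t < t + 1 / real (Suc (n + N))" by simp
    then obtain s where "\<phi> (t + 1 / real (Suc (n + N))) - \<phi> t = (t + 1 / real (Suc (n + N)) - t) * deriv \<phi> s"
      using MVT2[of t _ \<phi> "deriv \<phi>"] test_fun_deriv[OF \<phi>] by blast
    then have "\<psi> n t = deriv \<phi> s" unfolding \<psi>_def by (simp add: field_simps)
    then show ?thesis using z(4) by simp
  qed
  have lim: "(\<lambda>n. \<psi> n t) \<longlonglongrightarrow> deriv \<phi> t" for t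
  proof -
    have "((\<lambda>h. (\<phi> (t + h) - \<phi> t) / h) \<longlongrightarrow> deriv \<phi> t) (at 0)"
      using test_fun_deriv[OF \<phi>, of t] by (simp add: DERIV_def)
    moreover have "filterlim (\<lambda>n. 1 / real (Suc (n + N))) (at 0) sequentially"
    proof (rule filterlim_atI)
      have "(\<lambda>n. 1 / real (Suc n)) \<longlonglongrightarrow> 0" using LIMSEQ_inverse_real_of_nat by (simp add: inverse_eq_divide)
      then show "(\<lambda>n. 1 / real (Suc (n + N))) \<longlonglongrightarrow> 0"
        using LIMSEQ_ignore_initial_segment[of _ 0 N] by fastforce
    qed auto
    ultimately have "(\<lambda>n. (\<phi> (t + 1 / real (Suc (n + N))) - \<phi> t) / (1 / real (Suc (n + N)))) \<longlonglongrightarrow> deriv \<phi> t"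
      by (rule filterlim_compose)
    then show ?thesis unfolding \<psi>_def by (simp add: mult.commute)
  qed
  have conv: "(\<lambda>n. LINT t:{0<..<1}|lebesgue. h t * \<psi> n t) \<longlonglongrightarrow> (LINT t:{0<..<1}|lebesgue. h t * deriv \<phi> t)"
    if "loc_integrable h" for h
  proof -
    have ab': "0 < a / 2" "b < 1" using ab by auto
    have hi: "set_integrable lebesgue {a/2..b} h" using that ab' unfolding loc_integrable_def by blast
    have "(LINT t:{0<..<1}|lebesgue. h t * deriv \<phi> t) = (LINT t:{a/2..b}|lebesgue. h t * deriv \<phi> t)"
      using ab by (intro loc_integrable_mult_test(2)[OF that _ z(4) ab']) (auto simp: test_fun_measurable[OF \<phi>] z)
    moreover have "(LINT t:{0<..<1}|lebesgue. h t * \<psi> n t) = (LINT t:{a/2..b}|lebesgue. h t * \<psi> n t)" for n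
      by (intro loc_integrable_mult_test(2)[OF that _ bound ab']) (auto simp: test_fun_measurable[OF test] zero)
    moreover have "(\<lambda>n. LINT t:{a/2..b}|lebesgue. h t * \<psi> n t) \<longlonglongrightarrow> (LINT t:{a/2..b}|lebesgue. h t * deriv \<phi> t)"
      by (rule set_lebesgue_integral_bounded_conv[OF hi _ _ _ bound lim])
        (auto simp: test_fun_measurable[OF test] test_fun_measurable[OF \<phi>])
    ultimately show ?thesis by simp
  qed
  have "(LINT t:{0<..<1}|lebesgue. g t * \<psi> n t) = (LINT t:{0<..<1}|lebesgue. g' t * \<psi> n t)" for n
  proof -
    have "- (LINT t:{0<..<1}|lebesgue. g t * \<psi> n t) = - (LINT t:{0<..<1}|lebesgue. g' t * \<psi> n t)"
      using assms(1,2) test[of n] unfolding weak_deriv_def by simp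
    then show ?thesis by simp
  qed
  then have "(\<lambda>n. LINT t:{0<..<1}|lebesgue. g t * \<psi> n t) \<longlonglongrightarrow> (LINT t:{0<..<1}|lebesgue. g' t * deriv \<phi> t)"
    using conv[OF g(2)] by simp
  with conv[OF g(1)] show ?thesis by (rule LIMSEQ_unique)
qed

text \<open>Minimality of the Jordan decomposition, with the equality of the differences written
  additively as \<open>madd P N' = madd P' N\<close>. \<open>P\<close> lives off \<open>S\<close>,
  where \<open>N\<close> vanishes, so there the equality leaves \<open>P\<close> plus a nonnegative
  term equal to \<open>P'\<close>.\<close>

lemma mutually_singular_le:
  assumes sing: "mutually_singular01 P N"
    and s: "sets P = sets (restrict_space borel {0<..<1})" "sets N = sets (restrict_space borel {0<..<1})"
     "sets P' = sets (restrict_space borel {0<..<1})" "sets N' = sets (restrict_space borel {0<..<1})"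
    and eq: "madd P N' = madd P' N" and A: "A \<in> sets P"
  shows "emeasure P A \<le> emeasure P' A"
proof -
  obtain S where S: "S \<in> sets P" and PS: "emeasure P S = 0" and NS: "emeasure N ({0<..<1} - S) = 0"
    using sing s unfolding mutually_singular01_def by auto
  have sp: "space P = {0<..<1}" using s(1)[THEN sets_eq_imp_space_eq] by (simp add: space_restrict_space)
  have D: "A - S \<in> sets P" and C: "{0<..<1} - S \<in> sets P" using A S sp by (auto simp flip: sp)
  have "emeasure N (A - S) \<le> emeasure N ({0<..<1} - S)"
    using D C s sets.sets_into_space[OF A] sp by (intro emeasure_mono) auto
  then have N0: "emeasure N (A - S) = 0" using NS by simp
  have "emeasure P A \<le> emeasure P ((A - S) \<union> S)"
    using A S by (intro emeasure_mono) auto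
  also have "\<dots> \<le> emeasure P (A - S) + emeasure P S"
    using D S by (rule emeasure_subadditive)
  also have "\<dots> \<le> emeasure P (A - S) + emeasure N' (A - S)" using PS by simp
  also have "\<dots> = emeasure P' (A - S) + emeasure N (A - S)"
    using arg_cong[OF eq, of "\<lambda>M. emeasure M (A - S)"] D s by (simp add: emeasure_madd)
  also have "\<dots> \<le> emeasure P' A"
    using N0 A s by (simp add: emeasure_mono)
  finally show ?thesis .
qed

text \<open>Each of two mutually singular representations is minimal, so they dominate each other.
  Test functions yield an equality of sums of measures, which avoids subtracting infinite values;
  complementing the separating set exchanges the roles of the two parts.\<close>

lemma jordan01_unique:
  assumes "radon01 P" "radon01 N" "radon01 P'" "radon01 N'"
    "mutually_singular01 P N" "mutually_singular01 P' N'"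
    "\<And>\<phi>. test_fun \<phi> \<Longrightarrow> (\<integral>t. \<phi> t \<partial>P) - (\<integral>t. \<phi> t \<partial>N) = (\<integral>t. \<phi> t \<partial>P') - (\<integral>t. \<phi> t \<partial>N')"
  shows "P = P'" "N = N'"
proof -
  note s = assms(1-4)[THEN radon01_sets]
  have sw: "mutually_singular01 N P" if sn: "mutually_singular01 P N" and sP: "sets P = sets (restrict_space borel {0<..<1})" for P N
  proof -
    obtain S where S: "S \<in> sets P" and PS: "emeasure P S = 0" and NS: "emeasure N ({0<..<1} - S) = 0"
      using sn unfolding mutually_singular01_def sP[symmetric] by blast
    have sp: "space P = {0<..<1}" using sP[THEN sets_eq_imp_space_eq] by (simp add: space_restrict_space)
    have "{0<..<1} - ({0<..<1} - S) = S" using sets.sets_into_space[OF S] sp by auto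
    moreover have "{0<..<1} - S \<in> sets P" using sets.compl_sets[OF S] by (simp add: sp)
    ultimately show ?thesis unfolding mutually_singular01_def sP[symmetric]
      using PS NS by (intro exI[of _ "{0<..<1} - S"]) simp
  qed
  have eq: "madd P N' = madd P' N"
  proof (rule radon01_eqI)
    fix \<phi> assume "test_fun \<phi>"
    then show "(\<integral>t. \<phi> t \<partial>madd P N') = (\<integral>t. \<phi> t \<partial>madd P' N)"
      using assms(1-4) s assms(7)[of \<phi>] by (simp add: integral_madd radon01_integrable_test)
  qed (use assms in \<open>auto intro: radon01_madd\<close>)
  have eq': "madd N P' = madd N' P"
    using eq s by (simp add: madd_commute[of N P'] madd_commute[of N' P])
  show "P = P'"
  proof (rule measure_eqI)
    fix A assume A: "A \<in> sets P"
    with s have "A \<in> sets P'" by simp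
    then show "emeasure P A = emeasure P' A"
      using mutually_singular_le[OF assms(5) s(1,2,3,4) eq A]
       mutually_singular_le[OF assms(6) s(3,4,1,2) eq[symmetric]] by (simp add: antisym)
  qed (use s in simp)
  show "N = N'"
  proof (rule measure_eqI)
    fix A assume A: "A \<in> sets N"
    with s have "A \<in> sets N'" by simp
    then show "emeasure N A = emeasure N' A"
      using mutually_singular_le[OF sw[OF assms(5) s(1)] s(2,1,4,3) eq' A]
       mutually_singular_le[OF sw[OF assms(6) s(3)] s(4,3,2,1) eq'[symmetric]] by (simp add: antisym)
  qed (use s in simp)
qed

text \<open>This gives access to the definite description in \<open>tv_second_deriv\<close>:
  whatever representation of the second derivative is at hand, the true total variation splits into
  two measures whose weighted masses are no larger.\<close>

lemma tv_second_deriv_eq: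
  assumes u: "weak_deriv u g" and m: "measure_deriv g P N"
  obtains P' N' where "measure_deriv g P' N'" "tv_second_deriv u = madd P' N'"
    "\<And>\<rho>. \<rho> \<in> borel_measurable borel \<Longrightarrow> (\<integral>\<^sup>+t. \<rho> t \<partial>P') \<le> (\<integral>\<^sup>+t. \<rho> t \<partial>P)"
    "\<And>\<rho>. \<rho> \<in> borel_measurable borel \<Longrightarrow> (\<integral>\<^sup>+t. \<rho> t \<partial>N') \<le> (\<integral>\<^sup>+t. \<rho> t \<partial>N)"
proof -
  have PN: "radon01 P" "radon01 N" using m unfolding measure_deriv_def by auto
  obtain P' N' where PN': "radon01 P'" "radon01 N'" and sing: "mutually_singular01 P' N'"
    and eq: "\<And>\<phi>. test_fun \<phi> \<Longrightarrow> (\<integral>t. \<phi> t \<partial>P') - (\<integral>t. \<phi> t \<partial>N') = (\<integral>t. \<phi> t \<partial>P) - (\<integral>t. \<phi> t \<partial>N)"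
    and le: "\<And>\<rho>. \<rho> \<in> borel_measurable borel \<Longrightarrow> (\<integral>\<^sup>+t. \<rho> t \<partial>P') \<le> (\<integral>\<^sup>+t. \<rho> t \<partial>P)"
    "\<And>\<rho>. \<rho> \<in> borel_measurable borel \<Longrightarrow> (\<integral>\<^sup>+t. \<rho> t \<partial>N') \<le> (\<integral>\<^sup>+t. \<rho> t \<partial>N)"
    using jordan01[OF PN] by metis
  have m': "measure_deriv g P' N'"
    using m PN' eq unfolding measure_deriv_def by simp
  note s = PN'[THEN radon01_sets]
  have "tv_second_deriv u = madd P' N'"
    unfolding tv_second_deriv_def
  proof (rule the_equality)
    show "is_tv_second_deriv u (madd P' N')"
      unfolding is_tv_second_deriv_def using u m' sing s
      by (intro exI[of _ g] exI[of _ P'] exI[of _ N']) (auto simp: emeasure_madd)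
    fix M assume "is_tv_second_deriv u M"
    then obtain g2 P2 N2 where u2: "weak_deriv u g2" and m2: "measure_deriv g2 P2 N2"
      and sing2: "mutually_singular01 P2 N2" and sM: "sets M = sets (restrict_space borel {0<..<1})"
      and M: "\<And>A. A \<in> sets M \<Longrightarrow> emeasure M A = emeasure P2 A + emeasure N2 A"
      unfolding is_tv_second_deriv_def by blast
    have PN2: "radon01 P2" "radon01 N2" using m2 unfolding measure_deriv_def by auto
    \<comment> \<open>\<open>measure_deriv\<close> sees a slope only through its integrals against
      \<open>deriv \<phi>\<close>, and these agree for \<open>g\<close> and \<open>g2\<close> by
      \<open>weak_deriv_unique\<close>.\<close>
    have "(\<integral>t. \<phi> t \<partial>P2) - (\<integral>t. \<phi> t \<partial>N2) = (\<integral>t. \<phi> t \<partial>P') - (\<integral>t. \<phi> t \<partial>N')" if "test_fun \<phi>" for \<phi>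
      using weak_deriv_unique[OF u u2 that] m' m2 that unfolding measure_deriv_def by simp
    then have "P2 = P'" "N2 = N'"
      using jordan01_unique[OF PN2 PN' sing2 sing] by blast+
    then show "M = madd P' N'"
      by (intro measure_eqI) (use sM s M in \<open>auto simp: emeasure_madd\<close>)
  qed
  with m' show ?thesis using le that by blast
qed

section \<open>Localization to a half-line\<close>

lemma FTC_lebesgue:
  fixes F f :: "real \<Rightarrow> real"
  assumes "a \<le> b" and F: "\<And>t. t \<in> {a..b} \<Longrightarrow> (F has_real_derivative f t) (at t)" and c: "continuous_on {a..b} f"
  shows "set_integrable lebesgue {a<..<b} f" "(LINT t:{a<..<b}|lebesgue. f t) = F b - F a"
proof -
  have "set_integrable lebesgue {a..b} f"
    using absolutely_integrable_continuous_real[OF c] by simp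
  then show i: "set_integrable lebesgue {a<..<b} f"
    by (rule set_integrable_subset) auto
  have "(f has_integral F b - F a) {a..b}"
    using F by (intro fundamental_theorem_of_calculus assms(1))
      (auto simp: has_real_derivative_iff_has_vector_derivative[symmetric] intro: has_field_derivative_at_within)
  then show "(LINT t:{a<..<b}|lebesgue. f t) = F b - F a"
    using set_lebesgue_integral_eq_integral(2)[OF i] integral_open_interval_real[of a b f]
    by (simp add: integral_unique)
qed

lemma set_integral_split_open:
  fixes f :: "real \<Rightarrow> real"
  assumes y: "a < y" "y < b" and f: "set_integrable lebesgue {a<..<b} f"
  shows "(LINT t:{a<..<b}|lebesgue. f t) = (LINT t:{a<..<y}|lebesgue. f t) + (LINT t:{y<..<b}|lebesgue. f t)"
proof -
  have i: "set_integrable lebesgue {a<..<y} f" "set_integrable lebesgue {y<..<b} f"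
    by (rule set_integrable_subset[OF f]; use y in auto)+
  have "f integrable_on {a..b}"
    using set_lebesgue_integral_eq_integral(1)[OF f] by (simp add: integrable_on_open_interval_real)
  then have "integral {a..y} f + integral {y..b} f = integral {a..b} f"
    using y by (intro Henstock_Kurzweil_Integration.integral_combine) auto
  then show ?thesis
    by (simp add: set_lebesgue_integral_eq_integral(2)[OF f] set_lebesgue_integral_eq_integral(2)[OF i(1)]
      set_lebesgue_integral_eq_integral(2)[OF i(2)] integral_open_interval_real)
qed

lemma set_integral_abs_le:
  fixes h k :: "'a \<Rightarrow> real"
  assumes "set_integrable M A h" "set_integrable M A k" "AE t in M. t \<in> A \<longrightarrow> \<bar>h t\<bar> \<le> k t"
  shows "\<bar>LINT t:A|M. h t\<bar> \<le> (LINT t:A|M. k t)"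
proof -
  have "norm (LINT t:A|M. h t) \<le> (LINT t|M. norm (indicat_real A t *\<^sub>R h t))"
    unfolding set_lebesgue_integral_def by (rule integral_norm_bound)
  also have "\<dots> \<le> (LINT t|M. indicat_real A t *\<^sub>R k t)"
  proof (rule integral_mono_AE)
    show "AE t in M. norm (indicat_real A t *\<^sub>R h t) \<le> indicat_real A t *\<^sub>R k t"
      using assms(3) by eventually_elim (auto simp: indicator_def)
  qed (use assms in \<open>auto simp: set_integrable_def\<close>)
  finally show ?thesis by (simp add: set_lebesgue_integral_def)
qed

text \<open>The derivative of the later \<open>cutoff y n\<close>: an approximate identity supported
  in \<open>{y..y + 1 / real (Suc n)}\<close>, so averages against it approach \<open>y\<close> from
  the right.\<close>

definition kern :: "real \<Rightarrow> nat \<Rightarrow> real \<Rightarrow> real" where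
  "kern y n t = hat (real (Suc n) * (t - y)) * real (Suc n)"

lemma kern_continuous: "continuous_on S (kern y n)"
  unfolding kern_def[abs_def] by (intro continuous_intros)

lemma kern_nonneg: "0 \<le> kern y n t"
  unfolding kern_def by (intro mult_nonneg_nonneg hat_nonneg) auto

lemma kern_zero: "t \<notin> {y..y + 1 / real (Suc n)} \<Longrightarrow> kern y n t = 0"
proof -
  assume "t \<notin> {y..y + 1 / real (Suc n)}"
  then consider "t - y \<le> 0" | "1 / real (Suc n) \<le> t - y" by fastforce
  then have "real (Suc n) * (t - y) \<le> 0 \<or> 1 \<le> real (Suc n) * (t - y)"
  proof cases
    case 1
    then show ?thesis by (intro disjI1 mult_nonneg_nonpos) auto
  next
    case 2
    from mult_left_mono[OF this, of "real (Suc n)"] show ?thesis by simp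
  qed
  then show ?thesis unfolding kern_def by (simp add: hat_zero)
qed

lemma kern_integral:
  assumes "0 < y" "y + 1 / real (Suc n) < 1"
  shows "(LINT t:{0<..<1}|lebesgue. kern y n t) = 1"
proof -
  have "(LINT t:{0<..<1}|lebesgue. kern y n t) = step (real (Suc n) * (1 - y)) - step (real (Suc n) * (0 - y))"
    unfolding kern_def
    by (rule FTC_lebesgue) (auto intro!: derivative_eq_intros continuous_intros)
  also have "step (real (Suc n) * (1 - y)) = 1"
    using assms by (intro step_one) (simp add: field_simps)
  also have "step (real (Suc n) * (0 - y)) = 0"
    using assms by (intro step_zero) (simp add: mult_nonneg_nonpos)
  finally show ?thesis by simp
qed

lemma kern_bound: obtains B where "\<And>t. \<bar>kern y n t\<bar> \<le> B"
  using continuous_bounded_support[OF kern_continuous kern_zero] by metis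

lemma loc_integrable_kern:
  assumes "loc_integrable f" "0 < y" "y + 1 / real (Suc n) < 1"
  shows "set_integrable lebesgue {0<..<1} (\<lambda>t. f t * kern y n t)"
proof -
  obtain B where B: "\<And>t. \<bar>kern y n t\<bar> \<le> B" using kern_bound by blast
  show ?thesis
    by (rule loc_integrable_mult_test(1)[OF assms(1) _ B assms(2,3) kern_zero])
      (auto intro: borel_measurable_continuous_onI kern_continuous)
qed

lemma loc_integrable_const: "loc_integrable (\<lambda>_. c)"
  unfolding loc_integrable_def using absolutely_integrable_continuous_real[of _ _ "\<lambda>_. c"] by auto

lemma kern_eventually:
  assumes "y < 1" shows "\<forall>\<^sub>F n in sequentially. y + 1 / real (Suc n) < 1"
proof -
  have "(\<lambda>n. y + 1 / real (Suc n)) \<longlonglongrightarrow> y + 0"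
    using LIMSEQ_inverse_real_of_nat by (intro tendsto_add tendsto_const) (simp add: inverse_eq_divide)
  then show ?thesis using assms by (intro order_tendstoD) auto
qed

text \<open>The kernel concentrates where \<open>\<psi>\<close> is close to \<open>\<psi> y\<close>.
  The averages of \<open>f\<close> are subtracted rather than replaced by a limit because they may
  fail to converge; this covers both the constant 1 and a slope that is merely bounded.\<close>

lemma kern_conv:
  assumes f: "loc_integrable f" "AE t in lebesgue. t \<in> {0<..<1} \<longrightarrow> \<bar>f t\<bar> \<le> 1"
    and f\<psi>: "loc_integrable (\<lambda>t. f t * \<psi> t)" and \<psi>: "isCont \<psi> y" and y: "0 < y" "y < 1"
  shows "(\<lambda>n. (LINT t:{0<..<1}|lebesgue. f t * \<psi> t * kern y n t) - \<psi> y * (LINT t:{0<..<1}|lebesgue. f t * kern y n t)) \<longlonglongrightarrow> 0"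
proof (rule LIMSEQ_I)
  fix e :: real assume e: "e > 0"
  then obtain d where d: "d > 0" "\<And>t. \<bar>t - y\<bar> < d \<Longrightarrow> \<bar>\<psi> t - \<psi> y\<bar> < e / 2"
    using \<psi> unfolding continuous_at_eps_delta dist_real_def by (metis half_gt_zero)
  have "\<forall>\<^sub>F n in sequentially. y + 1 / real (Suc n) < min 1 (y + d)"
    using kern_eventually[of "y - min 1 (y + d) + 1"] y d by (auto elim!: eventually_mono)
  then obtain N where N: "\<And>n. n \<ge> N \<Longrightarrow> y + 1 / real (Suc n) < min 1 (y + d)"
    by (auto simp: eventually_sequentially)
  show "\<exists>no. \<forall>n\<ge>no. norm ((LINT t:{0<..<1}|lebesgue. f t * \<psi> t * kern y n t) - \<psi> y * (LINT t:{0<..<1}|lebesgue. f t * kern y n t) - 0) < e"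
  proof (intro exI allI impI)
    fix n assume "n \<ge> N"
    from N[OF this] have n: "y + 1 / real (Suc n) < 1" "y + 1 / real (Suc n) < y + d" by auto
    note i1 = loc_integrable_kern[OF f\<psi> y(1) n(1)] and i2 = loc_integrable_kern[OF f(1) y(1) n(1)]
      and i3 = loc_integrable_kern[OF loc_integrable_const y(1) n(1)]
    have "\<bar>LINT t:{0<..<1}|lebesgue. f t * \<psi> t * kern y n t - \<psi> y * (f t * kern y n t)\<bar>
      \<le> (LINT t:{0<..<1}|lebesgue. e / 2 * kern y n t)"
    proof (rule set_integral_abs_le)
      show "set_integrable lebesgue {0<..<1} (\<lambda>t. f t * \<psi> t * kern y n t - \<psi> y * (f t * kern y n t))"
        using i1 i2 by (intro set_integral_diff(1) set_integrable_mult_right)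
      show "set_integrable lebesgue {0<..<1} (\<lambda>t. e / 2 * kern y n t)" using i3 by simp
      show "AE t in lebesgue. t \<in> {0<..<1} \<longrightarrow> \<bar>f t * \<psi> t * kern y n t - \<psi> y * (f t * kern y n t)\<bar> \<le> e / 2 * kern y n t"
        using f(2)
      proof eventually_elim
        fix t assume t: "t \<in> {0<..<1} \<longrightarrow> \<bar>f t\<bar> \<le> 1"
        show "t \<in> {0<..<1} \<longrightarrow> \<bar>f t * \<psi> t * kern y n t - \<psi> y * (f t * kern y n t)\<bar> \<le> e / 2 * kern y n t"
        proof (cases "t \<in> {0<..<1} \<and> t \<in> {y..y + 1 / real (Suc n)}")
          case True
          have "\<bar>t - y\<bar> < d" using True n unfolding atLeastAtMost_iff by linarith
          then have "\<bar>\<psi> t - \<psi> y\<bar> \<le> e / 2" using d(2) by (simp add: less_imp_le)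
          then have "\<bar>f t\<bar> * \<bar>\<psi> t - \<psi> y\<bar> * kern y n t \<le> 1 * (e / 2) * kern y n t"
            using t True by (intro mult_right_mono mult_mono kern_nonneg) auto
          moreover have "f t * \<psi> t * kern y n t - \<psi> y * (f t * kern y n t) = f t * (\<psi> t - \<psi> y) * kern y n t"
            by (simp add: algebra_simps)
          ultimately show ?thesis using kern_nonneg[of y n t] by (simp add: abs_mult)
        next
          case False
          then show ?thesis using kern_zero[of t y n] kern_nonneg[of y n t] by (cases "t \<in> {0<..<1}") auto
        qed
      qed
    qed
    also have "(LINT t:{0<..<1}|lebesgue. e / 2 * kern y n t) = e / 2"
      using kern_integral[OF y(1) n(1)] by simp
    finally show "norm ((LINT t:{0<..<1}|lebesgue. f t * \<psi> t * kern y n t) - \<psi> y * (LINT t:{0<..<1}|lebesgue. f t * kern y n t) - 0) < e"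
      using e i1 i2 by (simp add: set_integral_diff(2)[OF i1 set_integrable_mult_right[OF i2]])
  qed
qed

definition cutoff :: "real \<Rightarrow> nat \<Rightarrow> real \<Rightarrow> real" where
  "cutoff y n t = step (real (Suc n) * (t - y))"

lemma cutoff_deriv: "(cutoff y n has_real_derivative kern y n t) (at t)"
  unfolding cutoff_def[abs_def] kern_def by (auto intro!: derivative_eq_intros)

lemma cutoff_bounds: "\<bar>cutoff y n t\<bar> \<le> 1"
  unfolding cutoff_def using step_bounds by simp

lemma cutoff_LIMSEQ: "(\<lambda>n. cutoff y n t) \<longlonglongrightarrow> indicat_real {y<..} t"
  using LIMSEQ_Suc[OF step_LIMSEQ[of "t - y"]] by (auto simp: cutoff_def indicator_def cong: if_cong)

lemma cutoff_measurable [measurable]: "cutoff y n \<in> borel_measurable borel"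
  using cutoff_deriv by (intro borel_measurable_continuous_onI) (meson DERIV_continuous_on DERIV_subset subset_UNIV)

lemma test_fun_cutoff:
  assumes "test_fun \<phi>"
  shows "test_fun (\<lambda>t. \<phi> t * cutoff y n t)"
    "deriv (\<lambda>t. \<phi> t * cutoff y n t) = (\<lambda>t. deriv \<phi> t * cutoff y n t + \<phi> t * kern y n t)"
  using test_fun_mult[OF assms cutoff_deriv kern_continuous] by auto

lemma cutoff_conv:
  assumes f: "loc_integrable f" and m: "\<psi> \<in> borel_measurable borel" and B: "\<And>t. \<bar>\<psi> t\<bar> \<le> B"
    and ab: "0 < a" "b < 1" and z: "\<And>t. t \<notin> {a..b} \<Longrightarrow> \<psi> t = 0" and y: "0 < y"
  shows "(\<lambda>n. LINT t:{0<..<1}|lebesgue. f t * (\<psi> t * cutoff y n t)) \<longlonglongrightarrow> (LINT t:{y<..<1}|lebesgue. f t * \<psi> t)"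
proof -
  have B': "\<bar>\<psi> t * cutoff y n t\<bar> \<le> B" for n t
    using mult_mono[OF B[of t] cutoff_bounds[of y n t]] order_trans[OF abs_ge_zero B[of t]] by (simp add: abs_mult)
  have mc: "(\<lambda>t. \<psi> t * cutoff y n t) \<in> borel_measurable borel" for n using m by measurable
  have "set_integrable lebesgue {a..b} f" using f ab by (auto simp: loc_integrable_def)
  then have "(\<lambda>n. LINT t:{a..b}|lebesgue. f t * (\<psi> t * cutoff y n t)) \<longlonglongrightarrow>
    (LINT t:{a..b}|lebesgue. f t * (\<psi> t * indicat_real {y<..} t))"
    by (rule set_lebesgue_integral_bounded_conv[OF _ _ mc _ B'])
      (use m in \<open>auto intro!: tendsto_mult cutoff_LIMSEQ\<close>)
  moreover have "(LINT t:{0<..<1}|lebesgue. f t * (\<psi> t * cutoff y n t)) = (LINT t:{a..b}|lebesgue. f t * (\<psi> t * cutoff y n t))" for n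
    by (rule loc_integrable_mult_test(2)[OF f mc B' ab]) (simp add: z)
  moreover have "(LINT t:{a..b}|lebesgue. f t * (\<psi> t * indicat_real {y<..} t)) = (LINT t:{y<..<1}|lebesgue. f t * \<psi> t)"
    unfolding set_lebesgue_integral_def
    by (intro Bochner_Integration.integral_cong) (use z ab y in \<open>auto simp: indicator_def\<close>)
  ultimately show ?thesis by simp
qed

text \<open>In the limit the term with \<open>kern\<close> produces the boundary value at
  \<open>y\<close>, and the other term the integral over \<open>{y<..<1}\<close>.\<close>

lemma cutoff_split:
  assumes f: "loc_integrable f" and \<phi>: "test_fun \<phi>" and y: "0 < y"
  shows "(LINT t:{0<..<1}|lebesgue. f t * deriv (\<lambda>t. \<phi> t * cutoff y n t) t) =
    (LINT t:{0<..<1}|lebesgue. f t * (deriv \<phi> t * cutoff y n t)) + (LINT t:{0<..<1}|lebesgue. f t * \<phi> t * kern y n t)"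
proof -
  obtain a b B where ab: "0 < a" "a < b" "b < 1" and z: "\<And>t. t \<notin> {a..b} \<Longrightarrow> \<phi> t = 0"
    "\<And>t. t \<notin> {a..b} \<Longrightarrow> deriv \<phi> t = 0" and B: "\<And>t. \<bar>\<phi> t\<bar> \<le> B" "\<And>t. \<bar>deriv \<phi> t\<bar> \<le> B"
    using test_fun_support[OF \<phi>] by metis
  obtain C where C: "\<And>t. \<bar>kern y n t\<bar> \<le> C" using kern_bound by blast
  have [measurable]: "\<phi> \<in> borel_measurable borel" "deriv \<phi> \<in> borel_measurable borel"
    "kern y n \<in> borel_measurable borel"
    using test_fun_measurable[OF \<phi>] by (auto intro: borel_measurable_continuous_onI kern_continuous)
  have "\<bar>deriv \<phi> t * cutoff y n t\<bar> \<le> B" "\<bar>\<phi> t * kern y n t\<bar> \<le> B * C" for t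
    using mult_mono[OF B(2)[of t] cutoff_bounds[of y n t]] mult_mono[OF B(1)[of t] C[of t]] B(1)[of t]
    by (auto simp: abs_mult)
  then have "set_integrable lebesgue {0<..<1} (\<lambda>t. f t * (deriv \<phi> t * cutoff y n t))"
     "set_integrable lebesgue {0<..<1} (\<lambda>t. f t * (\<phi> t * kern y n t))"
    by (intro loc_integrable_mult_test(1)[OF f _ _ ab(1,3)]; auto simp: z)+
  then show ?thesis
    by (simp add: test_fun_cutoff(2)[OF \<phi>] distrib_left set_integral_add(2) mult.assoc)
qed

text \<open>Test the weak derivative with \<open>\<phi>\<close> times a cutoff and let the cutoff
  sharpen; continuity of \<open>u\<close> identifies the limit of the kernel term.\<close>

lemma half_line_continuous:
  assumes wd: "weak_deriv u g" and u: "continuous_on {0..1} u" and y: "0 < y" "y < 1" and \<phi>: "test_fun \<phi>"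
  shows "(LINT t:{y<..<1}|lebesgue. u t * deriv \<phi> t) = - u y * \<phi> y - (LINT t:{y<..<1}|lebesgue. g t * \<phi> t)"
proof -
  have l: "loc_integrable u" "loc_integrable g" using wd by (auto simp: weak_deriv_def)
  obtain a b B where ab: "0 < a" "a < b" "b < 1" and z: "\<And>t. t \<notin> {a..b} \<Longrightarrow> \<phi> t = 0"
    "\<And>t. t \<notin> {a..b} \<Longrightarrow> deriv \<phi> t = 0" and B: "\<And>t. \<bar>\<phi> t\<bar> \<le> B" "\<And>t. \<bar>deriv \<phi> t\<bar> \<le> B"
    using test_fun_support[OF \<phi>] by metis
  note meas = test_fun_measurable[OF \<phi>]
  have cu: "isCont u y" by (rule continuous_on_interior[OF u]) (use y in simp)
  have c\<phi>: "isCont \<phi> y" using test_fun_cont[OF \<phi>] by (simp add: continuous_on_eq_continuous_at)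
  have lu: "loc_integrable (\<lambda>t. 1 * (u t * \<phi> t))"
    unfolding loc_integrable_def
    using set_integrable_mult_bounded[OF _ meas(1) B(1), of _ u] l(1) by (auto simp: loc_integrable_def)
  \<comment> \<open>Here the bounded factor is the constant 1 and \<open>\<psi>\<close> is the
    product of \<open>u\<close> and \<open>\<phi>\<close>; the averages of 1 are eventually equal to
    1.\<close>
  have "(\<lambda>n. (LINT t:{0<..<1}|lebesgue. 1 * (u t * \<phi> t) * kern y n t) - u y * \<phi> y * (LINT t:{0<..<1}|lebesgue. 1 * kern y n t)) \<longlonglongrightarrow> 0"
    by (rule kern_conv[OF loc_integrable_const _ lu]) (use y cu c\<phi> in auto)
  moreover have "\<forall>\<^sub>F n in sequentially. (LINT t:{0<..<1}|lebesgue. 1 * kern y n t) = 1"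
    using kern_eventually[OF y(2)] by eventually_elim (use kern_integral[OF y(1)] in simp)
  then have "\<forall>\<^sub>F n in sequentially. (LINT t:{0<..<1}|lebesgue. 1 * (u t * \<phi> t) * kern y n t) - u y * \<phi> y * (LINT t:{0<..<1}|lebesgue. 1 * kern y n t)
    = (LINT t:{0<..<1}|lebesgue. u t * \<phi> t * kern y n t) - u y * \<phi> y"
    by eventually_elim simp
  ultimately have "(\<lambda>n. (LINT t:{0<..<1}|lebesgue. u t * \<phi> t * kern y n t) - u y * \<phi> y) \<longlonglongrightarrow> 0"
    by (rule Lim_transform_eventually)
  then have k: "(\<lambda>n. LINT t:{0<..<1}|lebesgue. u t * \<phi> t * kern y n t) \<longlonglongrightarrow> u y * \<phi> y"
    by (simp add: LIM_zero_iff)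
  have "(\<lambda>n. LINT t:{0<..<1}|lebesgue. u t * (deriv \<phi> t * cutoff y n t)) \<longlonglongrightarrow> (LINT t:{y<..<1}|lebesgue. u t * deriv \<phi> t)"
    by (rule cutoff_conv[OF l(1) meas(2) B(2) ab(1,3) z(2) y(1)])
  from tendsto_add[OF this k]
  have 1: "(\<lambda>n. LINT t:{0<..<1}|lebesgue. u t * deriv (\<lambda>t. \<phi> t * cutoff y n t) t) \<longlonglongrightarrow>
    (LINT t:{y<..<1}|lebesgue. u t * deriv \<phi> t) + u y * \<phi> y"
    by (simp add: cutoff_split[OF l(1) \<phi> y(1)])
  have "(LINT t:{0<..<1}|lebesgue. u t * deriv (\<lambda>t. \<phi> t * cutoff y n t) t) =
    - (LINT t:{0<..<1}|lebesgue. g t * (\<phi> t * cutoff y n t))" for n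
    using wd test_fun_cutoff(1)[OF \<phi>] unfolding weak_deriv_def by blast
  moreover have "(\<lambda>n. LINT t:{0<..<1}|lebesgue. g t * (\<phi> t * cutoff y n t)) \<longlonglongrightarrow> (LINT t:{y<..<1}|lebesgue. g t * \<phi> t)"
    by (rule cutoff_conv[OF l(2) meas(1) B(1) ab(1,3) z(1) y(1)])
  ultimately have 2: "(\<lambda>n. LINT t:{0<..<1}|lebesgue. u t * deriv (\<lambda>t. \<phi> t * cutoff y n t) t) \<longlonglongrightarrow>
    - (LINT t:{y<..<1}|lebesgue. g t * \<phi> t)" by (simp add: tendsto_minus)
  from LIMSEQ_unique[OF 1 2] show ?thesis by simp
qed

text \<open>The half-line is open, so an atom of \<open>M\<close> at \<open>y\<close> is dropped;
  gluing puts its own kink there.\<close>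

definition right_part :: "real \<Rightarrow> real measure \<Rightarrow> real measure" where
  "right_part y M = density M (\<lambda>t. ennreal (indicat_real {y<..} t))"

lemma radon01_right_part:
  assumes "radon01 M" shows "radon01 (right_part y M)"
proof (rule radon01_le[OF assms])
  have m: "(\<lambda>t. ennreal (indicat_real {y<..} t)) \<in> borel_measurable M"
    by (rule radon01_measurable[OF assms]) simp
  fix A assume A: "A \<in> sets M"
  then have "emeasure (right_part y M) A = (\<integral>\<^sup>+t. ennreal (indicat_real {y<..} t) * indicator A t \<partial>M)"
    unfolding right_part_def using m by (simp add: emeasure_density)
  also have "\<dots> \<le> (\<integral>\<^sup>+t. indicator A t \<partial>M)"
    by (intro nn_integral_mono) (auto simp: indicator_def)
  finally show "emeasure (right_part y M) A \<le> emeasure M A" using A by simp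
qed (simp add: right_part_def)

lemma nn_integral_right_part:
  assumes "radon01 M" "\<rho> \<in> borel_measurable borel"
  shows "(\<integral>\<^sup>+t. \<rho> t \<partial>right_part y M) = (\<integral>\<^sup>+t. indicator {y<..} t * \<rho> t \<partial>M)"
proof -
  have "(\<lambda>t. ennreal (indicat_real {y<..} t)) \<in> borel_measurable M" "\<rho> \<in> borel_measurable M"
    by (rule radon01_measurable[OF assms(1)]; use assms(2) in simp)+
  then have "(\<integral>\<^sup>+t. \<rho> t \<partial>right_part y M) = (\<integral>\<^sup>+t. ennreal (indicat_real {y<..} t) * \<rho> t \<partial>M)"
    unfolding right_part_def by (rule nn_integral_density)
  also have "\<dots> = (\<integral>\<^sup>+t. indicator {y<..} t * \<rho> t \<partial>M)"
    by (intro nn_integral_cong) (auto simp: indicator_def)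
  finally show ?thesis .
qed

lemma right_part_conv:
  assumes M: "radon01 M" and \<phi>: "test_fun \<phi>"
  shows "(\<lambda>n. \<integral>t. \<phi> t * cutoff y n t \<partial>M) \<longlonglongrightarrow> (\<integral>t. \<phi> t \<partial>right_part y M)"
proof -
  note meas = radon01_measurable[OF M test_fun_measurable(1)[OF \<phi>]]
  have [measurable]: "(\<lambda>t. indicat_real {y<..} t) \<in> borel_measurable M" "\<And>n. cutoff y n \<in> borel_measurable M" "\<phi> \<in> borel_measurable M"
    using meas by (auto intro: radon01_measurable[OF M])
  have "(\<lambda>n. \<integral>t. \<phi> t * cutoff y n t \<partial>M) \<longlonglongrightarrow> (\<integral>t. \<phi> t * indicat_real {y<..} t \<partial>M)"
  proof (rule integral_dominated_convergence[where w = "\<lambda>t. \<bar>\<phi> t\<bar>"])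
    show "integrable M (\<lambda>t. \<bar>\<phi> t\<bar>)" using radon01_integrable_test[OF M \<phi>] by (rule integrable_abs)
    show "AE t in M. (\<lambda>n. \<phi> t * cutoff y n t) \<longlonglongrightarrow> \<phi> t * indicat_real {y<..} t"
      by (intro AE_I2 tendsto_mult tendsto_const cutoff_LIMSEQ)
    show "AE t in M. norm (\<phi> t * cutoff y n t) \<le> \<bar>\<phi> t\<bar>" for n
      using mult_left_mono[OF cutoff_bounds[of y n], of "\<bar>\<phi> t\<bar>" t for t] by (intro AE_I2) (simp add: abs_mult)
  qed measurable
  also have "(\<integral>t. \<phi> t * indicat_real {y<..} t \<partial>M) = (\<integral>t. \<phi> t \<partial>right_part y M)"
    unfolding right_part_def by (subst integral_density) (auto simp: mult.commute)
  finally show ?thesis .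
qed

text \<open>The one-sided trace \<open>c\<close> of \<open>g\<close> at \<open>y\<close> is a subsequential limit of averages over shrinking
  intervals, so no structure theorem for $BV$ functions is needed.\<close>

lemma half_line_trace:
  assumes md: "measure_deriv g P N" and l: "loc_integrable g"
    and g: "AE t in lebesgue. t \<in> {0<..<1} \<longrightarrow> \<bar>g t\<bar> \<le> 1" and y: "0 < y" "y < 1"
  shows "\<exists>c. \<bar>c\<bar> \<le> 1 \<and> (\<forall>\<phi>. test_fun \<phi> \<longrightarrow> (LINT t:{y<..<1}|lebesgue. g t * deriv \<phi> t) =
    - c * \<phi> y - ((\<integral>t. \<phi> t \<partial>right_part y P) - (\<integral>t. \<phi> t \<partial>right_part y N)))"
proof -
  have PN: "radon01 P" "radon01 N" using md by (auto simp: measure_deriv_def)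
  define a where "a n = (LINT t:{0<..<1}|lebesgue. g t * kern y n t)" for n
  \<comment> \<open>From \<open>n0\<close> on the kernel has its whole unit mass inside the unit
    interval, which bounds the averages of \<open>g\<close> by 1.\<close>
  obtain n0 where n0: "\<And>n. n \<ge> n0 \<Longrightarrow> y + 1 / real (Suc n) < 1"
    using kern_eventually[OF y(2)] by (auto simp: eventually_sequentially)
  have "a n \<in> {-1..1}" if "n \<ge> n0" for n
  proof -
    have "\<bar>a n\<bar> \<le> (LINT t:{0<..<1}|lebesgue. 1 * kern y n t)"
      unfolding a_def
    proof (rule set_integral_abs_le)
      show "AE t in lebesgue. t \<in> {0<..<1} \<longrightarrow> \<bar>g t * kern y n t\<bar> \<le> 1 * kern y n t"
        using g by eventually_elim (auto simp: abs_mult kern_nonneg intro!: mult_left_le_one_le)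
    qed (intro loc_integrable_kern l loc_integrable_const y n0[OF that])+
    then show ?thesis using kern_integral[OF y(1) n0[OF that]] by (auto simp: abs_le_iff)
  qed
  then have "\<forall>n. a (n + n0) \<in> {-1..1}" by auto
  \<comment> \<open>The trace \<open>c\<close> and the subsequence are fixed before any test
    function, so one value serves all of them.\<close>
  then obtain c r where c: "c \<in> {-1..1}" and r: "strict_mono r" and lim: "((\<lambda>n. a (n + n0)) \<circ> r) \<longlonglongrightarrow> c"
    by (rule seq_compactE[OF compact_imp_seq_compact[OF compact_Icc]])
  define s where "s n = r n + n0" for n
  have s: "filterlim s at_top sequentially"
  proof (rule filterlim_at_top_mono[OF filterlim_subseq[OF r]])
    show "\<forall>\<^sub>F n in sequentially. r n \<le> s n" by (simp add: s_def)
  qed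
  have as: "(\<lambda>n. a (s n)) \<longlonglongrightarrow> c" using lim by (simp add: s_def o_def)
  have "(LINT t:{y<..<1}|lebesgue. g t * deriv \<phi> t) =
    - c * \<phi> y - ((\<integral>t. \<phi> t \<partial>right_part y P) - (\<integral>t. \<phi> t \<partial>right_part y N))" if \<phi>: "test_fun \<phi>" for \<phi>
  proof -
    obtain a' b B where ab: "0 < a'" "a' < b" "b < 1" and z: "\<And>t. t \<notin> {a'..b} \<Longrightarrow> \<phi> t = 0"
      "\<And>t. t \<notin> {a'..b} \<Longrightarrow> deriv \<phi> t = 0" and B: "\<And>t. \<bar>\<phi> t\<bar> \<le> B" "\<And>t. \<bar>deriv \<phi> t\<bar> \<le> B"
      using test_fun_support[OF \<phi>] by metis
    note meas = test_fun_measurable[OF \<phi>]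
    have c\<phi>: "isCont \<phi> y" using test_fun_cont[OF \<phi>] by (simp add: continuous_on_eq_continuous_at)
    have lg: "loc_integrable (\<lambda>t. g t * \<phi> t)"
      unfolding loc_integrable_def
      using set_integrable_mult_bounded[OF _ meas(1) B(1), of _ g] l(1) by (auto simp: loc_integrable_def)
    have "(\<lambda>n. (LINT t:{0<..<1}|lebesgue. g t * \<phi> t * kern y n t) - \<phi> y * a n) \<longlonglongrightarrow> 0"
      unfolding a_def by (rule kern_conv[OF l g lg c\<phi> y])
    from filterlim_compose[OF this s]
    have "(\<lambda>n. (LINT t:{0<..<1}|lebesgue. g t * \<phi> t * kern y (s n) t) - \<phi> y * a (s n)) \<longlonglongrightarrow> 0" .
    from tendsto_add[OF this tendsto_mult[OF tendsto_const[of "\<phi> y"] as]]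
    have k: "(\<lambda>n. LINT t:{0<..<1}|lebesgue. g t * \<phi> t * kern y (s n) t) \<longlonglongrightarrow> \<phi> y * c" by simp
    have "(\<lambda>n. LINT t:{0<..<1}|lebesgue. g t * (deriv \<phi> t * cutoff y n t)) \<longlonglongrightarrow> (LINT t:{y<..<1}|lebesgue. g t * deriv \<phi> t)"
      by (rule cutoff_conv[OF l(1) meas(2) B(2) ab(1,3) z(2) y(1)])
    from tendsto_add[OF filterlim_compose[OF this s] k]
    have 1: "(\<lambda>n. LINT t:{0<..<1}|lebesgue. g t * deriv (\<lambda>t. \<phi> t * cutoff y (s n) t) t) \<longlonglongrightarrow>
      (LINT t:{y<..<1}|lebesgue. g t * deriv \<phi> t) + \<phi> y * c"
      by (simp add: cutoff_split[OF l(1) \<phi> y(1)])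
    have "(LINT t:{0<..<1}|lebesgue. g t * deriv (\<lambda>t. \<phi> t * cutoff y n t) t) =
      - ((\<integral>t. \<phi> t * cutoff y n t \<partial>P) - (\<integral>t. \<phi> t * cutoff y n t \<partial>N))" for n
      using md test_fun_cutoff(1)[OF \<phi>] unfolding measure_deriv_def by blast
    then have 2: "(\<lambda>n. LINT t:{0<..<1}|lebesgue. g t * deriv (\<lambda>t. \<phi> t * cutoff y (s n) t) t) \<longlonglongrightarrow>
      - ((\<integral>t. \<phi> t \<partial>right_part y P) - (\<integral>t. \<phi> t \<partial>right_part y N))"
      using PN \<phi> s by (auto intro!: tendsto_intros filterlim_compose[OF right_part_conv])
    from LIMSEQ_unique[OF 1 2] show ?thesis by (simp add: algebra_simps)
  qed
  then show ?thesis using c by (intro exI[of _ c]) auto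
qed

section \<open>Competitors and gluing\<close>

text \<open>A functional stands for a piece of the second derivative, including boundary terms.
  Unlike total variations, such bounds simply add when pieces are joined, and only an upper bound
  \<open>E\<close> on the weighted mass is recorded because overlap between \<open>P\<close> and
  \<open>N\<close> is harmless.\<close>

definition represented :: "(real \<Rightarrow> ennreal) \<Rightarrow> ((real \<Rightarrow> real) \<Rightarrow> real) \<Rightarrow> ennreal \<Rightarrow> bool" where
  "represented \<rho> L E \<longleftrightarrow> (\<exists>P N. radon01 P \<and> radon01 N \<and>
     (\<forall>\<phi>. test_fun \<phi> \<longrightarrow> L \<phi> = (\<integral>t. \<phi> t \<partial>P) - (\<integral>t. \<phi> t \<partial>N)) \<and>
     (\<integral>\<^sup>+t. \<rho> t \<partial>P) + (\<integral>\<^sup>+t. \<rho> t \<partial>N) \<le> E)"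

lemma represented_mono:
  assumes "represented \<rho> L E" "E \<le> E'" "\<And>\<phi>. test_fun \<phi> \<Longrightarrow> L' \<phi> = L \<phi>"
  shows "represented \<rho> L' E'"
  using assms unfolding represented_def by (metis order_trans)

lemma represented_point:
  assumes \<rho>: "\<rho> \<in> borel_measurable borel" and a: "a \<in> {0<..<1}"
  shows "represented \<rho> (\<lambda>\<phi>. s * \<phi> a) (ennreal \<bar>s\<bar> * \<rho> a)"
  unfolding represented_def
proof (intro exI conjI allI impI)
  \<comment> \<open>Splitting \<open>s\<close> into positive and negative part leaves at most one
    nonzero mass, so no weight beyond \<open>\<bar>s\<bar>\<close> is spent.\<close>
  let ?P = "point_mass a (max s 0)" and ?N = "point_mass a (max (-s) 0)"
  show "radon01 ?P" "radon01 ?N" using a by (auto intro: radon01_point_mass)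
  fix \<phi> assume "test_fun \<phi>"
  then show "s * \<phi> a = (\<integral>t. \<phi> t \<partial>?P) - (\<integral>t. \<phi> t \<partial>?N)"
    using a by (subst (1 2) integral_point_mass)
      (auto intro: measurable_restrict_space1 test_fun_measurable simp: max_def)
next
  have "ennreal (max s 0) + ennreal (max (-s) 0) = ennreal \<bar>s\<bar>" by (auto simp: max_def abs_if ennreal_neg)
  then show "(\<integral>\<^sup>+t. \<rho> t \<partial>point_mass a (max s 0)) + (\<integral>\<^sup>+t. \<rho> t \<partial>point_mass a (max (-s) 0)) \<le> ennreal \<bar>s\<bar> * \<rho> a"
    using a \<rho> by (subst (1 2) nn_integral_point_mass)
      (auto intro: measurable_restrict_space1 simp: distrib_right[symmetric])
qed

lemma represented_zero:
  assumes "\<rho> \<in> borel_measurable borel"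
  shows "represented \<rho> (\<lambda>_. 0) 0"
  using represented_point[OF assms, of "1/2" 0] by simp

lemma represented_add:
  assumes \<rho>: "\<rho> \<in> borel_measurable borel" and 1: "represented \<rho> L1 E1" and 2: "represented \<rho> L2 E2"
  shows "represented \<rho> (\<lambda>\<phi>. L1 \<phi> + L2 \<phi>) (E1 + E2)"
proof -
  obtain P1 N1 where 1: "radon01 P1" "radon01 N1"
     "\<And>\<phi>. test_fun \<phi> \<Longrightarrow> L1 \<phi> = (\<integral>t. \<phi> t \<partial>P1) - (\<integral>t. \<phi> t \<partial>N1)"
     "(\<integral>\<^sup>+t. \<rho> t \<partial>P1) + (\<integral>\<^sup>+t. \<rho> t \<partial>N1) \<le> E1"
    using 1 unfolding represented_def by blast
  obtain P2 N2 where 2: "radon01 P2" "radon01 N2"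
     "\<And>\<phi>. test_fun \<phi> \<Longrightarrow> L2 \<phi> = (\<integral>t. \<phi> t \<partial>P2) - (\<integral>t. \<phi> t \<partial>N2)"
     "(\<integral>\<^sup>+t. \<rho> t \<partial>P2) + (\<integral>\<^sup>+t. \<rho> t \<partial>N2) \<le> E2"
    using 2 unfolding represented_def by blast
  note s = radon01_sets[OF 1(1)] radon01_sets[OF 1(2)] radon01_sets[OF 2(1)] radon01_sets[OF 2(2)]
  show ?thesis unfolding represented_def
  proof (intro exI conjI allI impI)
    show "radon01 (madd P1 P2)" "radon01 (madd N1 N2)" using 1 2 by (auto intro: radon01_madd)
    show "L1 \<phi> + L2 \<phi> = (\<integral>t. \<phi> t \<partial>madd P1 P2) - (\<integral>t. \<phi> t \<partial>madd N1 N2)" if "test_fun \<phi>" for \<phi>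
      using 1 2 that s by (simp add: integral_madd radon01_integrable_test)
    have "(\<integral>\<^sup>+t. \<rho> t \<partial>madd P1 P2) + (\<integral>\<^sup>+t. \<rho> t \<partial>madd N1 N2) =
      ((\<integral>\<^sup>+t. \<rho> t \<partial>P1) + (\<integral>\<^sup>+t. \<rho> t \<partial>N1)) + ((\<integral>\<^sup>+t. \<rho> t \<partial>P2) + (\<integral>\<^sup>+t. \<rho> t \<partial>N2))"
      using s radon01_measurable[OF 1(1) \<rho>] radon01_measurable[OF 1(2) \<rho>] by (simp add: nn_integral_madd ac_simps)
    then show "(\<integral>\<^sup>+t. \<rho> t \<partial>madd P1 P2) + (\<integral>\<^sup>+t. \<rho> t \<partial>madd N1 N2) \<le> E1 + E2"
      using 1(4) 2(4) by (simp add: add_mono)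
  qed
qed

section \<open>Elastic energy and gluing of functions\<close>

definition elastic :: "real \<Rightarrow> (real \<Rightarrow> real) \<Rightarrow> real \<Rightarrow> real \<Rightarrow> ennreal" where
  "elastic \<beta> w a b = (\<integral>\<^sup>+ t \<in> {a<..<b}. ennreal (t powr (- \<beta>) * (w t)\<^sup>2) \<partial>lebesgue)"

lemma elastic_cong:
  assumes "\<And>t. a < t \<Longrightarrow> t < b \<Longrightarrow> v t = w t"
  shows "elastic \<beta> v a b = elastic \<beta> w a b"
  unfolding elastic_def using assms by (intro nn_integral_cong) (auto simp: indicator_def)

lemma elastic_measurable:
  assumes "continuous_on {c..d} w" "{a<..<b} \<subseteq> {c..d}"
  shows "(\<lambda>t. ennreal (t powr (- \<beta>) * (w t)\<^sup>2) * indicator {a<..<b} t) \<in> borel_measurable lebesgue"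
proof -
  have [measurable]: "(\<lambda>t. indicator {c..d} t *\<^sub>R w t) \<in> borel_measurable borel"
    using assms(1) by (intro borel_measurable_continuous_on_indicator) auto
  have "(\<lambda>t. ennreal (t powr (- \<beta>) * (indicator {c..d} t *\<^sub>R w t)\<^sup>2) * indicator {a<..<b} t) \<in> borel_measurable borel"
    by measurable
  also have "(\<lambda>t. ennreal (t powr (- \<beta>) * (indicator {c..d} t *\<^sub>R w t)\<^sup>2) * indicator {a<..<b} t) =
    (\<lambda>t. ennreal (t powr (- \<beta>) * (w t)\<^sup>2) * indicator {a<..<b} t)"
    using assms(2) by (auto simp: fun_eq_iff indicator_def)
  finally show ?thesis by (simp add: measurable_completion)
qed

lemma elastic_split:
  assumes w: "continuous_on {a..b} w" and y: "a < y" "y < b"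
  shows "elastic \<beta> w a b = elastic \<beta> w a y + elastic \<beta> w y b"
proof -
  have "elastic \<beta> w a b = (\<integral>\<^sup>+t. ennreal (t powr (- \<beta>) * (w t)\<^sup>2) * indicator {a<..<y} t +
     ennreal (t powr (- \<beta>) * (w t)\<^sup>2) * indicator {y<..<b} t \<partial>lebesgue)"
    unfolding elastic_def
  proof (rule nn_integral_cong_AE)
    have "AE t in lebesgue. t \<noteq> y"
      by (rule AE_I'[of "{y}"]) (auto simp: null_sets_completionI)
    then show "AE t in lebesgue. ennreal (t powr (- \<beta>) * (w t)\<^sup>2) * indicator {a<..<b} t =
      ennreal (t powr (- \<beta>) * (w t)\<^sup>2) * indicator {a<..<y} t + ennreal (t powr (- \<beta>) * (w t)\<^sup>2) * indicator {y<..<b} t"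
      by eventually_elim (use y in \<open>auto simp: indicator_def\<close>)
  qed
  also have "\<dots> = elastic \<beta> w a y + elastic \<beta> w y b"
    unfolding elastic_def
    by (rule nn_integral_add) (rule elastic_measurable[OF w]; use y in auto)+
  finally show ?thesis .
qed

lemma loc_integrable_glue:
  assumes "loc_integrable f" "loc_integrable g"
  shows "loc_integrable (\<lambda>t. if t < y then f t else g t)"
  unfolding loc_integrable_def
proof (intro allI impI)
  fix a b :: real assume ab: "0 < a" "b < 1"
  have "set_integrable lebesgue ({a..b} \<inter> {..<y}) f" "set_integrable lebesgue ({a..b} \<inter> {y..}) g"
    by (rule set_integrable_subset[of _ "{a..b}"]; use assms ab in \<open>auto simp: loc_integrable_def\<close>)+
  then have "integrable lebesgue (\<lambda>t. indicat_real ({a..b} \<inter> {..<y}) t *\<^sub>R f t + indicat_real ({a..b} \<inter> {y..}) t *\<^sub>R g t)"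
    unfolding set_integrable_def by (rule Bochner_Integration.integrable_add)
  also have "(\<lambda>t. indicat_real ({a..b} \<inter> {..<y}) t *\<^sub>R f t + indicat_real ({a..b} \<inter> {y..}) t *\<^sub>R g t) =
    (\<lambda>t. indicat_real {a..b} t *\<^sub>R (if t < y then f t else g t))"
    by (auto simp: fun_eq_iff indicator_def)
  finally show "set_integrable lebesgue {a..b} (\<lambda>t. if t < y then f t else g t)"
    by (simp add: set_integrable_def)
qed

lemma continuous_glue:
  fixes f g :: "real \<Rightarrow> real"
  assumes "continuous_on {a..y} f" "continuous_on {y..b} g" "f y = g y" "a \<le> y" "y \<le> b"
  shows "continuous_on {a..b} (\<lambda>t. if t \<le> y then f t else g t)"
proof -
  have "continuous_on ({a..y} \<union> {y..b}) (\<lambda>t. if t \<le> y then f t else g t)"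
  proof (rule continuous_on_If)
    fix t assume "t \<in> {y..b}" "t \<le> y"
    then have "t = y" by simp
    then show "f t = g t" using assms(3) by simp
  qed (use assms in auto)
  also have "{a..y} \<union> {y..b} = {a..b}" using assms by auto
  finally show ?thesis .
qed

lemma set_integrable_continuous_test:
  assumes "continuous_on {a..b} w" "test_fun \<phi>"
  shows "set_integrable lebesgue {a<..<b} (\<lambda>t. w t * deriv \<phi> t)"
proof -
  have "continuous_on {a..b} (\<lambda>t. w t * deriv \<phi> t)"
    using assms test_fun_cont_deriv continuous_on_subset by (intro continuous_intros) blast+
  then have "set_integrable lebesgue {a..b} (\<lambda>t. w t * deriv \<phi> t)"
    using absolutely_integrable_continuous_real by simp
  then show ?thesis by (rule set_integrable_subset) auto
qed

lemma loc_integrable_test: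
  assumes f: "loc_integrable f" and \<phi>: "test_fun \<phi>" and "0 \<le> a" "b \<le> 1"
  shows "set_integrable lebesgue {a<..<b} (\<lambda>t. f t * \<phi> t)" "set_integrable lebesgue {a<..<b} (\<lambda>t. f t * deriv \<phi> t)"
proof -
  obtain c d B where ab: "0 < c" "c < d" "d < 1" and z: "\<And>t. t \<notin> {c..d} \<Longrightarrow> \<phi> t = 0"
    "\<And>t. t \<notin> {c..d} \<Longrightarrow> deriv \<phi> t = 0" and B: "\<And>t. \<bar>\<phi> t\<bar> \<le> B" "\<And>t. \<bar>deriv \<phi> t\<bar> \<le> B"
    using test_fun_support[OF \<phi>] by metis
  have "set_integrable lebesgue {0<..<1} (\<lambda>t. f t * \<phi> t)" "set_integrable lebesgue {0<..<1} (\<lambda>t. f t * deriv \<phi> t)"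
    using loc_integrable_mult_test(1)[OF f test_fun_measurable(1)[OF \<phi>] B(1) ab(1,3) z(1)]
      loc_integrable_mult_test(1)[OF f test_fun_measurable(2)[OF \<phi>] B(2) ab(1,3) z(2)] by auto
  then show "set_integrable lebesgue {a<..<b} (\<lambda>t. f t * \<phi> t)" "set_integrable lebesgue {a<..<b} (\<lambda>t. f t * deriv \<phi> t)"
    using assms(3,4) by (auto elim!: set_integrable_subset)
qed

lemma set_integral_cong_open:
  fixes f g :: "real \<Rightarrow> real"
  assumes "\<And>t. a < t \<Longrightarrow> t < b \<Longrightarrow> f t = g t"
  shows "(LINT t:{a<..<b}|M. f t) = (LINT t:{a<..<b}|M. g t)"
  unfolding set_lebesgue_integral_def
  by (intro Bochner_Integration.integral_cong) (use assms in \<open>auto simp: indicator_def\<close>)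

text \<open>The boundary terms at both ends are kept: when pieces are joined, those of the function
  cancel and those of the slope combine into a kink.\<close>

lemma segment_parts:
  assumes \<phi>: "test_fun \<phi>" and ab: "a \<le> b"
  shows "(LINT t:{a<..<b}|lebesgue. (m + s * (t - a)) * deriv \<phi> t) =
      (m + s * (b - a)) * \<phi> b - m * \<phi> a - (LINT t:{a<..<b}|lebesgue. s * \<phi> t)" (is ?A)
    and "(LINT t:{a<..<b}|lebesgue. s * deriv \<phi> t) = s * \<phi> b - s * \<phi> a" (is ?B)
proof -
  have c: "continuous_on S \<phi>" "continuous_on S (deriv \<phi>)" for S
    using test_fun_cont[OF \<phi>] test_fun_cont_deriv[OF \<phi>] by (auto intro: continuous_on_subset)
  have i: "set_integrable lebesgue {a<..<b} (\<lambda>t. (m + s * (t - a)) * deriv \<phi> t)"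
    by (rule set_integrable_continuous_test[OF _ \<phi>]) (intro continuous_intros)
  have "continuous_on {a..b} (\<lambda>t. s * \<phi> t)" by (intro continuous_intros c)
  then have "set_integrable lebesgue {a..b} (\<lambda>t. s * \<phi> t)"
    using absolutely_integrable_continuous_real by simp
  then have i2: "set_integrable lebesgue {a<..<b} (\<lambda>t. s * \<phi> t)" by (rule set_integrable_subset) auto
  have "(LINT t:{a<..<b}|lebesgue. (m + s * (t - a)) * deriv \<phi> t + s * \<phi> t) =
    (m + s * (b - a)) * \<phi> b - (m + s * (a - a)) * \<phi> a"
    by (rule FTC_lebesgue(2)[OF ab, of "\<lambda>t. (m + s * (t - a)) * \<phi> t"])
      (auto intro!: derivative_eq_intros test_fun_deriv \<phi> continuous_intros c)
  then show ?A using set_integral_add(2)[OF i i2] by simp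
  show ?B
    by (rule FTC_lebesgue(2)[OF ab, of "\<lambda>t. s * \<phi> t"])
      (auto intro!: derivative_eq_intros test_fun_deriv \<phi> continuous_intros c)
qed

text \<open>The number \<open>l\<close> plays the role of the left trace of the slope \<open>g\<close> at \<open>b\<close>; it allows the
  derivative of \<open>g\<close> on \<open>{0<..<b}\<close> to be tested against functions not vanishing at \<open>b\<close>.\<close>

definition zigzag :: "real \<Rightarrow> real \<Rightarrow> real \<Rightarrow> real \<Rightarrow> real \<Rightarrow> ennreal \<Rightarrow> bool" where
  "zigzag \<alpha> \<beta> \<epsilon> b m E \<longleftrightarrow> (\<exists>w g l F. continuous_on {0..b} w \<and> w 0 = 0 \<and> w b = m \<and>
     loc_integrable g \<and> (\<forall>t. \<bar>g t\<bar> = 1) \<and> \<bar>l\<bar> \<le> 1 \<and>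
     (\<forall>\<phi>. test_fun \<phi> \<longrightarrow> (LINT t:{0<..<b}|lebesgue. w t * deriv \<phi> t) =
        m * \<phi> b - (LINT t:{0<..<b}|lebesgue. g t * \<phi> t)) \<and>
     represented (\<lambda>t. ennreal (\<epsilon> * t powr \<alpha>))
       (\<lambda>\<phi>. l * \<phi> b - (LINT t:{0<..<b}|lebesgue. g t * deriv \<phi> t)) F \<and>
     F + elastic \<beta> w 0 b \<le> E)"

lemma zigzag_mono: "zigzag \<alpha> \<beta> \<epsilon> b m E \<Longrightarrow> E \<le> E' \<Longrightarrow> zigzag \<alpha> \<beta> \<epsilon> b m E'"
  unfolding zigzag_def
  by (elim exE conjE) (intro exI conjI, (assumption | erule order_trans)+)

text \<open>A single straight piece out of the origin has no kink inside, so its cost is purely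
  elastic.\<close>

lemma zigzag_linear:
  assumes "0 < b" "\<bar>s\<bar> = 1"
  shows "zigzag \<alpha> \<beta> \<epsilon> b (s * b) (elastic \<beta> (\<lambda>t. s * t) 0 b)"
  unfolding zigzag_def
proof (intro exI conjI allI impI)
  show "represented (\<lambda>t. ennreal (\<epsilon> * t powr \<alpha>)) (\<lambda>\<phi>. s * \<phi> b - (LINT t:{0<..<b}|lebesgue. s * deriv \<phi> t)) 0"
  proof (rule represented_mono[OF represented_zero])
    fix \<phi> assume \<phi>: "test_fun \<phi>"
    have "\<phi> 0 = 0" using \<phi> by (rule test_fun_zero) simp
    then show "s * \<phi> b - (LINT t:{0<..<b}|lebesgue. s * deriv \<phi> t) = 0"
      using segment_parts(2)[OF \<phi>, of 0 b s] assms by auto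
  qed auto
  fix \<phi> assume \<phi>: "test_fun \<phi>"
  show "(LINT t:{0<..<b}|lebesgue. s * t * deriv \<phi> t) = s * b * \<phi> b - (LINT t:{0<..<b}|lebesgue. s * \<phi> t)"
    using segment_parts(1)[OF \<phi>, of 0 b 0 s] assms by simp
qed (use assms in \<open>auto intro!: continuous_intros loc_integrable_const\<close>)

text \<open>The old trace \<open>l\<close> and the new slope \<open>s\<close> are bounded by 1 in
  modulus, so the kink at \<open>a\<close> has jump at most 2. The slope \<open>s\<close> becomes
  the trace at the new right end, ready for the next piece.\<close>

lemma zigzag_extend:
  assumes z: "zigzag \<alpha> \<beta> \<epsilon> a m E" and a: "0 < a" "a < b" "b \<le> 1" and s: "\<bar>s\<bar> = 1" and \<epsilon>: "\<epsilon> > 0"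
  shows "zigzag \<alpha> \<beta> \<epsilon> b (m + s * (b - a))
    (E + ennreal (2 * \<epsilon> * a powr \<alpha>) + elastic \<beta> (\<lambda>t. m + s * (t - a)) a b)"
proof -
  let ?\<rho> = "\<lambda>t. ennreal (\<epsilon> * t powr \<alpha>)"
  obtain w g l F where w: "continuous_on {0..a} w" "w 0 = 0" "w a = m"
    and g: "loc_integrable g" "\<And>t. \<bar>g t\<bar> = 1" and l: "\<bar>l\<bar> \<le> 1"
    and wg: "\<And>\<phi>. test_fun \<phi> \<Longrightarrow> (LINT t:{0<..<a}|lebesgue. w t * deriv \<phi> t) =
        m * \<phi> a - (LINT t:{0<..<a}|lebesgue. g t * \<phi> t)"
    and r: "represented ?\<rho> (\<lambda>\<phi>. l * \<phi> a - (LINT t:{0<..<a}|lebesgue. g t * deriv \<phi> t)) F"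
    and E: "F + elastic \<beta> w 0 a \<le> E"
    using z unfolding zigzag_def by blast
  define w' where "w' t = (if t \<le> a then w t else m + s * (t - a))" for t
  define g' where "g' t = (if t < a then g t else s)" for t
  have w': "continuous_on {0..b} w'"
    unfolding w'_def by (rule continuous_glue) (use a w in \<open>auto intro!: continuous_intros\<close>)
  have g': "loc_integrable g'" unfolding g'_def by (intro loc_integrable_glue g loc_integrable_const)
  show ?thesis unfolding zigzag_def
  proof (intro exI conjI allI impI)
    show "continuous_on {0..b} w'" "loc_integrable g'" by fact+
    show "w' 0 = 0" "w' b = m + s * (b - a)" "\<bar>s\<bar> \<le> 1" "\<And>t. \<bar>g' t\<bar> = 1"
      using a w s g by (auto simp: w'_def g'_def)
    show "(LINT t:{0<..<b}|lebesgue. w' t * deriv \<phi> t) =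
        (m + s * (b - a)) * \<phi> b - (LINT t:{0<..<b}|lebesgue. g' t * \<phi> t)" if \<phi>: "test_fun \<phi>" for \<phi>
    proof -
      have "(LINT t:{0<..<b}|lebesgue. w' t * deriv \<phi> t) = (LINT t:{0<..<a}|lebesgue. w' t * deriv \<phi> t) +
        (LINT t:{a<..<b}|lebesgue. w' t * deriv \<phi> t)"
        using set_integrable_continuous_test[OF w' \<phi>] a by (intro set_integral_split_open) auto
      also have "(LINT t:{0<..<a}|lebesgue. w' t * deriv \<phi> t) = (LINT t:{0<..<a}|lebesgue. w t * deriv \<phi> t)"
        by (rule set_integral_cong_open) (simp add: w'_def)
      also have "(LINT t:{a<..<b}|lebesgue. w' t * deriv \<phi> t) = (LINT t:{a<..<b}|lebesgue. (m + s * (t - a)) * deriv \<phi> t)"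
        by (rule set_integral_cong_open) (simp add: w'_def)
      finally have 1: "(LINT t:{0<..<b}|lebesgue. w' t * deriv \<phi> t) = (m + s * (b - a)) * \<phi> b
         - (LINT t:{0<..<a}|lebesgue. g t * \<phi> t) - (LINT t:{a<..<b}|lebesgue. s * \<phi> t)"
        using segment_parts(1)[OF \<phi>, of a b m s] wg[OF \<phi>] a by simp
      have "(LINT t:{0<..<b}|lebesgue. g' t * \<phi> t) = (LINT t:{0<..<a}|lebesgue. g' t * \<phi> t) +
        (LINT t:{a<..<b}|lebesgue. g' t * \<phi> t)"
        using loc_integrable_test[OF g' \<phi>, of 0 b] a by (intro set_integral_split_open) auto
      also have "(LINT t:{0<..<a}|lebesgue. g' t * \<phi> t) = (LINT t:{0<..<a}|lebesgue. g t * \<phi> t)"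
        by (rule set_integral_cong_open) (simp add: g'_def)
      also have "(LINT t:{a<..<b}|lebesgue. g' t * \<phi> t) = (LINT t:{a<..<b}|lebesgue. s * \<phi> t)"
        by (rule set_integral_cong_open) (simp add: g'_def)
      finally show ?thesis using 1 by simp
    qed
    \<comment> \<open>This point mass turns the boundary term \<open>l * \<phi> a\<close> of the old
      piece into \<open>s * \<phi> a\<close>, which is what the new segment leaves at its left
      end.\<close>
    have "represented ?\<rho> (\<lambda>\<phi>. (s - l) * \<phi> a) (ennreal \<bar>s - l\<bar> * ?\<rho> a)"
      using a by (intro represented_point) auto
    from represented_add[OF _ r this]
    have "represented ?\<rho> (\<lambda>\<phi>. l * \<phi> a - (LINT t:{0<..<a}|lebesgue. g t * deriv \<phi> t) + (s - l) * \<phi> a) (F + ennreal \<bar>s - l\<bar> * ?\<rho> a)"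
      by measurable
    then show "represented ?\<rho> (\<lambda>\<phi>. s * \<phi> b - (LINT t:{0<..<b}|lebesgue. g' t * deriv \<phi> t)) (F + ennreal (2 * \<epsilon> * a powr \<alpha>))"
    proof (rule represented_mono)
      have "ennreal \<bar>s - l\<bar> * ?\<rho> a = ennreal (\<bar>s - l\<bar> * (\<epsilon> * a powr \<alpha>))"
        using \<epsilon> by (simp add: ennreal_mult)
      also have "\<dots> \<le> ennreal (2 * (\<epsilon> * a powr \<alpha>))"
        using s l \<epsilon> by (intro ennreal_leI mult_right_mono) auto
      finally show "F + ennreal \<bar>s - l\<bar> * ?\<rho> a \<le> F + ennreal (2 * \<epsilon> * a powr \<alpha>)"
        by (simp add: add_left_mono mult.assoc)
      fix \<phi> assume \<phi>: "test_fun \<phi>"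
      have "(LINT t:{0<..<b}|lebesgue. g' t * deriv \<phi> t) = (LINT t:{0<..<a}|lebesgue. g' t * deriv \<phi> t) +
        (LINT t:{a<..<b}|lebesgue. g' t * deriv \<phi> t)"
        using loc_integrable_test[OF g' \<phi>, of 0 b] a by (intro set_integral_split_open) auto
      also have "(LINT t:{0<..<a}|lebesgue. g' t * deriv \<phi> t) = (LINT t:{0<..<a}|lebesgue. g t * deriv \<phi> t)"
        by (rule set_integral_cong_open) (simp add: g'_def)
      also have "(LINT t:{a<..<b}|lebesgue. g' t * deriv \<phi> t) = (LINT t:{a<..<b}|lebesgue. s * deriv \<phi> t)"
        by (rule set_integral_cong_open) (simp add: g'_def)
      finally show "s * \<phi> b - (LINT t:{0<..<b}|lebesgue. g' t * deriv \<phi> t) =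
        l * \<phi> a - (LINT t:{0<..<a}|lebesgue. g t * deriv \<phi> t) + (s - l) * \<phi> a"
        using segment_parts(2)[OF \<phi>, of a b s] a by (simp add: algebra_simps)
    qed
    have "elastic \<beta> w' 0 b = elastic \<beta> w' 0 a + elastic \<beta> w' a b"
      using w' a(1,2) by (rule elastic_split)
    also have "elastic \<beta> w' 0 a = elastic \<beta> w 0 a" by (rule elastic_cong) (simp add: w'_def)
    also have "elastic \<beta> w' a b = elastic \<beta> (\<lambda>t. m + s * (t - a)) a b" by (rule elastic_cong) (simp add: w'_def)
    finally have "F + ennreal (2 * \<epsilon> * a powr \<alpha>) + elastic \<beta> w' 0 b =
      (F + elastic \<beta> w 0 a) + (ennreal (2 * \<epsilon> * a powr \<alpha>) + elastic \<beta> (\<lambda>t. m + s * (t - a)) a b)"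
      by (simp add: ac_simps)
    also have "\<dots> \<le> E + (ennreal (2 * \<epsilon> * a powr \<alpha>) + elastic \<beta> (\<lambda>t. m + s * (t - a)) a b)"
      using E by (rule add_right_mono)
    finally show "F + ennreal (2 * \<epsilon> * a powr \<alpha>) + elastic \<beta> w' 0 b \<le>
      E + ennreal (2 * \<epsilon> * a powr \<alpha>) + elastic \<beta> (\<lambda>t. m + s * (t - a)) a b"
      by (simp add: add.assoc)
  qed
qed

section \<open>From zigzags to admissible functions\<close>

lemma loc_integrable_indicator_measurable:
  assumes "loc_integrable g"
  shows "(\<lambda>t. indicat_real {0<..<1} t *\<^sub>R g t) \<in> borel_measurable lebesgue"
proof (rule borel_measurable_LIMSEQ_real)
  let ?f = "\<lambda>n t. indicat_real {1 / real (Suc n) .. 1 - 1 / real (Suc n)} t *\<^sub>R g t"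
  show "?f n \<in> borel_measurable lebesgue" for n
    using assms unfolding loc_integrable_def set_integrable_def
    by (auto intro!: borel_measurable_integrable)
  fix t
  show "(\<lambda>n. ?f n t) \<longlonglongrightarrow> indicat_real {0<..<1} t *\<^sub>R g t"
  proof (cases "t \<in> {0<..<1}")
    case True
    then have "min t (1 - t) > 0" by auto
    then obtain N where N: "inverse (real (Suc N)) < min t (1 - t)" using reals_Archimedean by blast
    have "?f n t = indicat_real {0<..<1} t *\<^sub>R g t" if "n \<ge> N" for n
    proof -
      have "1 / real (Suc n) \<le> inverse (real (Suc N))"
        using that by (simp add: inverse_eq_divide frac_le)
      then show ?thesis using N True by (simp add: indicator_def)
    qed
    then show ?thesis by (intro tendsto_eventually) (auto simp: eventually_sequentially)
  next
    case False
    have "t \<notin> {1 / real (Suc n) .. 1 - 1 / real (Suc n)}" for n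
    proof -
      have "1 / real (Suc n) > 0" by simp
      then show ?thesis using False unfolding greaterThanLessThan_iff atLeastAtMost_iff by linarith
    qed
    then show ?thesis using False by simp
  qed
qed

text \<open>The energy is defined through the total variation itself, whereas a competitor comes
  with some representation of its second derivative. By \<open>tv_second_deriv_eq\<close> the latter
  costs at least as much.\<close>

lemma admissible_energy_le:
  assumes v: "continuous_on {0..1} v" "v 0 = 0" "v 1 = 0"
    and g: "loc_integrable g" "AE t in lebesgue. t \<in> {0<..<1} \<longrightarrow> \<bar>g t\<bar> = 1"
    and vg: "\<And>\<phi>. test_fun \<phi> \<Longrightarrow> (LINT t:{0<..<1}|lebesgue. v t * deriv \<phi> t) = - (LINT t:{0<..<1}|lebesgue. g t * \<phi> t)"
    and r: "represented (\<lambda>t. ennreal (\<epsilon> * t powr \<alpha>)) (\<lambda>\<phi>. - (LINT t:{0<..<1}|lebesgue. g t * deriv \<phi> t)) F"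
  shows "v \<in> admissible" "energy \<alpha> \<beta> \<epsilon> v \<le> F + elastic \<beta> v 0 1"
proof -
  let ?\<rho> = "\<lambda>t. ennreal (\<epsilon> * t powr \<alpha>)"
  obtain P N where PN: "radon01 P" "radon01 N"
    and eq: "\<And>\<phi>. test_fun \<phi> \<Longrightarrow> - (LINT t:{0<..<1}|lebesgue. g t * deriv \<phi> t) = (\<integral>t. \<phi> t \<partial>P) - (\<integral>t. \<phi> t \<partial>N)"
    and F: "(\<integral>\<^sup>+t. ?\<rho> t \<partial>P) + (\<integral>\<^sup>+t. ?\<rho> t \<partial>N) \<le> F"
    using r unfolding represented_def by blast
  have m: "measure_deriv g P N"
    unfolding measure_deriv_def
  proof (intro conjI allI impI PN)
    show "(LINT t:{0<..<1}|lebesgue. g t * deriv \<phi> t) = - ((\<integral>t. \<phi> t \<partial>P) - (\<integral>t. \<phi> t \<partial>N))" if "test_fun \<phi>" for \<phi>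
      using eq[OF that] by simp
  qed
  have lv: "loc_integrable v"
    unfolding loc_integrable_def
  proof (intro allI impI)
    fix a b :: real assume "0 < a" "b < 1"
    then have "continuous_on {a..b} v" using v(1) by (auto elim!: continuous_on_subset)
    then show "set_integrable lebesgue {a..b} v" using absolutely_integrable_continuous_real by simp
  qed
  have wd: "weak_deriv v g" unfolding weak_deriv_def using lv g vg by simp
  have "continuous_on {0..1} (\<lambda>t. (v t)\<^sup>2)" using v(1) by (intro continuous_intros)
  then have "set_integrable lebesgue {0..1} (\<lambda>t. (v t)\<^sup>2)" using absolutely_integrable_continuous_real by simp
  then have v2: "set_integrable lebesgue {0<..<1} (\<lambda>t. (v t)\<^sup>2)" by (rule set_integrable_subset) auto
  have g2: "set_integrable lebesgue {0<..<1} (\<lambda>t. (g t)\<^sup>2)"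
    unfolding set_integrable_def
  proof (rule Bochner_Integration.integrable_bound[where f = "\<lambda>t. indicat_real {0<..<1} t"])
    have "(\<lambda>t. (indicat_real {0<..<1} t *\<^sub>R g t)\<^sup>2) \<in> borel_measurable lebesgue"
      using loc_integrable_indicator_measurable[OF g(1)] by measurable
    also have "(\<lambda>t. (indicat_real {0<..<1} t *\<^sub>R g t)\<^sup>2) = (\<lambda>t. indicat_real {0<..<1} t *\<^sub>R (g t)\<^sup>2)"
      by (auto simp: fun_eq_iff indicator_def)
    finally show "(\<lambda>t. indicat_real {0<..<1} t *\<^sub>R (g t)\<^sup>2) \<in> borel_measurable lebesgue" .
    show "AE t in lebesgue. norm (indicat_real {0<..<1} t *\<^sub>R (g t)\<^sup>2) \<le> norm (indicat_real {0<..<1} t)"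
      using g(2) by eventually_elim (auto simp: indicator_def abs_square_le_1)
    have "set_integrable lebesgue {0..1::real} (\<lambda>_. 1 :: real)"
      using absolutely_integrable_continuous_real[of 0 1 "\<lambda>_. 1"] by simp
    then have "set_integrable lebesgue {0<..<1::real} (\<lambda>_. 1 :: real)" by (rule set_integrable_subset) auto
    then show "integrable lebesgue (indicat_real {0<..<1::real})"
      by (simp only: set_integrable_def real_scaleR_def mult_1_right)
  qed
  have "H1_01 v" unfolding H1_01_def using v(1) v2 wd g2 by blast
  moreover have "BV_loc g" unfolding BV_loc_def using g(1) m by blast
  ultimately show "v \<in> admissible" unfolding admissible_def using wd g(2) v by blast
  have \<rho>: "?\<rho> \<in> borel_measurable borel" by measurable
  obtain P' N' where m': "measure_deriv g P' N'" and tv: "tv_second_deriv v = madd P' N'"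
    and le: "(\<integral>\<^sup>+t. ?\<rho> t \<partial>P') \<le> (\<integral>\<^sup>+t. ?\<rho> t \<partial>P)" "(\<integral>\<^sup>+t. ?\<rho> t \<partial>N') \<le> (\<integral>\<^sup>+t. ?\<rho> t \<partial>N)"
    using tv_second_deriv_eq[OF wd m] \<rho> by metis
  have PN': "radon01 P'" "radon01 N'" using m' by (auto simp: measure_deriv_def)
  have "(\<integral>\<^sup>+ t \<in> {0<..<1}. ?\<rho> t \<partial>tv_second_deriv v) \<le> (\<integral>\<^sup>+ t. ?\<rho> t \<partial>tv_second_deriv v)"
    by (intro nn_integral_mono) (auto simp: indicator_def)
  also have "\<dots> = (\<integral>\<^sup>+t. ?\<rho> t \<partial>P') + (\<integral>\<^sup>+t. ?\<rho> t \<partial>N')"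
    unfolding tv using radon01_sets[OF PN'(1)] radon01_sets[OF PN'(2)] radon01_measurable[OF PN'(1) \<rho>]
    by (intro nn_integral_madd) auto
  also have "\<dots> \<le> F" using le F by (meson add_mono order_trans)
  finally show "energy \<alpha> \<beta> \<epsilon> v \<le> F + elastic \<beta> v 0 1"
    unfolding energy_def energy_upto_def elastic_def by (rule add_right_mono)
qed

lemma zigzag_admissible:
  assumes "zigzag \<alpha> \<beta> \<epsilon> 1 0 E"
  obtains v where "v \<in> admissible" "energy \<alpha> \<beta> \<epsilon> v \<le> E"
proof -
  let ?\<rho> = "\<lambda>t. ennreal (\<epsilon> * t powr \<alpha>)"
  obtain w g l F where w: "continuous_on {0..1} w" "w 0 = 0" "w 1 = 0"
    and g: "loc_integrable g" "\<And>t. \<bar>g t\<bar> = 1" and l: "\<bar>l\<bar> \<le> 1"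
    and wg: "\<And>\<phi>. test_fun \<phi> \<Longrightarrow> (LINT t:{0<..<1}|lebesgue. w t * deriv \<phi> t) =
        0 * \<phi> 1 - (LINT t:{0<..<1}|lebesgue. g t * \<phi> t)"
    and r: "represented ?\<rho> (\<lambda>\<phi>. l * \<phi> 1 - (LINT t:{0<..<1}|lebesgue. g t * deriv \<phi> t)) F"
    and E: "F + elastic \<beta> w 0 1 \<le> E"
    using assms unfolding zigzag_def by blast
  have "represented ?\<rho> (\<lambda>\<phi>. - (LINT t:{0<..<1}|lebesgue. g t * deriv \<phi> t)) F"
    using r by (rule represented_mono) (auto simp: test_fun_zero)
  from admissible_energy_le(1)[OF w g(1) _ _ this] admissible_energy_le(2)[OF w g(1) _ _ this, where \<beta> = \<beta>] wg g(2)
  have "w \<in> admissible" "energy \<alpha> \<beta> \<epsilon> w \<le> F + elastic \<beta> w 0 1"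
    by auto
  with E show ?thesis by (intro that[of w]) auto
qed

text \<open>\<open>R\<close> stands for the energy of \<open>u\<close> on \<open>{y<..<1}\<close>,
  which the glued function inherits. It is kept as a summand on both sides so that a later
  cancellation replaces a subtraction in \<open>ennreal\<close>.\<close>

lemma zigzag_glue:
  assumes u: "u \<in> admissible" and y: "0 < y" "y < 1" and z: "zigzag \<alpha> \<beta> \<epsilon> y (u y) E" and \<epsilon>: "\<epsilon> > 0"
  obtains v R where "v \<in> admissible" "energy \<alpha> \<beta> \<epsilon> v \<le> E + ennreal (2 * \<epsilon> * y powr \<alpha>) + R"
    "energy_upto \<alpha> \<beta> \<epsilon> u y + R \<le> energy \<alpha> \<beta> \<epsilon> u"
proof -
  let ?\<rho> = "\<lambda>t. ennreal (\<epsilon> * t powr \<alpha>)"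
  have \<rho>: "?\<rho> \<in> borel_measurable borel" by measurable
  obtain w g l F where w: "continuous_on {0..y} w" "w 0 = 0" "w y = u y"
    and g: "loc_integrable g" "\<And>t. \<bar>g t\<bar> = 1" and l: "\<bar>l\<bar> \<le> 1"
    and wg: "\<And>\<phi>. test_fun \<phi> \<Longrightarrow> (LINT t:{0<..<y}|lebesgue. w t * deriv \<phi> t) =
        u y * \<phi> y - (LINT t:{0<..<y}|lebesgue. g t * \<phi> t)"
    and r: "represented ?\<rho> (\<lambda>\<phi>. l * \<phi> y - (LINT t:{0<..<y}|lebesgue. g t * deriv \<phi> t)) F"
    and E: "F + elastic \<beta> w 0 y \<le> E"
    using z unfolding zigzag_def by blast
  obtain h P0 N0 where h: "weak_deriv u h" "AE t in lebesgue. t \<in> {0<..<1} \<longrightarrow> \<bar>h t\<bar> = 1"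
    and m0: "measure_deriv h P0 N0" and H1: "H1_01 u" and u01: "u 1 = 0"
    using u unfolding admissible_def BV_loc_def by blast
  have uc: "continuous_on {0..1} u" using H1 unfolding H1_01_def by blast
  have hl: "loc_integrable h" using h(1) unfolding weak_deriv_def by blast
  obtain P N where m: "measure_deriv h P N" and tv: "tv_second_deriv u = madd P N"
    using tv_second_deriv_eq[OF h(1) m0] by metis
  have PN: "radon01 P" "radon01 N" using m by (auto simp: measure_deriv_def)
  have "AE t in lebesgue. t \<in> {0<..<1} \<longrightarrow> \<bar>h t\<bar> \<le> 1" using h(2) by eventually_elim auto
  from half_line_trace[OF m hl this y]
  obtain c where c: "\<bar>c\<bar> \<le> 1" and tr: "\<And>\<phi>. test_fun \<phi> \<Longrightarrow> (LINT t:{y<..<1}|lebesgue. h t * deriv \<phi> t) =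
    - c * \<phi> y - ((\<integral>t. \<phi> t \<partial>right_part y P) - (\<integral>t. \<phi> t \<partial>right_part y N))" by blast
  define K where "K = (\<integral>\<^sup>+t. ?\<rho> t \<partial>right_part y P) + (\<integral>\<^sup>+t. ?\<rho> t \<partial>right_part y N)"
  have rh: "represented ?\<rho> (\<lambda>\<phi>. - c * \<phi> y - (LINT t:{y<..<1}|lebesgue. h t * deriv \<phi> t)) K"
    unfolding represented_def K_def using tr PN
    by (intro exI[of _ "right_part y P"] exI[of _ "right_part y N"]) (simp add: radon01_right_part)
  \<comment> \<open>At \<open>y\<close> the left trace \<open>l\<close> of the zigzag meets the
    right trace \<open>c\<close> of the slope of \<open>u\<close>; both are bounded by 1 in modulus,
    so the new kink has jump at most 2.\<close>
  have "represented ?\<rho> (\<lambda>\<phi>. (c - l) * \<phi> y) (ennreal \<bar>c - l\<bar> * ?\<rho> y)"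
    using y \<rho> by (intro represented_point) auto
  from represented_add[OF \<rho> represented_add[OF \<rho> r this] rh]
  have rr: "represented ?\<rho> (\<lambda>\<phi>. l * \<phi> y - (LINT t:{0<..<y}|lebesgue. g t * deriv \<phi> t) + (c - l) * \<phi> y
     + (- c * \<phi> y - (LINT t:{y<..<1}|lebesgue. h t * deriv \<phi> t))) (F + ennreal \<bar>c - l\<bar> * ?\<rho> y + K)" .
  define v where "v t = (if t \<le> y then w t else u t)" for t
  define g' where "g' t = (if t < y then g t else h t)" for t
  have v: "continuous_on {0..1} v"
    unfolding v_def by (rule continuous_glue[OF w(1) continuous_on_subset[OF uc]]) (use y w in auto)
  have g': "loc_integrable g'" unfolding g'_def by (intro loc_integrable_glue g hl)
  have g1: "AE t in lebesgue. t \<in> {0<..<1} \<longrightarrow> \<bar>g' t\<bar> = 1"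
    using h(2) by eventually_elim (simp add: g'_def g)
  have v01: "v 0 = 0" "v 1 = 0" using w y u01 by (auto simp: v_def)
  have vg: "(LINT t:{0<..<1}|lebesgue. v t * deriv \<phi> t) = - (LINT t:{0<..<1}|lebesgue. g' t * \<phi> t)" if \<phi>: "test_fun \<phi>" for \<phi>
  proof -
    have "(LINT t:{0<..<1}|lebesgue. v t * deriv \<phi> t) = (LINT t:{0<..<y}|lebesgue. v t * deriv \<phi> t) +
      (LINT t:{y<..<1}|lebesgue. v t * deriv \<phi> t)"
      using set_integrable_continuous_test[OF v \<phi>] y by (intro set_integral_split_open) auto
    also have "(LINT t:{0<..<y}|lebesgue. v t * deriv \<phi> t) = (LINT t:{0<..<y}|lebesgue. w t * deriv \<phi> t)"
      by (rule set_integral_cong_open) (simp add: v_def)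
    also have "(LINT t:{y<..<1}|lebesgue. v t * deriv \<phi> t) = (LINT t:{y<..<1}|lebesgue. u t * deriv \<phi> t)"
      by (rule set_integral_cong_open) (simp add: v_def)
    finally have 1: "(LINT t:{0<..<1}|lebesgue. v t * deriv \<phi> t) =
       - (LINT t:{0<..<y}|lebesgue. g t * \<phi> t) - (LINT t:{y<..<1}|lebesgue. h t * \<phi> t)"
      using half_line_continuous[OF h(1) uc y \<phi>] wg[OF \<phi>] by simp
    have "(LINT t:{0<..<1}|lebesgue. g' t * \<phi> t) = (LINT t:{0<..<y}|lebesgue. g' t * \<phi> t) +
      (LINT t:{y<..<1}|lebesgue. g' t * \<phi> t)"
      using loc_integrable_test[OF g' \<phi>, of 0 1] y by (intro set_integral_split_open) auto
    also have "(LINT t:{0<..<y}|lebesgue. g' t * \<phi> t) = (LINT t:{0<..<y}|lebesgue. g t * \<phi> t)"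
      by (rule set_integral_cong_open) (simp add: g'_def)
    also have "(LINT t:{y<..<1}|lebesgue. g' t * \<phi> t) = (LINT t:{y<..<1}|lebesgue. h t * \<phi> t)"
      by (rule set_integral_cong_open) (simp add: g'_def)
    finally show ?thesis using 1 by simp
  qed
  have "represented ?\<rho> (\<lambda>\<phi>. - (LINT t:{0<..<1}|lebesgue. g' t * deriv \<phi> t)) (F + ennreal (2 * \<epsilon> * y powr \<alpha>) + K)"
    using rr
  proof (rule represented_mono)
    have "ennreal \<bar>c - l\<bar> * ?\<rho> y = ennreal (\<bar>c - l\<bar> * (\<epsilon> * y powr \<alpha>))"
      using \<epsilon> by (simp add: ennreal_mult)
    also have "\<dots> \<le> ennreal (2 * (\<epsilon> * y powr \<alpha>))"
      using c l \<epsilon> by (intro ennreal_leI mult_right_mono) auto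
    finally show "F + ennreal \<bar>c - l\<bar> * ?\<rho> y + K \<le> F + ennreal (2 * \<epsilon> * y powr \<alpha>) + K"
      by (intro add_right_mono add_left_mono) (simp add: mult.assoc)
    fix \<phi> assume \<phi>: "test_fun \<phi>"
    have "(LINT t:{0<..<1}|lebesgue. g' t * deriv \<phi> t) = (LINT t:{0<..<y}|lebesgue. g' t * deriv \<phi> t) +
      (LINT t:{y<..<1}|lebesgue. g' t * deriv \<phi> t)"
      using loc_integrable_test[OF g' \<phi>, of 0 1] y by (intro set_integral_split_open) auto
    also have "(LINT t:{0<..<y}|lebesgue. g' t * deriv \<phi> t) = (LINT t:{0<..<y}|lebesgue. g t * deriv \<phi> t)"
      by (rule set_integral_cong_open) (simp add: g'_def)
    also have "(LINT t:{y<..<1}|lebesgue. g' t * deriv \<phi> t) = (LINT t:{y<..<1}|lebesgue. h t * deriv \<phi> t)"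
      by (rule set_integral_cong_open) (simp add: g'_def)
    finally show "- (LINT t:{0<..<1}|lebesgue. g' t * deriv \<phi> t) = l * \<phi> y - (LINT t:{0<..<y}|lebesgue. g t * deriv \<phi> t) + (c - l) * \<phi> y
     + (- c * \<phi> y - (LINT t:{y<..<1}|lebesgue. h t * deriv \<phi> t))"
      by (simp add: algebra_simps)
  qed
  note adm = admissible_energy_le(1)[OF v v01 g' g1 vg this] admissible_energy_le(2)[OF v v01 g' g1 vg this, where \<beta> = \<beta>]
  have "elastic \<beta> v 0 1 = elastic \<beta> v 0 y + elastic \<beta> v y 1"
    using v y by (rule elastic_split)
  also have "elastic \<beta> v 0 y = elastic \<beta> w 0 y" by (rule elastic_cong) (simp add: v_def)
  also have "elastic \<beta> v y 1 = elastic \<beta> u y 1" by (rule elastic_cong) (simp add: v_def)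
  finally have "F + ennreal (2 * \<epsilon> * y powr \<alpha>) + K + elastic \<beta> v 0 1 =
    (F + elastic \<beta> w 0 y) + (ennreal (2 * \<epsilon> * y powr \<alpha>) + (K + elastic \<beta> u y 1))"
    by (simp add: ac_simps)
  also have "\<dots> \<le> E + (ennreal (2 * \<epsilon> * y powr \<alpha>) + (K + elastic \<beta> u y 1))"
    using E by (rule add_right_mono)
  finally have 1: "energy \<alpha> \<beta> \<epsilon> v \<le> E + ennreal (2 * \<epsilon> * y powr \<alpha>) + (K + elastic \<beta> u y 1)"
    using adm(2) unfolding add.assoc by (rule order_trans[rotated])
  note s = radon01_sets[OF PN(1)] radon01_sets[OF PN(2)]
  have mP: "?\<rho> \<in> borel_measurable P" using PN(1) \<rho> by (rule radon01_measurable)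
  have mS: "(\<lambda>t. ?\<rho> t * indicator S t) \<in> borel_measurable borel" "(\<lambda>t. indicator S t * ?\<rho> t) \<in> borel_measurable borel" if "S \<in> sets borel" for S
    using that by measurable
  have "(\<integral>\<^sup>+ t \<in> {0<..<y}. ?\<rho> t \<partial>tv_second_deriv u) + K =
    (\<integral>\<^sup>+ t. ?\<rho> t * indicator {0<..<y} t \<partial>madd P N) + (\<integral>\<^sup>+ t. indicator {y<..} t * ?\<rho> t \<partial>madd P N)"
    unfolding K_def tv nn_integral_right_part[OF PN(1) \<rho>] nn_integral_right_part[OF PN(2) \<rho>]
    using s by (subst (2) nn_integral_madd) (auto intro!: radon01_measurable[OF PN(1)] mS)
  also have "\<dots> = (\<integral>\<^sup>+ t. ?\<rho> t * indicator {0<..<y} t + indicator {y<..} t * ?\<rho> t \<partial>madd P N)"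
    by (rule nn_integral_add[symmetric]) (auto intro!: radon01_measurable[OF radon01_madd[OF PN]] mS)
  \<comment> \<open>The two indicators both miss the point \<open>y\<close>, so a kink of
    \<open>u\<close> at \<open>y\<close> only helps the inequality.\<close>
  also have "\<dots> \<le> (\<integral>\<^sup>+ t \<in> {0<..<1}. ?\<rho> t \<partial>madd P N)"
    using y by (intro nn_integral_mono) (auto simp: indicator_def radon01_space[OF PN(1)])
  finally have 2: "(\<integral>\<^sup>+ t \<in> {0<..<y}. ?\<rho> t \<partial>tv_second_deriv u) + K \<le> (\<integral>\<^sup>+ t \<in> {0<..<1}. ?\<rho> t \<partial>tv_second_deriv u)"
    unfolding tv .
  have "energy_upto \<alpha> \<beta> \<epsilon> u y + (K + elastic \<beta> u y 1) =
    ((\<integral>\<^sup>+ t \<in> {0<..<y}. ?\<rho> t \<partial>tv_second_deriv u) + K) + (elastic \<beta> u 0 y + elastic \<beta> u y 1)"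
    unfolding energy_upto_def elastic_def by (simp add: ac_simps)
  also have "elastic \<beta> u 0 y + elastic \<beta> u y 1 = elastic \<beta> u 0 1"
    using uc y by (rule elastic_split[symmetric])
  also have "((\<integral>\<^sup>+ t \<in> {0<..<y}. ?\<rho> t \<partial>tv_second_deriv u) + K) + elastic \<beta> u 0 1 \<le> energy \<alpha> \<beta> \<epsilon> u"
    unfolding energy_def energy_upto_def elastic_def using 2 by (rule add_right_mono)
  finally show ?thesis using adm(1) 1 that by blast
qed

section \<open>Energy of the competitors\<close>

lemma powr_comparable:
  fixes t a c \<kappa> :: real
  assumes "0 < t" "0 < a" "t \<le> \<kappa> * a" "a \<le> \<kappa> * t"
  shows "t powr c \<le> \<kappa> powr \<bar>c\<bar> * a powr c"
proof -
  have "(t / a) powr c \<le> \<kappa> powr \<bar>c\<bar>"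
  proof (cases "c \<ge> 0")
    case True
    then show ?thesis using assms by (auto intro!: powr_mono2 simp: field_simps)
  next
    case False
    have "(t / a) powr c = (a / t) powr \<bar>c\<bar>"
      using False assms by (simp add: powr_divide powr_minus_divide[of _ "-c"] field_simps flip: powr_add)
    also have "\<dots> \<le> \<kappa> powr \<bar>c\<bar>" using assms by (intro powr_mono2) (auto simp: field_simps)
    finally show ?thesis .
  qed
  from mult_right_mono[OF this, of "a powr c"] show ?thesis
    using assms by (simp add: powr_divide)
qed

lemma ennreal_plus3:
  "0 \<le> a \<Longrightarrow> 0 \<le> b \<Longrightarrow> 0 \<le> c \<Longrightarrow> ennreal a + ennreal b + ennreal c = ennreal (a + b + c)"
  by simp

lemma four_powr_half: "(4::real) powr (x / 2) = 2 powr x"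
proof -
  have "(4::real) = 2 powr 2" by simp
  then show ?thesis by (simp only: powr_powr) simp
qed

text \<open>This is where \<open>2 * \<alpha> \<ge> \<beta>\<close> enters: for
  \<open>t \<le> 1\<close> it gives \<open>t powr \<alpha> \<le> t powr (\<beta> / 2)\<close>. The
  reference scale \<open>\<sigma>\<close> may exceed \<open>t\<close> by a factor up to 4, because
  \<open>zigzag_base\<close> measures a kink at \<open>\<tau> / 2\<close> on a scale up to
  \<open>2 * \<tau>\<close>.\<close>

lemma kink_cost:
  fixes \<alpha> \<beta> e t \<sigma> :: real
  assumes "0 < e" "0 < t" "t \<le> 1" "t \<le> \<sigma>" "\<sigma> \<le> 4 * t" "2 * \<alpha> \<ge> \<beta>"
  shows "e ^ 3 * t powr \<alpha> \<le> 2 powr \<bar>\<beta>\<bar> * e\<^sup>2 * (e * \<sigma> powr (\<beta> / 2))"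
proof -
  have "t powr \<alpha> \<le> t powr (\<beta> / 2)" using assms by (intro powr_mono') auto
  also have "\<dots> \<le> 4 powr \<bar>\<beta> / 2\<bar> * \<sigma> powr (\<beta> / 2)" using assms by (intro powr_comparable) auto
  also have "4 powr \<bar>\<beta> / 2\<bar> = 2 powr \<bar>\<beta>\<bar>" by (simp add: abs_divide four_powr_half)
  finally have "e ^ 3 * t powr \<alpha> \<le> e ^ 3 * (2 powr \<bar>\<beta>\<bar> * \<sigma> powr (\<beta> / 2))"
    using assms(1) by (intro mult_left_mono) auto
  then show ?thesis by (simp add: power3_eq_cube power2_eq_square ac_simps)
qed

text \<open>Squared, the claim is
  \<open>e\<^sup>2 * \<tau> powr \<beta> \<le> \<tau>\<^sup>2\<close>, and the hypothesis is this
  multiplied by \<open>\<tau> powr (1 - \<beta>)\<close>. It says that a tent of the balanced width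
  fits at distance \<open>\<tau>\<close> from 0.\<close>

lemma scale_le:
  fixes \<tau> e \<beta> :: real
  assumes "0 < e" "0 < \<tau>" "\<tau> * e\<^sup>2 \<le> \<tau> powr (3 - \<beta>)"
  shows "e * \<tau> powr (\<beta> / 2) \<le> \<tau>"
proof (rule power2_le_imp_le)
  have "(e * \<tau> powr (\<beta> / 2))\<^sup>2 = e\<^sup>2 * \<tau> powr \<beta>"
    using assms by (simp add: power_mult_distrib power2_eq_square flip: powr_add)
  also have "\<dots> = (\<tau> * e\<^sup>2) * \<tau> powr (\<beta> - 1)"
    using assms by (simp add: powr_diff)
  also have "\<dots> \<le> \<tau> powr (3 - \<beta>) * \<tau> powr (\<beta> - 1)"
    using assms by (intro mult_right_mono) auto
  also have "\<dots> = \<tau>\<^sup>2" using assms by (simp flip: powr_add)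
  finally show "(e * \<tau> powr (\<beta> / 2))\<^sup>2 \<le> \<tau>\<^sup>2" .
qed (use assms in auto)

section \<open>Tents, dyadic blocks and the base tent\<close>

lemma elastic_le:
  assumes "a \<le> b" "0 \<le> a" and C: "\<And>t. a < t \<Longrightarrow> t < b \<Longrightarrow> t powr (- \<beta>) \<le> C" "0 \<le> C"
    and H: "\<And>t. a < t \<Longrightarrow> t < b \<Longrightarrow> \<bar>w t\<bar> \<le> H"
  shows "elastic \<beta> w a b \<le> ennreal (C * H\<^sup>2 * (b - a))"
proof -
  have "elastic \<beta> w a b \<le> (\<integral>\<^sup>+ t. ennreal (C * H\<^sup>2) * indicator {a<..<b} t \<partial>lebesgue)"
    unfolding elastic_def
  proof (rule nn_integral_mono)
    fix t
    show "ennreal (t powr - \<beta> * (w t)\<^sup>2) * indicator {a<..<b} t \<le> ennreal (C * H\<^sup>2) * indicator {a<..<b} t"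
    proof (cases "t \<in> {a<..<b}")
      case True
      have "(w t)\<^sup>2 \<le> H\<^sup>2" using H[of t] True power_mono[of "\<bar>w t\<bar>" H 2] by simp
      then have "t powr - \<beta> * (w t)\<^sup>2 \<le> C * H\<^sup>2" using C True by (intro mult_mono) auto
      then show ?thesis using True by (simp add: ennreal_leI)
    qed simp
  qed
  also have "\<dots> = ennreal (C * H\<^sup>2) * emeasure lebesgue {a<..<b}"
    by (rule nn_integral_cmult_indicator) simp
  also have "\<dots> = ennreal (C * H\<^sup>2 * (b - a))"
    using assms by (simp add: ennreal_mult)
  finally show ?thesis .
qed

text \<open>The tent rises with slope 1 to height \<open>d / 2\<close> and falls back. Its kinks at
  \<open>a\<close> and at the peak cost at most \<open>2 * \<kappa>\<close> each; the one at
  \<open>a + d\<close> is charged to whatever is appended next.\<close>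

lemma zigzag_tent:
  assumes z: "zigzag \<alpha> \<beta> \<epsilon> a 0 E" and a: "0 < a" "0 < d" "a + d \<le> 1" and \<epsilon>: "\<epsilon> > 0"
    and \<kappa>: "\<And>t. a \<le> t \<Longrightarrow> t \<le> a + d \<Longrightarrow> \<epsilon> * t powr \<alpha> \<le> \<kappa>"
    and C: "\<And>t. a < t \<Longrightarrow> t < a + d \<Longrightarrow> t powr (- \<beta>) \<le> C" "0 \<le> C"
  shows "zigzag \<alpha> \<beta> \<epsilon> (a + d) 0 (E + ennreal (4 * \<kappa> + C * d\<^sup>2 * d))"
proof -
  let ?c = "a + d / 2"
  have k0: "0 \<le> \<kappa>" using \<kappa>[of a] a \<epsilon> by (meson less_eq_real_def mult_nonneg_nonneg order_trans powr_ge_zero le_add_same_cancel1)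
  have c: "a < ?c" "?c < a + d" using a by auto
  have "zigzag \<alpha> \<beta> \<epsilon> ?c (0 + 1 * (?c - a)) (E + ennreal (2 * \<epsilon> * a powr \<alpha>) + elastic \<beta> (\<lambda>t. 0 + 1 * (t - a)) a ?c)"
    by (rule zigzag_extend[OF z a(1) _ _ _ \<epsilon>]) (use a in auto)
  moreover have "0 + 1 * (?c - a) = d / 2" by simp
  ultimately have "zigzag \<alpha> \<beta> \<epsilon> ?c (d / 2) (E + ennreal (2 * \<epsilon> * a powr \<alpha>) + elastic \<beta> (\<lambda>t. 0 + 1 * (t - a)) a ?c)"
    by (simp only:)
  then have "zigzag \<alpha> \<beta> \<epsilon> ?c (d / 2) (E + ennreal (2 * \<kappa> + C * d\<^sup>2 * (d / 2)))"
  proof (rule zigzag_mono)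
    have "elastic \<beta> (\<lambda>t. 0 + 1 * (t - a)) a ?c \<le> ennreal (C * d\<^sup>2 * (?c - a))"
      using a C by (intro elastic_le) auto
    moreover have "ennreal (2 * \<epsilon> * a powr \<alpha>) \<le> ennreal (2 * \<kappa>)"
      using \<kappa>[of a] a by (intro ennreal_leI) auto
    ultimately have "E + ennreal (2 * \<epsilon> * a powr \<alpha>) + elastic \<beta> (\<lambda>t. 0 + 1 * (t - a)) a ?c
      \<le> E + ennreal (2 * \<kappa>) + ennreal (C * d\<^sup>2 * (d / 2))"
      by (intro add_mono) auto
    also have "\<dots> = E + ennreal (2 * \<kappa> + C * d\<^sup>2 * (d / 2))"
      using k0 C(2) a by (subst ennreal_plus) (auto simp: add.assoc)
    finally show "E + ennreal (2 * \<epsilon> * a powr \<alpha>) + elastic \<beta> (\<lambda>t. 0 + 1 * (t - a)) a ?c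
      \<le> E + ennreal (2 * \<kappa> + C * d\<^sup>2 * (d / 2))" .
  qed
  from zigzag_extend[OF this _ c(2) a(3), of "-1"]
  have "zigzag \<alpha> \<beta> \<epsilon> (a + d) (d / 2 + (-1) * (a + d - ?c)) (E + ennreal (2 * \<kappa> + C * d\<^sup>2 * (d / 2))
    + ennreal (2 * \<epsilon> * ?c powr \<alpha>) + elastic \<beta> (\<lambda>t. d / 2 + (-1) * (t - ?c)) ?c (a + d))"
    using a \<epsilon> by simp
  moreover have "d / 2 + (-1) * (a + d - ?c) = 0" by (simp add: field_simps)
  ultimately have "zigzag \<alpha> \<beta> \<epsilon> (a + d) 0 (E + ennreal (2 * \<kappa> + C * d\<^sup>2 * (d / 2))
    + ennreal (2 * \<epsilon> * ?c powr \<alpha>) + elastic \<beta> (\<lambda>t. d / 2 + (-1) * (t - ?c)) ?c (a + d))" by simp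
  then show ?thesis
  proof (rule zigzag_mono)
    have "elastic \<beta> (\<lambda>t. d / 2 + (-1) * (t - ?c)) ?c (a + d) \<le> ennreal (C * d\<^sup>2 * (a + d - ?c))"
      using a C c by (intro elastic_le) (auto simp: abs_if)
    also have "a + d - ?c = d / 2" by (simp add: field_simps)
    finally have el: "elastic \<beta> (\<lambda>t. d / 2 + (-1) * (t - ?c)) ?c (a + d) \<le> ennreal (C * d\<^sup>2 * (d / 2))" .
    have "ennreal (2 * \<epsilon> * ?c powr \<alpha>) \<le> ennreal (2 * \<kappa>)"
      using \<kappa>[of ?c] a by (intro ennreal_leI) auto
    with el have "E + ennreal (2 * \<kappa> + C * d\<^sup>2 * (d / 2)) + ennreal (2 * \<epsilon> * ?c powr \<alpha>) + elastic \<beta> (\<lambda>t. d / 2 + (-1) * (t - ?c)) ?c (a + d)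
      \<le> E + ennreal (2 * \<kappa> + C * d\<^sup>2 * (d / 2)) + ennreal (2 * \<kappa>) + ennreal (C * d\<^sup>2 * (d / 2))"
      by (intro add_mono) auto
    also have "\<dots> = E + ennreal (2 * \<kappa> + C * d\<^sup>2 * (d / 2) + 2 * \<kappa> + C * d\<^sup>2 * (d / 2))"
      using k0 C(2) a by (simp add: add.assoc flip: ennreal_plus)
    also have "2 * \<kappa> + C * d\<^sup>2 * (d / 2) + 2 * \<kappa> + C * d\<^sup>2 * (d / 2) = 4 * \<kappa> + C * d\<^sup>2 * d"
      by (simp add: field_simps)
    finally show "E + ennreal (2 * \<kappa> + C * d\<^sup>2 * (d / 2)) + ennreal (2 * \<epsilon> * ?c powr \<alpha>) + elastic \<beta> (\<lambda>t. d / 2 + (-1) * (t - ?c)) ?c (a + d)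
      \<le> E + ennreal (4 * \<kappa> + C * d\<^sup>2 * d)" .
  qed
qed

lemma zigzag_tents:
  assumes z: "zigzag \<alpha> \<beta> \<epsilon> a 0 E" and a: "0 < a" "0 < d" and \<epsilon>: "\<epsilon> > 0" and n: "a + real n * d \<le> 1"
    and \<kappa>: "\<And>t. a \<le> t \<Longrightarrow> t \<le> a + real n * d \<Longrightarrow> \<epsilon> * t powr \<alpha> \<le> \<kappa>"
    and C: "\<And>t. a < t \<Longrightarrow> t < a + real n * d \<Longrightarrow> t powr (- \<beta>) \<le> C" "0 \<le> C"
  shows "zigzag \<alpha> \<beta> \<epsilon> (a + real n * d) 0 (E + ennreal (real n * (4 * \<kappa> + C * d\<^sup>2 * d)))"
proof -
  have k0: "0 \<le> \<kappa>" using \<kappa>[of a] a \<epsilon> by (meson less_eq_real_def mult_nonneg_nonneg order_trans powr_ge_zero le_add_same_cancel1 of_nat_0_le_iff)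
  have "k \<le> n \<Longrightarrow> zigzag \<alpha> \<beta> \<epsilon> (a + real k * d) 0 (E + ennreal (real k * (4 * \<kappa> + C * d\<^sup>2 * d)))" for k
  proof (induction k)
    case 0
    then show ?case using z by simp
  next
    case (Suc k)
    have kn: "a + real k * d + d \<le> a + real n * d"
      using mult_right_mono[of "real (Suc k)" "real n" d] Suc.prems a by (simp add: algebra_simps)
    have ak: "a \<le> a + real k * d" using a by simp
    have "zigzag \<alpha> \<beta> \<epsilon> (a + real k * d + d) 0 (E + ennreal (real k * (4 * \<kappa> + C * d\<^sup>2 * d)) + ennreal (4 * \<kappa> + C * d\<^sup>2 * d))"
    proof (rule zigzag_tent[OF Suc.IH _ a(2) _ \<epsilon>])
      show "k \<le> n" using Suc.prems by simp
      show "0 < a + real k * d" using a ak by linarith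
      show "a + real k * d + d \<le> 1" using kn n by linarith
      show "\<epsilon> * t powr \<alpha> \<le> \<kappa>" if "a + real k * d \<le> t" "t \<le> a + real k * d + d" for t
        using \<kappa>[of t] that ak kn by linarith
      show "t powr - \<beta> \<le> C" if "a + real k * d < t" "t < a + real k * d + d" for t
        using C(1)[of t] that ak kn by linarith
    qed (fact C)
    moreover have "E + ennreal (real k * (4 * \<kappa> + C * d\<^sup>2 * d)) + ennreal (4 * \<kappa> + C * d\<^sup>2 * d) =
      E + ennreal (real (Suc k) * (4 * \<kappa> + C * d\<^sup>2 * d))"
      using k0 C(2) a by (simp add: add.assoc distrib_right add.commute flip: ennreal_plus)
    moreover have "a + real k * d + d = a + real (Suc k) * d" by (simp add: algebra_simps)
    ultimately show ?case by simp
  qed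
  then show ?thesis by simp
qed

text \<open>At the balanced width \<open>h = e * \<tau> powr (\<beta> / 2)\<close> one has
  \<open>h\<^sup>2 * \<tau> powr (- \<beta>) = e\<^sup>2\<close>, so kinks and elastic energy both
  cost of order \<open>e\<^sup>2\<close> per unit length. On the dyadic block all powers of
  \<open>t\<close> are comparable to those of \<open>\<tau>\<close>.\<close>

lemma zigzag_block:
  assumes z: "zigzag \<alpha> \<beta> (e ^ 3) (\<tau> / 2) 0 E" and \<tau>: "0 < \<tau>" "\<tau> \<le> 1" and e: "0 < e"
    and h: "e * \<tau> powr (\<beta> / 2) \<le> \<tau>" and ab: "2 * \<alpha> \<ge> \<beta>"
  shows "zigzag \<alpha> \<beta> (e ^ 3) \<tau> 0 (E + ennreal (9 * 2 powr \<bar>\<beta>\<bar> * \<tau> * e\<^sup>2))"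
proof -
  define h where "h = e * \<tau> powr (\<beta> / 2)"
  define B where "B = 2 powr \<bar>\<beta>\<bar>"
  have h0: "0 < h" "h \<le> \<tau>" using e \<tau> h by (auto simp: h_def)
  have B0: "0 < B" by (simp add: B_def)
  \<comment> \<open>Rounding up gives \<open>d \<le> h\<close>, which controls the elastic part. The
    extra tent is absorbed by \<open>h \<le> \<tau>\<close>, since
    \<open>real n * h \<le> \<tau> / 2 + h \<le> 2 * \<tau>\<close>.\<close>
  define n where "n = nat \<lceil>\<tau> / (2 * h)\<rceil>"
  define d where "d = \<tau> / (2 * real n)"
  have n1: "\<tau> / (2 * h) \<le> real n" "real n \<le> \<tau> / (2 * h) + 1"
    using h0 \<tau> unfolding n_def by (auto simp: of_nat_ceiling)
  have n0: "0 < real n" using n1(1) h0 \<tau> by (smt (verit) divide_pos_pos)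
  have nd: "real n * d = \<tau> / 2" using n0 by (simp add: d_def)
  have d0: "0 < d" using n0 \<tau> by (simp add: d_def)
  have dh: "d \<le> h" using n1(1) n0 h0 by (simp add: d_def field_simps)
  have nh: "real n * h \<le> 2 * \<tau>"
  proof -
    have "real n * h \<le> (\<tau> / (2 * h) + 1) * h" using n1(2) h0 by (intro mult_right_mono) auto
    also have "\<dots> = \<tau> / 2 + h" using h0 by (simp add: field_simps)
    finally show ?thesis using h0 \<tau> by linarith
  qed
  have "zigzag \<alpha> \<beta> (e ^ 3) (\<tau> / 2 + real n * d) 0 (E + ennreal (real n * (4 * (B * e\<^sup>2 * h) + (B * \<tau> powr - \<beta>) * d\<^sup>2 * d)))"
  proof (rule zigzag_tents[OF z])
    show "e ^ 3 * t powr \<alpha> \<le> B * e\<^sup>2 * h" if "\<tau> / 2 \<le> t" "t \<le> \<tau> / 2 + real n * d" for t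
      unfolding B_def h_def using that \<tau> e ab by (intro kink_cost) (auto simp: nd)
    show "t powr - \<beta> \<le> B * \<tau> powr - \<beta>" if "\<tau> / 2 < t" "t < \<tau> / 2 + real n * d" for t
      unfolding B_def using that \<tau> powr_comparable[of t \<tau> 2 "-\<beta>"] by (auto simp: nd)
  qed (use \<tau> d0 e B0 nd in auto)
  moreover have "\<tau> / 2 + real n * d = \<tau>" by (simp add: nd)
  ultimately have "zigzag \<alpha> \<beta> (e ^ 3) \<tau> 0 (E + ennreal (real n * (4 * (B * e\<^sup>2 * h) + (B * \<tau> powr - \<beta>) * d\<^sup>2 * d)))" by simp
  then show ?thesis
  proof (rule zigzag_mono)
    have "h\<^sup>2 * \<tau> powr - \<beta> = e\<^sup>2"
      using \<tau> by (simp add: h_def power_mult_distrib power2_eq_square mult.assoc flip: powr_add)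
    moreover have "d\<^sup>2 * \<tau> powr - \<beta> \<le> h\<^sup>2 * \<tau> powr - \<beta>" using d0 dh by (intro mult_right_mono power_mono) auto
    ultimately have 1: "d\<^sup>2 * \<tau> powr - \<beta> \<le> e\<^sup>2" by simp
    have "real n * (4 * (B * e\<^sup>2 * h) + (B * \<tau> powr - \<beta>) * d\<^sup>2 * d) =
      4 * B * e\<^sup>2 * (real n * h) + B * (real n * d) * (d\<^sup>2 * \<tau> powr - \<beta>)"
      by (simp add: algebra_simps)
    \<comment> \<open>The kinks contribute the factor 8 and the elastic part 1/2, together less than
      the 9 of the claim.\<close>
    also have "\<dots> \<le> 4 * B * e\<^sup>2 * (2 * \<tau>) + B * (\<tau> / 2) * e\<^sup>2"
      unfolding nd using nh 1 B0 \<tau> by (intro add_mono mult_left_mono) auto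
    also have "\<dots> \<le> 9 * B * \<tau> * e\<^sup>2"
      using B0 \<tau> e by (simp add: field_simps)
    finally show "E + ennreal (real n * (4 * (B * e\<^sup>2 * h) + (B * \<tau> powr - \<beta>) * d\<^sup>2 * d)) \<le> E + ennreal (9 * 2 powr \<bar>\<beta>\<bar> * \<tau> * e\<^sup>2)"
      unfolding B_def by (intro add_left_mono ennreal_leI)
  qed
qed

lemma elastic_linear:
  assumes "\<beta> < 3" "0 \<le> b"
  shows "elastic \<beta> (\<lambda>t. 1 * t) 0 b \<le> ennreal (b powr (3 - \<beta>) / (3 - \<beta>))"
proof -
  have "((\<lambda>t. t powr (2 - \<beta>)) has_integral (b powr (2 - \<beta> + 1) / (2 - \<beta> + 1))) {0..b}"
    using assms by (intro has_integral_powr_from_0) auto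
  then have "(\<integral>\<^sup>+ t. ennreal (indicator {0..b} t * t powr (2 - \<beta>)) \<partial>lebesgue) = ennreal (b powr (2 - \<beta> + 1) / (2 - \<beta> + 1))"
    unfolding nn_integral_completion by (intro nn_integral_has_integral_lebesgue) auto
  moreover have "elastic \<beta> (\<lambda>t. 1 * t) 0 b \<le> (\<integral>\<^sup>+ t. ennreal (indicator {0..b} t * t powr (2 - \<beta>)) \<partial>lebesgue)"
    unfolding elastic_def
  proof (rule nn_integral_mono)
    fix t :: real
    have "t powr - \<beta> * t\<^sup>2 = t powr (2 - \<beta>)" if "0 < t"
      using that by (simp add: powr_diff powr_minus_divide field_simps)
    then show "ennreal (t powr - \<beta> * (1 * t)\<^sup>2) * indicator {0<..<b} t \<le> ennreal (indicator {0..b} t * t powr (2 - \<beta>))"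
      by (auto simp: indicator_def)
  qed
  moreover have "2 - \<beta> + 1 = 3 - \<beta>" by simp
  ultimately show ?thesis by simp
qed

text \<open>Near 0 the weight \<open>t powr (- \<beta>)\<close> is not comparable to a constant; on
  the rising side it is compensated by the zero at the origin, through
  \<open>elastic_linear\<close>. A balanced tent need not fit at \<open>\<tau>\<close> itself, so
  the kink is measured at a scale \<open>\<sigma>\<close>, at most twice as large, where it
  does.\<close>

lemma zigzag_base:
  assumes \<tau>: "0 < \<tau>" "\<tau> \<le> 1" and e: "0 < e" and \<beta>: "\<beta> < 3" "2 * \<alpha> \<ge> \<beta>"
    and \<sigma>: "\<tau> \<le> \<sigma>" "\<sigma> \<le> 2 * \<tau>" "\<sigma> \<le> z" "e * \<sigma> powr (\<beta> / 2) \<le> \<sigma>"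
    and small: "\<tau> powr (3 - \<beta>) \<le> z * e\<^sup>2"
  shows "zigzag \<alpha> \<beta> (e ^ 3) \<tau> 0 (ennreal ((1 / (3 - \<beta>) + 3 * 2 powr \<bar>\<beta>\<bar>) * z * e\<^sup>2))"
proof -
  define B where "B = 2 powr \<bar>\<beta>\<bar>"
  have B0: "0 < B" by (simp add: B_def)
  have z0: "0 < z" using \<tau> \<sigma> by linarith
  have "zigzag \<alpha> \<beta> (e ^ 3) (\<tau> / 2) (1 * (\<tau> / 2)) (elastic \<beta> (\<lambda>t. 1 * t) 0 (\<tau> / 2))"
    using \<tau> by (intro zigzag_linear) auto
  from zigzag_extend[OF this, of \<tau> "-1"]
  have "zigzag \<alpha> \<beta> (e ^ 3) \<tau> (1 * (\<tau> / 2) + -1 * (\<tau> - \<tau> / 2))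
    (elastic \<beta> (\<lambda>t. 1 * t) 0 (\<tau> / 2) + ennreal (2 * e ^ 3 * (\<tau> / 2) powr \<alpha>) + elastic \<beta> (\<lambda>t. 1 * (\<tau> / 2) + -1 * (t - \<tau> / 2)) (\<tau> / 2) \<tau>)"
    using \<tau> e by simp
  moreover have "1 * (\<tau> / 2) + -1 * (\<tau> - \<tau> / 2) = 0" by simp
  ultimately have "zigzag \<alpha> \<beta> (e ^ 3) \<tau> 0
    (elastic \<beta> (\<lambda>t. 1 * t) 0 (\<tau> / 2) + ennreal (2 * e ^ 3 * (\<tau> / 2) powr \<alpha>) + elastic \<beta> (\<lambda>t. 1 * (\<tau> / 2) + -1 * (t - \<tau> / 2)) (\<tau> / 2) \<tau>)"
    by simp
  then show ?thesis
  proof (rule zigzag_mono)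
    have 1: "elastic \<beta> (\<lambda>t. 1 * t) 0 (\<tau> / 2) \<le> ennreal (1 / (3 - \<beta>) * z * e\<^sup>2)"
    proof (rule order_trans[OF elastic_linear])
      have "(\<tau> / 2) powr (3 - \<beta>) \<le> \<tau> powr (3 - \<beta>)" using \<tau> \<beta> by (intro powr_mono2) auto
      then have "(\<tau> / 2) powr (3 - \<beta>) \<le> z * e\<^sup>2" using small by linarith
      from divide_right_mono[OF this, of "3 - \<beta>"] \<beta>
      show "ennreal ((\<tau> / 2) powr (3 - \<beta>) / (3 - \<beta>)) \<le> ennreal (1 / (3 - \<beta>) * z * e\<^sup>2)"
        by (intro ennreal_leI) simp
    qed (use \<beta> \<tau> in auto)
    have "e ^ 3 * (\<tau> / 2) powr \<alpha> \<le> 2 powr \<bar>\<beta>\<bar> * e\<^sup>2 * (e * \<sigma> powr (\<beta> / 2))"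
      using \<tau> e \<sigma> \<beta> by (intro kink_cost) auto
    also have "\<dots> \<le> 2 powr \<bar>\<beta>\<bar> * e\<^sup>2 * z"
      using \<sigma> by (intro mult_left_mono) auto
    finally have 2: "ennreal (2 * e ^ 3 * (\<tau> / 2) powr \<alpha>) \<le> ennreal (2 * B * z * e\<^sup>2)"
      unfolding B_def by (intro ennreal_leI) (simp add: ac_simps)
    have "elastic \<beta> (\<lambda>t. 1 * (\<tau> / 2) + -1 * (t - \<tau> / 2)) (\<tau> / 2) \<tau> \<le> ennreal (B * \<tau> powr - \<beta> * \<tau>\<^sup>2 * (\<tau> - \<tau> / 2))"
    proof (rule elastic_le)
      show "t powr - \<beta> \<le> B * \<tau> powr - \<beta>" if "\<tau> / 2 < t" "t < \<tau>" for t
        unfolding B_def using that \<tau> powr_comparable[of t \<tau> 2 "-\<beta>"] by auto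
    qed (use \<tau> B0 in auto)
    also have "\<dots> \<le> ennreal (B * z * e\<^sup>2)"
    proof (rule ennreal_leI)
      have "\<tau> powr - \<beta> * \<tau>\<^sup>2 * \<tau> = \<tau> powr (3 - \<beta>)"
        using \<tau> by (simp add: powr_diff powr_minus_divide power2_eq_square power3_eq_cube)
      then have "B * \<tau> powr - \<beta> * \<tau>\<^sup>2 * (\<tau> - \<tau> / 2) = B * \<tau> powr (3 - \<beta>) / 2"
        by (simp add: field_simps)
      also have "\<dots> \<le> B * \<tau> powr (3 - \<beta>)" using B0 by simp
      also have "\<dots> \<le> B * (z * e\<^sup>2)" using B0 small by (intro mult_left_mono) auto
      finally show "B * \<tau> powr - \<beta> * \<tau>\<^sup>2 * (\<tau> - \<tau> / 2) \<le> B * z * e\<^sup>2" by (simp add: ac_simps)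
    qed
    finally have 3: "elastic \<beta> (\<lambda>t. 1 * (\<tau> / 2) + -1 * (t - \<tau> / 2)) (\<tau> / 2) \<tau> \<le> ennreal (B * z * e\<^sup>2)" .
    have "elastic \<beta> (\<lambda>t. 1 * t) 0 (\<tau> / 2) + ennreal (2 * e ^ 3 * (\<tau> / 2) powr \<alpha>) + elastic \<beta> (\<lambda>t. 1 * (\<tau> / 2) + -1 * (t - \<tau> / 2)) (\<tau> / 2) \<tau>
      \<le> ennreal (1 / (3 - \<beta>) * z * e\<^sup>2) + ennreal (2 * B * z * e\<^sup>2) + ennreal (B * z * e\<^sup>2)"
      using 1 2 3 by (intro add_mono)
    also have "\<dots> = ennreal (1 / (3 - \<beta>) * z * e\<^sup>2 + 2 * B * z * e\<^sup>2 + B * z * e\<^sup>2)"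
      using B0 z0 \<beta> by (intro ennreal_plus3) auto
    also have "1 / (3 - \<beta>) * z * e\<^sup>2 + 2 * B * z * e\<^sup>2 + B * z * e\<^sup>2 = (1 / (3 - \<beta>) + 3 * B) * z * e\<^sup>2"
      by (simp add: algebra_simps)
    finally show "elastic \<beta> (\<lambda>t. 1 * t) 0 (\<tau> / 2) + ennreal (2 * e ^ 3 * (\<tau> / 2) powr \<alpha>) + elastic \<beta> (\<lambda>t. 1 * (\<tau> / 2) + -1 * (t - \<tau> / 2)) (\<tau> / 2) \<tau>
      \<le> ennreal ((1 / (3 - \<beta>) + 3 * 2 powr \<bar>\<beta>\<bar>) * z * e\<^sup>2)" unfolding B_def .
  qed
qed

text \<open>The base tent contributes
  \<open>1 / (3 - \<beta>) + 3 * 2 powr \<bar>\<beta>\<bar>\<close>. The dyadic blocks, each of cost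
  \<open>9 * 2 powr \<bar>\<beta>\<bar> * \<tau> * e\<^sup>2\<close>, add twice the largest one by a
  geometric series, hence 18 more.\<close>

definition competitor_const :: "real \<Rightarrow> real" where
  "competitor_const \<beta> = 1 / (3 - \<beta>) + 21 * 2 powr \<bar>\<beta>\<bar>"

text \<open>Dyadic blocks with tents of width \<open>e \<tau> powr (\<beta> / 2)\<close> are stacked down to the first scale
  \<open>\<tau> = z / 2 ^ K\<close> at which a single tent on \<open>{0..\<tau>}\<close> costs at most \<open>O(z e\<^sup>2)\<close>; above that scale the
  tents fit into their blocks.\<close>

lemma zigzag_competitor:
  assumes z: "0 < z" "z \<le> 1" and e: "0 < e" and \<beta>: "\<beta> < 3" "2 * \<alpha> \<ge> \<beta>"
    and large: "e\<^sup>2 \<le> z powr (3 - \<beta>)"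
  shows "zigzag \<alpha> \<beta> (e ^ 3) z 0 (ennreal (competitor_const \<beta> * z * e\<^sup>2))"
proof -
  define B where "B = 2 powr \<bar>\<beta>\<bar>"
  have B0: "0 < B" by (simp add: B_def)
  define D where "D = (1 / (3 - \<beta>) + 3 * B) * z * e\<^sup>2"
  have D0: "0 \<le> D" unfolding D_def using \<beta> B0 z by simp
  define t where "t k = z / 2 ^ k" for k :: nat
  have t0: "0 < t k" "t k \<le> z" for k using z by (auto simp: t_def field_simps)
  have "\<exists>k. t k powr (3 - \<beta>) \<le> z * e\<^sup>2"
  proof -
    have "(\<lambda>k. z * (1 / 2) ^ k) \<longlonglongrightarrow> z * 0"
      by (intro tendsto_mult tendsto_const LIMSEQ_power_zero) auto
    then have "t \<longlonglongrightarrow> 0" by (simp add: t_def[abs_def] power_divide)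
    then have "(\<lambda>k. t k powr (3 - \<beta>)) \<longlonglongrightarrow> 0 powr (3 - \<beta>)"
      by (rule tendsto_powr') (use \<beta> t0(1)[THEN less_imp_le] in auto)
    then have "\<forall>\<^sub>F k in sequentially. t k powr (3 - \<beta>) < z * e\<^sup>2"
      using z e by (intro order_tendstoD) auto
    then show ?thesis by (auto simp: eventually_sequentially intro: less_imp_le)
  qed
  \<comment> \<open>Taking the least \<open>K\<close> yields both sides of the alternative: the base
    tent is cheap at \<open>t K\<close>, and every coarser scale satisfies the hypothesis of
    \<open>scale_le\<close>.\<close>
  then obtain K where K: "t K powr (3 - \<beta>) \<le> z * e\<^sup>2" and least: "\<And>k. k < K \<Longrightarrow> z * e\<^sup>2 < t k powr (3 - \<beta>)"
    using exists_least_iff[of "\<lambda>k. t k powr (3 - \<beta>) \<le> z * e\<^sup>2"] by (auto simp: not_le)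
  have scale: "e * t k powr (\<beta> / 2) \<le> t k" if "k < K" for k
  proof (rule scale_le[OF e t0(1)])
    have "t k * e\<^sup>2 \<le> z * e\<^sup>2" using t0 by (intro mult_right_mono) auto
    then show "t k * e\<^sup>2 \<le> t k powr (3 - \<beta>)" using least[OF that] by linarith
  qed
  \<comment> \<open>If \<open>K = 0\<close> there is no coarser scale, and \<open>z\<close> itself
    serves as \<open>\<sigma>\<close>; \<open>large\<close> ensures that a tent fits there.\<close>
  have scale_z: "e * z powr (\<beta> / 2) \<le> z"
  proof (rule scale_le[OF e z(1)])
    have "z * e\<^sup>2 \<le> 1 * e\<^sup>2" using z by (intro mult_right_mono) auto
    then show "z * e\<^sup>2 \<le> z powr (3 - \<beta>)" using large by linarith
  qed
  have base: "zigzag \<alpha> \<beta> (e ^ 3) (t K) 0 (ennreal D)"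
  proof (cases K)
    case 0
    show ?thesis unfolding D_def B_def
      by (rule zigzag_base[where \<sigma> = z]) (use 0 z t0[of K] e \<beta> scale_z K in \<open>auto simp: t_def\<close>)
  next
    case (Suc k)
    have "t k = 2 * t K" by (simp add: Suc t_def)
    then show ?thesis unfolding D_def B_def
      using Suc z t0[of K] t0[of k] e \<beta> scale[of k] K by (intro zigzag_base[where \<sigma> = "t k"]) auto
  qed
  \<comment> \<open>The coefficient 18 is reproduced by the induction: half of it from the smaller
    scale plus the 9 of \<open>zigzag_block\<close>.\<close>
  have "j \<le> K \<Longrightarrow> zigzag \<alpha> \<beta> (e ^ 3) (t (K - j)) 0 (ennreal (18 * B * t (K - j) * e\<^sup>2 + D))" for j
  proof (induction j)
    case 0
    have "ennreal D \<le> ennreal (18 * B * t K * e\<^sup>2 + D)"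
      using B0 t0[of K] by (intro ennreal_leI) auto
    from zigzag_mono[OF base this] show ?case by simp
  next
    case (Suc j)
    let ?\<tau> = "t (K - Suc j)"
    have half: "t (K - j) = ?\<tau> / 2"
      using Suc.prems by (simp add: t_def Suc_diff_Suc[symmetric])
    have "zigzag \<alpha> \<beta> (e ^ 3) ?\<tau> 0 (ennreal (18 * B * (?\<tau> / 2) * e\<^sup>2 + D) + ennreal (9 * 2 powr \<bar>\<beta>\<bar> * ?\<tau> * e\<^sup>2))"
    proof (rule zigzag_block)
      show "zigzag \<alpha> \<beta> (e ^ 3) (?\<tau> / 2) 0 (ennreal (18 * B * (?\<tau> / 2) * e\<^sup>2 + D))"
        using Suc half by simp
      show "?\<tau> \<le> 1" using t0(2)[of "K - Suc j"] z by linarith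
      show "e * ?\<tau> powr (\<beta> / 2) \<le> ?\<tau>" using scale[of "K - Suc j"] Suc.prems by simp
    qed (use t0 e \<beta> in auto)
    also have "ennreal (18 * B * (?\<tau> / 2) * e\<^sup>2 + D) + ennreal (9 * 2 powr \<bar>\<beta>\<bar> * ?\<tau> * e\<^sup>2) =
      ennreal (18 * B * (?\<tau> / 2) * e\<^sup>2 + D + 9 * B * ?\<tau> * e\<^sup>2)"
      unfolding B_def[symmetric] using B0 D0 t0[of "K - Suc j"] by (intro ennreal_plus[symmetric]) auto
    also have "18 * B * (?\<tau> / 2) * e\<^sup>2 + D + 9 * B * ?\<tau> * e\<^sup>2 = 18 * B * ?\<tau> * e\<^sup>2 + D"
      by (simp add: field_simps)
    finally show ?case .
  qed
  from this[of K] have "zigzag \<alpha> \<beta> (e ^ 3) z 0 (ennreal (18 * B * z * e\<^sup>2 + D))"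
    by (simp add: t_def)
  moreover have "18 * B * z * e\<^sup>2 + D = competitor_const \<beta> * z * e\<^sup>2"
    by (simp add: D_def competitor_const_def B_def algebra_simps)
  ultimately show ?thesis by simp
qed

text \<open>Let the zigzag return to 0 at \<open>y - \<bar>m\<bar>\<close> and then run straight to
  \<open>m\<close>. The last piece has length and height \<open>\<bar>m\<bar>\<close>, whence the
  cubic term, and \<open>\<bar>m\<bar> \<le> y / 2\<close> keeps the weight on it comparable to
  \<open>y powr (- \<beta>)\<close>.\<close>

lemma zigzag_competitor_end:
  assumes y: "0 < y" "y \<le> 1" and e: "0 < e" and \<beta>: "\<beta> < 3" "2 * \<alpha> \<ge> \<beta>"
    and m: "\<bar>m\<bar> \<le> y / 2" and large: "e\<^sup>2 \<le> (y - \<bar>m\<bar>) powr (3 - \<beta>)"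
  shows "zigzag \<alpha> \<beta> (e ^ 3) y m
    (ennreal ((competitor_const \<beta> + 2 * 2 powr \<bar>\<beta>\<bar>) * y * e\<^sup>2 + 2 powr \<bar>\<beta>\<bar> * y powr (- \<beta>) * \<bar>m\<bar> ^ 3))"
proof -
  define B where "B = 2 powr \<bar>\<beta>\<bar>"
  have B0: "0 < B" by (simp add: B_def)
  have C0: "0 < competitor_const \<beta>" unfolding competitor_const_def using \<beta> by (intro add_pos_pos) auto
  define z where "z = y - \<bar>m\<bar>"
  have z: "0 < z" "z \<le> 1" "z \<le> y" "y \<le> 2 * z" using y m by (auto simp: z_def abs_if split: if_splits)
  have comp: "zigzag \<alpha> \<beta> (e ^ 3) z 0 (ennreal (competitor_const \<beta> * z * e\<^sup>2))"
    using z e \<beta> large by (intro zigzag_competitor) (auto simp: z_def)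
  show ?thesis
  proof (cases "m = 0")
    \<comment> \<open>Here the last piece is empty, and \<open>sgn m\<close> would not be a slope of
      modulus 1.\<close>
    case True
    have "competitor_const \<beta> * z * e\<^sup>2 \<le> (competitor_const \<beta> + 2 * B) * z * e\<^sup>2"
      using B0 z by (intro mult_right_mono) auto
    then have "ennreal (competitor_const \<beta> * z * e\<^sup>2) \<le> ennreal ((competitor_const \<beta> + 2 * B) * z * e\<^sup>2)"
      by (rule ennreal_leI)
    from zigzag_mono[OF comp this] True show ?thesis
      by (simp add: z_def B_def)
  next
    case False
    have "z * e\<^sup>2 \<le> 1 * e\<^sup>2" using z by (intro mult_right_mono) auto
    then have scale: "e * z powr (\<beta> / 2) \<le> z"
      using large by (intro scale_le e z) (simp add: z_def)
    have "zigzag \<alpha> \<beta> (e ^ 3) y (0 + sgn m * (y - z)) (ennreal (competitor_const \<beta> * z * e\<^sup>2)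
      + ennreal (2 * e ^ 3 * z powr \<alpha>) + elastic \<beta> (\<lambda>t. 0 + sgn m * (t - z)) z y)"
      by (rule zigzag_extend[OF comp]) (use z y e False in \<open>auto simp: z_def abs_sgn_eq\<close>)
    moreover have "0 + sgn m * (y - z) = m" by (simp add: z_def sgn_mult_abs)
    ultimately have "zigzag \<alpha> \<beta> (e ^ 3) y m (ennreal (competitor_const \<beta> * z * e\<^sup>2)
      + ennreal (2 * e ^ 3 * z powr \<alpha>) + elastic \<beta> (\<lambda>t. 0 + sgn m * (t - z)) z y)" by simp
    then show ?thesis
    proof (rule zigzag_mono)
      have "e ^ 3 * z powr \<alpha> \<le> B * e\<^sup>2 * (e * z powr (\<beta> / 2))"
        unfolding B_def using z e \<beta> by (intro kink_cost) auto
      also have "\<dots> \<le> B * e\<^sup>2 * y"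
        using scale z B0 by (intro mult_left_mono) auto
      finally have 1: "ennreal (2 * e ^ 3 * z powr \<alpha>) \<le> ennreal (2 * B * y * e\<^sup>2)"
        by (intro ennreal_leI) (simp add: ac_simps)
      have "elastic \<beta> (\<lambda>t. 0 + sgn m * (t - z)) z y \<le> ennreal (B * y powr - \<beta> * \<bar>m\<bar>\<^sup>2 * (y - z))"
      proof (rule elastic_le)
        show "t powr - \<beta> \<le> B * y powr - \<beta>" if "z < t" "t < y" for t
          unfolding B_def using that z y powr_comparable[of t y 2 "-\<beta>"] by auto
        show "\<bar>0 + sgn m * (t - z)\<bar> \<le> \<bar>m\<bar>" if "z < t" "t < y" for t
          using that False by (auto simp: abs_mult abs_sgn_eq z_def)
      qed (use z B0 in auto)
      also have "B * y powr - \<beta> * \<bar>m\<bar>\<^sup>2 * (y - z) = B * y powr - \<beta> * \<bar>m\<bar> ^ 3"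
        by (simp add: z_def power3_eq_cube power2_eq_square)
      finally have 2: "elastic \<beta> (\<lambda>t. 0 + sgn m * (t - z)) z y \<le> ennreal (B * y powr - \<beta> * \<bar>m\<bar> ^ 3)" .
      have 3: "ennreal (competitor_const \<beta> * z * e\<^sup>2) \<le> ennreal (competitor_const \<beta> * y * e\<^sup>2)"
        using C0 z by (intro ennreal_leI mult_right_mono mult_left_mono) auto
      have "ennreal (competitor_const \<beta> * z * e\<^sup>2) + ennreal (2 * e ^ 3 * z powr \<alpha>) + elastic \<beta> (\<lambda>t. 0 + sgn m * (t - z)) z y
        \<le> ennreal (competitor_const \<beta> * y * e\<^sup>2) + ennreal (2 * B * y * e\<^sup>2) + ennreal (B * y powr - \<beta> * \<bar>m\<bar> ^ 3)"
        using 1 2 3 by (intro add_mono)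
      also have "\<dots> = ennreal (competitor_const \<beta> * y * e\<^sup>2 + 2 * B * y * e\<^sup>2 + B * y powr - \<beta> * \<bar>m\<bar> ^ 3)"
        using B0 C0 y by (intro ennreal_plus3) auto
      also have "competitor_const \<beta> * y * e\<^sup>2 + 2 * B * y * e\<^sup>2 + B * y powr - \<beta> * \<bar>m\<bar> ^ 3 =
        (competitor_const \<beta> + 2 * B) * y * e\<^sup>2 + B * y powr - \<beta> * \<bar>m\<bar> ^ 3"
        by (simp add: algebra_simps)
      finally show "ennreal (competitor_const \<beta> * z * e\<^sup>2) + ennreal (2 * e ^ 3 * z powr \<alpha>) + elastic \<beta> (\<lambda>t. 0 + sgn m * (t - z)) z y
        \<le> ennreal ((competitor_const \<beta> + 2 * 2 powr \<bar>\<beta>\<bar>) * y * e\<^sup>2 + 2 powr \<bar>\<beta>\<bar> * y powr (- \<beta>) * \<bar>m\<bar> ^ 3)"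
        unfolding B_def .
    qed
  qed
qed

section \<open>The energy bound\<close>

lemma energy_upto_mono:
  assumes "x \<le> y"
  shows "energy_upto \<alpha> \<beta> \<epsilon> u x \<le> energy_upto \<alpha> \<beta> \<epsilon> u y"
  unfolding energy_upto_def
  by (intro add_mono nn_integral_mono) (use assms in \<open>auto simp: indicator_def\<close>)

lemma elastic_le_energy_upto:
  assumes "0 \<le> x"
  shows "elastic \<beta> u x y \<le> energy_upto \<alpha> \<beta> \<epsilon> u y"
proof -
  have "elastic \<beta> u x y \<le> elastic \<beta> u 0 y"
    unfolding elastic_def by (intro nn_integral_mono) (use assms in \<open>auto simp: indicator_def\<close>)
  then show ?thesis unfolding energy_upto_def elastic_def by (simp add: add_increasing)
qed

text \<open>Otherwise the integral would be at least \<open>2 * R\<close>; the factor 2 makes this a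
  contradiction to the bound by \<open>R > 0\<close>.\<close>

lemma exists_small_value:
  assumes "0 \<le> a" "a < b" and R: "0 < R" "elastic \<beta> u a b \<le> ennreal R"
  shows "\<exists>y. a < y \<and> y < b \<and> y powr (- \<beta>) * (u y)\<^sup>2 \<le> 2 * R / (b - a)"
proof (rule ccontr)
  assume "\<not> ?thesis"
  then have large: "2 * R / (b - a) \<le> y powr (- \<beta>) * (u y)\<^sup>2" if "a < y" "y < b" for y
    using that by (meson less_imp_le not_le)
  have "ennreal (2 * R) = ennreal (2 * R / (b - a)) * emeasure lebesgue {a<..<b}"
    using assms by (simp flip: ennreal_mult)
  also have "\<dots> = (\<integral>\<^sup>+ t. ennreal (2 * R / (b - a)) * indicator {a<..<b} t \<partial>lebesgue)"
    by (rule nn_integral_cmult_indicator[symmetric]) simp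
  also have "\<dots> \<le> elastic \<beta> u a b"
    unfolding elastic_def
    by (intro nn_integral_mono) (auto simp: indicator_def intro!: ennreal_leI large)
  also have "\<dots> \<le> ennreal R" by fact
  finally show False using R(1) by simp
qed

lemma competitor_const_pos: "\<beta> < 3 \<Longrightarrow> 0 < competitor_const \<beta>"
  unfolding competitor_const_def by (intro add_pos_pos) auto

lemma minimizer_total_energy:
  assumes u: "global_minimizer \<alpha> \<beta> (e ^ 3) u" and e: "0 < e" "e \<le> 1" and \<beta>: "\<beta> < 3" "2 * \<alpha> \<ge> \<beta>"
  shows "energy \<alpha> \<beta> (e ^ 3) u \<le> ennreal (competitor_const \<beta> * e\<^sup>2)"
proof -
  have "zigzag \<alpha> \<beta> (e ^ 3) 1 0 (ennreal (competitor_const \<beta> * 1 * e\<^sup>2))"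
    using e \<beta> by (intro zigzag_competitor) (auto simp: power_le_one)
  then obtain v where "v \<in> admissible" "energy \<alpha> \<beta> (e ^ 3) v \<le> ennreal (competitor_const \<beta> * e\<^sup>2)"
    by (auto elim: zigzag_admissible)
  with u show ?thesis unfolding global_minimizer_def by (meson order_trans)
qed

text \<open>Minimality against the glued function compares two sums with the common term
  \<open>R\<close>; finiteness of the total energy allows \<open>R\<close> to be cancelled.\<close>

lemma minimizer_energy_upto:
  assumes u: "global_minimizer \<alpha> \<beta> (e ^ 3) u" and e: "0 < e" "e \<le> 1" and \<beta>: "\<beta> < 3" "2 * \<alpha> \<ge> \<beta>"
    and y: "0 < y" "y < 1" and m: "\<bar>u y\<bar> \<le> y / 2" and large: "e\<^sup>2 \<le> (y - \<bar>u y\<bar>) powr (3 - \<beta>)"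
  shows "energy_upto \<alpha> \<beta> (e ^ 3) u y \<le>
    ennreal ((competitor_const \<beta> + 4 * 2 powr \<bar>\<beta>\<bar>) * y * e\<^sup>2 + 2 powr \<bar>\<beta>\<bar> * y powr (- \<beta>) * \<bar>u y\<bar> ^ 3)"
proof -
  define B where "B = 2 powr \<bar>\<beta>\<bar>"
  have B0: "0 < B" by (simp add: B_def)
  note C0 = competitor_const_pos[OF \<beta>(1)]
  let ?E = "(competitor_const \<beta> + 2 * B) * y * e\<^sup>2 + B * y powr (- \<beta>) * \<bar>u y\<bar> ^ 3"
  have zz: "zigzag \<alpha> \<beta> (e ^ 3) y (u y) (ennreal ?E)"
    unfolding B_def using y e \<beta> m large by (intro zigzag_competitor_end) auto
  have adm: "u \<in> admissible" using u by (simp add: global_minimizer_def)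
  have "0 < e ^ 3" using e by simp
  from zigzag_glue[OF adm y zz this]
  obtain v R where v: "v \<in> admissible" "energy \<alpha> \<beta> (e ^ 3) v \<le> ennreal ?E + ennreal (2 * e ^ 3 * y powr \<alpha>) + R"
    "energy_upto \<alpha> \<beta> (e ^ 3) u y + R \<le> energy \<alpha> \<beta> (e ^ 3) u" by metis
  have "energy \<alpha> \<beta> (e ^ 3) u < top"
    using minimizer_total_energy[OF u e \<beta>] by (meson ennreal_less_top order_le_less_trans)
  moreover have "R \<le> energy \<alpha> \<beta> (e ^ 3) u" using v(3) by (meson add_increasing order_refl order_trans zero_le)
  ultimately have "R < top" by (meson order_le_less_trans)
  moreover have "energy_upto \<alpha> \<beta> (e ^ 3) u y + R \<le> ennreal ?E + ennreal (2 * e ^ 3 * y powr \<alpha>) + R"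
    using u v unfolding global_minimizer_def by (meson order_trans)
  ultimately have 1: "energy_upto \<alpha> \<beta> (e ^ 3) u y \<le> ennreal ?E + ennreal (2 * e ^ 3 * y powr \<alpha>)"
    by (auto simp: add.commute[of _ R])
  \<comment> \<open>The kink created at \<open>y\<close> by gluing costs another
    \<open>2 * B * y * e\<^sup>2\<close>, which raises the coefficient \<open>2 * B\<close> of the
    competitor to \<open>4 * B\<close>.\<close>
  have "y * e\<^sup>2 \<le> 1 * e\<^sup>2" using y by (intro mult_right_mono) auto
  also have "\<dots> \<le> (y - \<bar>u y\<bar>) powr (3 - \<beta>)" using large by simp
  also have "\<dots> \<le> y powr (3 - \<beta>)" using \<beta> m y by (intro powr_mono2) auto
  finally have scale: "e * y powr (\<beta> / 2) \<le> y" using e y by (intro scale_le) auto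
  have "e ^ 3 * y powr \<alpha> \<le> B * e\<^sup>2 * (e * y powr (\<beta> / 2))"
    unfolding B_def using y e \<beta> by (intro kink_cost) auto
  also have "\<dots> \<le> B * e\<^sup>2 * y"
    using scale B0 by (intro mult_left_mono) auto
  finally have "ennreal (2 * e ^ 3 * y powr \<alpha>) \<le> ennreal (2 * B * y * e\<^sup>2)"
    by (intro ennreal_leI) (simp add: ac_simps)
  with 1 have "energy_upto \<alpha> \<beta> (e ^ 3) u y \<le> ennreal ?E + ennreal (2 * B * y * e\<^sup>2)"
    by (meson add_left_mono order_trans)
  also have "\<dots> = ennreal (?E + 2 * B * y * e\<^sup>2)"
    using B0 C0 y by (intro ennreal_plus[symmetric]) auto
  also have "?E + 2 * B * y * e\<^sup>2 = (competitor_const \<beta> + 4 * B) * y * e\<^sup>2 + B * y powr (- \<beta>) * \<bar>u y\<bar> ^ 3"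
    by (simp add: algebra_simps)
  finally show ?thesis unfolding B_def .
qed

text \<open>
  Averaging the elastic energy over \<open>{x<..<2 * x}\<close> yields a point \<open>y\<close> where \<open>u y\<close> is small, and
  replacing \<open>u\<close> on \<open>{0..y}\<close> by a competitor costs \<open>O(x e\<^sup>2)\<close> plus a small multiple of the bound
  for \<open>2 * x\<close>; this is why a bound at scale \<open>2 * x\<close> propagates to \<open>x\<close> with the same constant.
\<close>

lemma energy_upto_halving:
  fixes \<alpha> \<beta> e \<Lambda> \<mu> K x :: real
  defines "B \<equiv> 2 powr \<bar>\<beta>\<bar>" and "C \<equiv> competitor_const \<beta>"
  assumes u: "global_minimizer \<alpha> \<beta> (e ^ 3) u" and e: "0 < e" "e \<le> 1" and \<beta>: "\<beta> < 3" "2 * \<alpha> \<ge> \<beta>"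
    and \<mu>: "\<mu> = 1 / (16 * B)" and \<Lambda>: "4 * C \<le> \<Lambda> * \<mu>\<^sup>2" "2 powr (3 - \<beta>) \<le> \<Lambda>" and K: "K = 4 * (C + 4 * B)"
    and x: "0 < x" "2 * x \<le> 1" "\<Lambda> * e\<^sup>2 \<le> x powr (3 - \<beta>)"
    and IH: "energy_upto \<alpha> \<beta> (e ^ 3) u (2 * x) \<le> ennreal (K * (2 * x) * e\<^sup>2)"
  shows "energy_upto \<alpha> \<beta> (e ^ 3) u x \<le> ennreal (K * x * e\<^sup>2)"
proof -
  have B1: "1 \<le> B" by (simp add: B_def ge_one_powr_ge_zero)
  have C0: "0 < C" unfolding C_def using \<beta> by (intro competitor_const_pos)
  have K0: "0 < K" using K C0 B1 by simp
  have \<mu>0: "0 < \<mu>" "\<mu> \<le> 1 / 2" "8 * B * \<mu> = 1 / 2" using B1 by (auto simp: \<mu> field_simps)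
  have \<Lambda>0: "0 < \<Lambda>" by (rule less_le_trans[OF _ \<Lambda>(2)]) simp
  \<comment> \<open>The two bounds have different uses: the one from \<open>2 * x\<close> enters the
    contraction, and the total energy \<open>C * e\<^sup>2\<close> makes
    \<open>\<bar>u y\<bar>\<close> small against \<open>y\<close> through
    \<open>\<Lambda>\<close>.\<close>
  define R where "R = min (K * (2 * x) * e\<^sup>2) (C * e\<^sup>2)"
  have R0: "0 < R" using K0 C0 x e by (simp add: R_def)
  have "energy_upto \<alpha> \<beta> (e ^ 3) u (2 * x) \<le> energy_upto \<alpha> \<beta> (e ^ 3) u 1"
    using x by (intro energy_upto_mono)
  also have "\<dots> \<le> ennreal (C * e\<^sup>2)"
    using minimizer_total_energy[OF u e \<beta>] by (simp add: energy_def C_def)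
  finally have "energy_upto \<alpha> \<beta> (e ^ 3) u (2 * x) \<le> ennreal R"
    using IH by (auto simp: R_def min_def)
  then have "elastic \<beta> u x (2 * x) \<le> ennreal R"
    using elastic_le_energy_upto[of x \<beta> u "2 * x" \<alpha> "e ^ 3"] x by (meson less_imp_le order_trans)
  from exists_small_value[OF _ _ R0 this] x obtain y where y: "x < y" "y < 2 * x"
    and uy: "y powr (- \<beta>) * (u y)\<^sup>2 \<le> 2 * R / x" by auto
  define q where "q = y powr (- \<beta>) * (u y)\<^sup>2"
  have q: "q \<le> 4 * K * e\<^sup>2" "q \<le> 4 * C * e\<^sup>2 / y" "0 \<le> q"
  proof -
    have "2 * R / x \<le> 2 * (K * (2 * x) * e\<^sup>2) / x" using x by (intro divide_right_mono) (auto simp: R_def)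
    then show "q \<le> 4 * K * e\<^sup>2" using uy x by (simp add: q_def)
    have "2 * R / x \<le> 2 * (C * e\<^sup>2) / x" using x by (intro divide_right_mono) (auto simp: R_def)
    also have "\<dots> \<le> 4 * C * e\<^sup>2 / y"
      using mult_right_mono[of y "2 * x" "2 * C * e\<^sup>2"] x y C0 by (simp add: field_simps)
    finally show "q \<le> 4 * C * e\<^sup>2 / y" using uy by (simp add: q_def)
  qed (simp add: q_def)
  have xy: "x powr (3 - \<beta>) \<le> y powr (3 - \<beta>)" using x y \<beta> by (intro powr_mono2) auto
  have y0: "0 < y" "y < 1" using x y by auto
  \<comment> \<open>Here the exponent \<open>3 - \<beta>\<close> is used:
    \<open>\<Lambda> * e\<^sup>2 \<le> x powr (3 - \<beta>)\<close> turns the total-energy bound on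
    \<open>q\<close> into \<open>\<bar>u y\<bar> \<le> \<mu> * y\<close>.\<close>
  have "(u y)\<^sup>2 = y powr \<beta> * q" using y0 by (simp add: q_def flip: mult.assoc powr_add)
  also have "\<dots> \<le> y powr \<beta> * (4 * C * e\<^sup>2 / y)" using q by (intro mult_left_mono) auto
  also have "\<dots> \<le> y powr \<beta> * (\<Lambda> * \<mu>\<^sup>2 * e\<^sup>2 / y)"
    using \<Lambda> y0 by (intro mult_left_mono divide_right_mono mult_right_mono) auto
  also have "\<dots> = y powr \<beta> * (\<mu>\<^sup>2 * (\<Lambda> * e\<^sup>2) / y)" by (simp add: ac_simps)
  also have "\<dots> \<le> y powr \<beta> * (\<mu>\<^sup>2 * y powr (3 - \<beta>) / y)"
    using x(3) xy y0 by (intro mult_left_mono divide_right_mono) auto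
  also have "\<dots> = \<mu>\<^sup>2 * (y powr \<beta> * y powr (3 - \<beta>)) / y" by simp
  also have "y powr \<beta> * y powr (3 - \<beta>) = y ^ 3" using y0 by (simp flip: powr_add)
  also have "\<mu>\<^sup>2 * y ^ 3 / y = (\<mu> * y)\<^sup>2" using y0 by (simp add: power2_eq_square power3_eq_cube)
  finally have m: "\<bar>u y\<bar> \<le> \<mu> * y" using \<mu>0 y0 by (intro power2_le_imp_le[of "\<bar>u y\<bar>"]) auto
  have half: "\<bar>u y\<bar> \<le> y / 2" using m mult_right_mono[OF \<mu>0(2), of y] y0 by linarith
  \<comment> \<open>The zigzag has to end at \<open>y - \<bar>u y\<bar>\<close>, possibly as small
    as \<open>y / 2\<close>; the bound \<open>2 powr (3 - \<beta>) \<le> \<Lambda>\<close> pays for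
    this halving.\<close>
  have "2 powr (3 - \<beta>) * e\<^sup>2 \<le> \<Lambda> * e\<^sup>2" using \<Lambda> by (intro mult_right_mono) auto
  also have "\<dots> \<le> y powr (3 - \<beta>)" using x xy by linarith
  also have "\<dots> = 2 powr (3 - \<beta>) * (y / 2) powr (3 - \<beta>)" using y0 by (simp flip: powr_mult)
  finally have "e\<^sup>2 \<le> (y / 2) powr (3 - \<beta>)" by simp
  also have "\<dots> \<le> (y - \<bar>u y\<bar>) powr (3 - \<beta>)" using half y0 \<beta> by (intro powr_mono2) auto
  finally have large: "e\<^sup>2 \<le> (y - \<bar>u y\<bar>) powr (3 - \<beta>)" .
  have "energy_upto \<alpha> \<beta> (e ^ 3) u x \<le> energy_upto \<alpha> \<beta> (e ^ 3) u y"
    using y by (intro energy_upto_mono) auto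
  also have "\<dots> \<le> ennreal ((C + 4 * B) * y * e\<^sup>2 + B * y powr (- \<beta>) * \<bar>u y\<bar> ^ 3)"
    unfolding B_def C_def by (rule minimizer_energy_upto[OF u e \<beta> y0 half large])
  also have "\<dots> \<le> ennreal (K * x * e\<^sup>2)"
  proof (rule ennreal_leI)
    \<comment> \<open>The cubic term is \<open>q\<close> times \<open>\<bar>u y\<bar>\<close>: the
      hypothesis at \<open>2 * x\<close> bounds \<open>q\<close>, and \<open>\<mu> * (2 * x)\<close>
      bounds the rest. The value of \<open>\<mu>\<close> makes the product half of the target, and
      \<open>K\<close> is chosen so that the competitor fills the other half.\<close>
    have "\<bar>u y\<bar> \<le> \<mu> * (2 * x)" using m y \<mu>0 by (smt (verit) mult_left_mono)
    then have "B * (q * \<bar>u y\<bar>) \<le> B * ((4 * K * e\<^sup>2) * (\<mu> * (2 * x)))"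
      using B1 q K0 by (intro mult_left_mono mult_mono) auto
    also have "\<dots> = (8 * B * \<mu>) * (K * x * e\<^sup>2)" by simp
    also have "\<dots> = K * x * e\<^sup>2 / 2" by (simp add: \<mu>0(3))
    finally have 1: "B * (q * \<bar>u y\<bar>) \<le> K * x * e\<^sup>2 / 2" .
    have "(C + 4 * B) * y * e\<^sup>2 \<le> (C + 4 * B) * (2 * x) * e\<^sup>2"
      using C0 B1 y by (intro mult_right_mono mult_left_mono) auto
    also have "\<dots> = K * x * e\<^sup>2 / 2" by (simp add: K)
    finally have 2: "(C + 4 * B) * y * e\<^sup>2 \<le> K * x * e\<^sup>2 / 2" .
    have "B * y powr (- \<beta>) * \<bar>u y\<bar> ^ 3 = B * (q * \<bar>u y\<bar>)"
      by (simp add: q_def power3_eq_cube power2_eq_square abs_mult_self_eq mult.assoc)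
    with 1 2 show "(C + 4 * B) * y * e\<^sup>2 + B * y powr (- \<beta>) * \<bar>u y\<bar> ^ 3 \<le> K * x * e\<^sup>2" by linarith
  qed
  finally show ?thesis .
qed

theorem theorem3p1:
  fixes \<alpha> \<beta> :: real
  assumes "\<beta> < 3" and "2 * \<alpha> \<ge> \<beta>"
  shows "\<exists>c\<^sub>1 c\<^sub>2 :: real. c\<^sub>1 > 0 \<and> c\<^sub>2 > 0 \<and>
    (\<forall>\<epsilon> u x. \<epsilon> > 0 \<longrightarrow> global_minimizer \<alpha> \<beta> \<epsilon> u \<longrightarrow> x \<in> {0..1} \<longrightarrow>
       x \<ge> c\<^sub>1 * \<epsilon> powr (2 / (9 - 3 * \<beta>)) \<longrightarrow>
       energy_upto \<alpha> \<beta> \<epsilon> u x \<le> ennreal (c\<^sub>2 * x * \<epsilon> powr (2 / 3)))"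
proof -
  define B where "B = 2 powr \<bar>\<beta>\<bar>"
  define C where "C = competitor_const \<beta>"
  define \<mu> where "\<mu> = 1 / (16 * B)"
  define \<Lambda> where "\<Lambda> = max (4 * C / \<mu>\<^sup>2) (2 powr (3 - \<beta>))"
  define K where "K = 4 * (C + 4 * B)"
  \<comment> \<open>With this constant the assumption on \<open>x\<close>, raised to the power
    \<open>3 - \<beta>\<close>, becomes
    \<open>\<Lambda> * e\<^sup>2 \<le> x powr (3 - \<beta>)\<close>.\<close>
  define c where "c = \<Lambda> powr (1 / (3 - \<beta>))"
  have B1: "1 \<le> B" by (simp add: B_def ge_one_powr_ge_zero)
  have C0: "0 < C" unfolding C_def using assms by (intro competitor_const_pos)
  have K0: "0 < K" using C0 B1 by (simp add: K_def)
  have \<mu>0: "0 < \<mu>" using B1 by (simp add: \<mu>_def)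
  have \<Lambda>1: "1 \<le> \<Lambda>" using assms by (simp add: \<Lambda>_def le_max_iff_disj ge_one_powr_ge_zero)
  have \<Lambda>: "4 * C \<le> \<Lambda> * \<mu>\<^sup>2" "2 powr (3 - \<beta>) \<le> \<Lambda>"
    using \<mu>0 by (auto simp: \<Lambda>_def pos_divide_le_eq[symmetric])
  have "energy_upto \<alpha> \<beta> \<epsilon> u x \<le> ennreal (K * x * \<epsilon> powr (2 / 3))"
    if \<epsilon>: "\<epsilon> > 0" and u: "global_minimizer \<alpha> \<beta> \<epsilon> u" and x: "x \<in> {0..1}" "x \<ge> c * \<epsilon> powr (2 / (9 - 3 * \<beta>))" for \<epsilon> u x
  proof -
    define e where "e = \<epsilon> powr (1 / 3)"
    have e0: "0 < e" using \<epsilon> by (simp add: e_def)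
    have e3: "e ^ 3 = \<epsilon>" using \<epsilon> by (simp add: e_def powr_powr flip: powr_realpow)
    have e2: "e\<^sup>2 = \<epsilon> powr (2 / 3)" using \<epsilon> by (simp add: e_def powr_powr flip: powr_realpow)
    have "0 < c * \<epsilon> powr (2 / (9 - 3 * \<beta>))" using \<Lambda>1 \<epsilon> by (simp add: c_def)
    then have x0: "0 < x" using x by linarith
    have "\<Lambda> * e\<^sup>2 = (c * \<epsilon> powr (2 / (9 - 3 * \<beta>))) powr (3 - \<beta>)"
    proof -
      have "2 / (9 - 3 * \<beta>) * (3 - \<beta>) = 2 / 3" using assms by (simp add: field_simps)
      then have "(\<epsilon> powr (2 / (9 - 3 * \<beta>))) powr (3 - \<beta>) = e\<^sup>2" by (simp only: powr_powr e2)
      moreover have "c powr (3 - \<beta>) = \<Lambda>" using \<Lambda>1 assms by (simp add: c_def powr_powr)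
      ultimately show ?thesis using \<Lambda>1 by (simp add: powr_mult c_def)
    qed
    also have "\<dots> \<le> x powr (3 - \<beta>)" using x assms \<Lambda>1 by (intro powr_mono2) (auto simp: c_def)
    finally have xl: "\<Lambda> * e\<^sup>2 \<le> x powr (3 - \<beta>)" .
    \<comment> \<open>As \<open>x \<le> 1\<close> and \<open>1 \<le> \<Lambda>\<close>, the
      assumption on \<open>x\<close> can hold only if \<open>e \<le> 1\<close>, which the
      total-energy bound requires.\<close>
    have "1 * e\<^sup>2 \<le> \<Lambda> * e\<^sup>2" using \<Lambda>1 by (intro mult_right_mono) auto
    also note xl
    also have "x powr (3 - \<beta>) \<le> 1" using x x0 assms by (intro powr_le1) auto
    finally have "e\<^sup>2 \<le> 1\<^sup>2" by simp
    then have e1: "e \<le> 1" by (rule power2_le_imp_le) simp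
    have u': "global_minimizer \<alpha> \<beta> (e ^ 3) u" using u by (simp add: e3)
    \<comment> \<open>Above 1/2 the total energy already suffices, because
      \<open>C \<le> K / 2\<close>.\<close>
    have coarse: "energy_upto \<alpha> \<beta> (e ^ 3) u s \<le> ennreal (K * s * e\<^sup>2)" if "1 / 2 < s" "s \<le> 1" for s
    proof -
      have "energy_upto \<alpha> \<beta> (e ^ 3) u s \<le> energy_upto \<alpha> \<beta> (e ^ 3) u 1" using that by (intro energy_upto_mono)
      also have "\<dots> \<le> ennreal (C * e\<^sup>2)"
        using minimizer_total_energy[OF u' e0 e1 assms] by (simp add: energy_def C_def)
      also have "\<dots> \<le> ennreal (K * s * e\<^sup>2)"
      proof (intro ennreal_leI mult_right_mono)
        have "C \<le> K * (1 / 2)" using C0 B1 by (simp add: K_def)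
        also have "\<dots> \<le> K * s" using that K0 by (intro mult_left_mono) auto
        finally show "C \<le> K * s" .
      qed simp
      finally show ?thesis .
    qed
    \<comment> \<open>Induction on a number \<open>n\<close> of doublings that carry
      \<open>s\<close> beyond 1/2. The lower bound on \<open>s\<close> passes to
      \<open>2 * s\<close> because \<open>3 - \<beta>\<close> is positive.\<close>
    have "energy_upto \<alpha> \<beta> (e ^ 3) u s \<le> ennreal (K * s * e\<^sup>2)"
      if "0 < s" "s \<le> 1" "\<Lambda> * e\<^sup>2 \<le> s powr (3 - \<beta>)" "1 / 2 < s * 2 ^ n" for s n
      using that
    proof (induction n arbitrary: s)
      case 0
      then show ?case using coarse by simp
    next
      case (Suc n)
      show ?case
      proof (cases "1 / 2 < s")
        case True
        then show ?thesis using coarse Suc.prems by simp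
      next
        case False
        have "s powr (3 - \<beta>) \<le> (2 * s) powr (3 - \<beta>)" using Suc.prems assms by (intro powr_mono2) auto
        then have "energy_upto \<alpha> \<beta> (e ^ 3) u (2 * s) \<le> ennreal (K * (2 * s) * e\<^sup>2)"
          using Suc.prems False by (intro Suc.IH) (auto simp: mult_ac)
        then show ?thesis
          using energy_upto_halving[OF u' e0 e1 assms, of \<mu> \<Lambda> K s] \<Lambda> Suc.prems False
          by (simp add: B_def C_def \<mu>_def K_def)
      qed
    qed
    moreover obtain n where "1 / 2 / x < 2 ^ n" using real_arch_pow[of 2 "1 / 2 / x"] by auto
    then have "1 / 2 < x * 2 ^ n" using x0 by (simp add: field_simps)
    ultimately show ?thesis using x x0 xl by (simp add: e3 e2)
  qed
  moreover have "0 < c" using \<Lambda>1 by (simp add: c_def)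
  ultimately show ?thesis using K0 by blast
qed

end
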